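(* Let $v\in H^1(\Omega)$ be an approximation of the exact solution $u$ of the boundary-value problem $\operatorname{div}(A\nabla u)+f=0$ in $\Omega$, $u=u_g$ on $\Gamma=\partial\Omega$, such that $v$ satisfies the boundary condition $v=u_g$ on $\Gamma$. Let $\boldsymbol{y}=(\boldsymbol{y}_1,\ldots,\boldsymbol{y}_N)\in H(\bigcup_j\omega_j,\operatorname{div})$ satisfy the two constraints (A.1) for every interior interface $\gamma_{kj}\in\mathcal{E}_1$, $$\frac{1}{|\gamma_{kj}|}\int_{\gamma_{kj}}\left(\boldsymbol{y}_k\cdot\boldsymbol{n}_{kj}-\boldsymbol{y}_j\cdot\boldsymbol{n}_{kj}\right)ds=0;$$ (A.2) for every $j=1,\ldots,N$, $$\frac{1}{|\omega_j|}\int_{\omega_j}\left(\operatorname{div}\boldsymbol{y}_j+f\right)dx=0.$$ Then $$ \|\nabla(u-v)\|_{A,\Omega}\le\left(\sum_{k=1}^N\|\boldsymbol{y}_k-A\nabla v\|^2_{A^{-1},\omega_k}\right)^{1/2}+\frac{1}{\sqrt{C_{\min}}}\left[C_{\mathrm{P},\max}\left(\sum_{k=1}^N\|\operatorname{div}\boldsymbol{y}_k+f\|^2_{\omega_k}\right)^{1/2}+\sqrt{E_{\max}}\left(\sum_{\gamma_{kj}\in\mathcal{E}_1}\beta_{kj}^2\,\|(\boldsymbol{y}_k-\boldsymbol{y}_j)\cdot\boldsymbol{n}_{kj}\|^2_{\gamma_{kj}}\right)^{1/2}\right]. $$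
   Context: **Domain and problem.** $\Omega\subset\mathbb{R}^d$ is a bounded polygonal (polyhedral) Lipschitz domain with boundary $\Gamma=\partial\Omega$; $f\in L^2(\Omega)$; $u_g\in H^1(\Omega)$ is given. $A$ is a symmetric positive definite $d\times d$ matrix with constants $0<C_{\min}\le C_{\max}$ such that $C_{\min}\|\xi\|^2\le A\xi\cdot\xi\le C_{\max}\|\xi\|^2$ for all $\xi\in\mathbb{R}^d$. The exact solution $u\in H^1(\Omega)$ is the weak solution: $u=u_g$ on $\Gamma$ (equality of traces) and $\int_\Omega A\nabla u\cdot\nabla w\,dx=\int_\Omega fw\,dx$ for all $w\in H^1_0(\Omega)$. **Partition into basic subdomains.** $\Omega$ is partitioned into finitely many convex subdomains $\omega_1,\ldots,\omega_N$ (e.g. triangles or quadrilaterals for $d=2$, tetrahedra or hexahedra for $d=3$): $\overline\Omega=\bigcup_{k=1}^N\overline{\omega}_k$ and $\omega_i\cap\omega_j=\emptyset$ for $i\neq j$. For $k\ne j$, the interface is $\gamma_{kj}=\gamma_{jk}=\overline{\omega}_k\cap\overline{\omega}_j$, considered only when it has positive surface measure (otherwise the two cells are regarded as non-intersecting). $\mathcal{E}_1$ is the set of all these interior interfaces, each counted once. $\boldsymbol{n}_{kj}$ is a unit normal to $\gamma_{kj}$. $E_{\max}$ is the maximum number of interfaces in $\mathcal{E}_1$ associated with a single basic subdomain $\omega_k$. **Broken space.** $H(\omega_j,\operatorname{div})=\{\boldsymbol{q}\in[L^2(\omega_j)]^d:\operatorname{div}\boldsymbol{q}\in L^2(\omega_j)\}$,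 and $H(\bigcup_j\omega_j,\operatorname{div})=\{\boldsymbol{q}\in[L^2(\Omega)]^d:\boldsymbol{q}=\boldsymbol{q}_j\text{ in }\omega_j,\ \boldsymbol{q}_j\in H(\omega_j,\operatorname{div})\text{ for all }j=1,\ldots,N\}$. For $\boldsymbol{y}$ in this space, $\boldsymbol{y}_j$ denotes the restriction of $\boldsymbol{y}$ to $\omega_j$. The normal traces $\boldsymbol{y}_k\cdot\boldsymbol{n}_{kj}$ and $\boldsymbol{y}_j\cdot\boldsymbol{n}_{kj}$ on each interface $\gamma_{kj}$ (taken from $\omega_k$ and $\omega_j$ respectively) are assumed to be functions in $L^2(\gamma_{kj})$. **Norms.** For a set $\omega\subseteq\Omega$: $\|\cdot\|_\omega$ is the $L^2(\omega)$ norm (scalar or vector valued), $\|\boldsymbol{q}\|^2_{A,\omega}=\int_\omega A\boldsymbol{q}\cdot\boldsymbol{q}\,dx$, and $\|\boldsymbol{q}\|^2_{A^{-1},\omega}=\int_\omega A^{-1}\boldsymbol{q}\cdot\boldsymbol{q}\,dx$. For an interface $\gamma$, $\|\cdot\|_\gamma$ is the $L^2(\gamma)$ norm. **Constants.** $C_{\mathrm{P},j}$ is a constant in the Poincaré inequality on $\omega_j$: $\|w-c_j\|_{\omega_j}\le C_{\mathrm{P},j}\|\nabla w\|_{\omega_j}$ for all $w\in H^1(\omega_j)$, where $c_j=\frac1{|\omega_j|}\int_{\omega_j}w\,dx$; and $C_{\mathrm{P},\max}=\max_{j=1,\ldots,N}C_{\mathrm{P},j}$. For a bounded Lipschitz domain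 $\omega$ and a connected part $\gamma\subset\partial\omega$ of positive surface measure, $C_{\mathrm{P}}(\gamma,\omega)$ is a constant such that $\|w\|_\gamma\le C_{\mathrm{P}}(\gamma,\omega)\|\nabla w\|_\omega$ for all $w\in H^1(\omega)$ with $\frac{1}{|\gamma|}\int_\gamma w\,ds=0$. Finally, $$\beta_{kj}=\sqrt{\frac{C_{\mathrm{P}}(\gamma_{kj},\omega_j)^2+C_{\mathrm{P}}(\gamma_{kj},\omega_k)^2}{2}}.$$ *)

theory Defs
  imports "HOL-Analysis.Analysis"
begin

section \<open>Square integrable functions\<close>

definition L2 :: "'a measure \<Rightarrow> ('a \<Rightarrow> 'b::euclidean_space) \<Rightarrow> bool" where
  "L2 M h \<longleftrightarrow> h \<in> borel_measurable M \<and> integrable M (\<lambda>x. (norm (h x))\<^sup>2)"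

definition L2norm :: "'a measure \<Rightarrow> ('a \<Rightarrow> 'b::euclidean_space) \<Rightarrow> real" where
  "L2norm M h = sqrt (\<integral>x. (norm (h x))\<^sup>2 \<partial>M)"

definition matrix_norm_on ::
    "real^'n^'n \<Rightarrow> (real^'n) set \<Rightarrow> (real^'n \<Rightarrow> real^'n) \<Rightarrow> real" where
  "matrix_norm_on B S q = sqrt (\<integral>x. (B *v q x) \<bullet> q x \<partial>lebesgue_on S)"


section \<open>Surface measure\<close>

text \<open>
  For a Borel subset S of a hyperplane H, the (d-1)-dimensional area of S is the volume of
  the prism of height 1 with cross section S (here centred at H). The area of a Borel set
  contained in finitely (or countably) many hyperplanes is the sum of the areas of its
  intersections with all hyperplanes, since two different hyperplanes meet in a set of
  area 0. On such sets, in particular on subsets of the boundary of a polyhedral set, this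
  is the usual surface measure, that is, the (d-1)-dimensional Hausdorff measure. It
  carries no information about curved surfaces, which do not occur here.
\<close>

definition hyperplanes :: "'a::euclidean_space set set" where
  "hyperplanes = {{x. n \<bullet> x = b} | n b. norm n = 1}"

definition flat_area :: "'a::euclidean_space set \<Rightarrow> 'a set \<Rightarrow> ennreal" where
  "flat_area H S = emeasure lborel {x. infdist x H \<le> 1/2 \<and> closest_point H x \<in> S}"

definition surface :: "'a::euclidean_space measure" where
  "surface = measure_of UNIV (sets borel)
     (\<lambda>S. \<integral>\<^sup>+ H. flat_area H S \<partial>count_space hyperplanes)"

lemma sets_surface [measurable_cong, simp]: "sets surface = sets borel"
  and space_surface [simp]: "space surface = UNIV"
  unfolding surface_def by (simp_all add: sets.sigma_sets_eq[of borel, simplified])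

lemma flat_area_suminf:
  fixes H :: "'a::euclidean_space set"
  assumes H: "H \<in> hyperplanes" and F: "range F \<subseteq> sets borel" "disjoint_family F"
  shows "(\<Sum>i. flat_area H (F i)) = flat_area H (\<Union>i. F i)"
proof -
  obtain n b where n: "norm n = 1" and Hd: "H = {x. n \<bullet> x = b}"
    using H by (auto simp: hyperplanes_def)
  have "n \<bullet> (b *\<^sub>R n) = b"
    using n by (simp add: norm_eq_1)
  then have "H \<noteq> {}"
    using Hd by blast
  then have c: "continuous_on UNIV (closest_point H)"
    unfolding Hd
    by (intro continuous_on_closest_point) (auto simp: convex_hyperplane closed_hyperplane)
  define G where "G i = {x. infdist x H \<le> 1/2 \<and> closest_point H x \<in> F i}" for i :: nat
  have "G i \<in> sets borel" for i
  proof -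
    have "closest_point H \<in> borel_measurable borel"
      using c by (rule borel_measurable_continuous_onI)
    moreover have "(\<lambda>x. infdist x H) \<in> borel_measurable borel"
      by (intro borel_measurable_continuous_onI continuous_intros)
    moreover have "F i \<in> sets borel"
      using F by auto
    ultimately have "{x \<in> space borel. infdist x H \<le> 1/2 \<and> closest_point H x \<in> F i} \<in> sets borel"
      by measurable
    then show ?thesis
      by (simp add: G_def)
  qed
  moreover have "disjoint_family G"
    using F(2) by (auto simp: disjoint_family_on_def G_def)
  ultimately have "(\<Sum>i. emeasure lborel (G i)) = emeasure lborel (\<Union>i. G i)"
    by (intro suminf_emeasure) auto
  moreover have "(\<Union>i. G i) = {x. infdist x H \<le> 1/2 \<and> closest_point H x \<in> (\<Union>i. F i)}"
    by (auto simp: G_def)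
  ultimately show ?thesis
    by (simp add: flat_area_def G_def)
qed

lemma emeasure_surface:
  fixes S :: "'a::euclidean_space set"
  assumes "S \<in> sets borel"
  shows "emeasure surface S = (\<integral>\<^sup>+ H. flat_area H S \<partial>count_space hyperplanes)"
proof (rule emeasure_measure_of[OF surface_def])
  show "positive (sets surface) (\<lambda>S::'a set. \<integral>\<^sup>+ H. flat_area H S \<partial>count_space hyperplanes)"
    by (simp add: positive_def flat_area_def)
  show "countably_additive (sets surface)
      (\<lambda>S::'a set. \<integral>\<^sup>+ H. flat_area H S \<partial>count_space hyperplanes)"
  proof (rule countably_additiveI)
    fix F :: "nat \<Rightarrow> 'a set"
    assume F: "range F \<subseteq> sets surface" "disjoint_family F"
    have "(\<Sum>i. \<integral>\<^sup>+ H. flat_area H (F i) \<partial>count_space hyperplanes)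
        = (\<integral>\<^sup>+ H. (\<Sum>i. flat_area H (F i)) \<partial>count_space hyperplanes)"
      by (rule nn_integral_suminf[symmetric]) simp
    also have "\<dots> = (\<integral>\<^sup>+ H. flat_area H (\<Union>i. F i) \<partial>count_space hyperplanes)"
      using F by (intro nn_integral_cong) (simp add: flat_area_suminf)
    finally show "(\<Sum>i. \<integral>\<^sup>+ H. flat_area H (F i) \<partial>count_space hyperplanes)
        = (\<integral>\<^sup>+ H. flat_area H (\<Union>i. F i) \<partial>count_space hyperplanes)" .
  qed
qed (use assms in auto)

definition surface_on :: "'a::euclidean_space set \<Rightarrow> 'a measure" where
  "surface_on S = restrict_space surface S"


section \<open>Weak derivatives\<close>

primrec dir_derivs :: "'a::euclidean_space list \<Rightarrow> ('a \<Rightarrow> real) \<Rightarrow> 'a \<Rightarrow> real" where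
  "dir_derivs [] \<phi> = \<phi>"
| "dir_derivs (v # vs) \<phi> = (\<lambda>x. frechet_derivative (dir_derivs vs \<phi>) (at x) v)"

definition test_function :: "'a::euclidean_space set \<Rightarrow> ('a \<Rightarrow> real) \<Rightarrow> bool" where
  "test_function S \<phi> \<longleftrightarrow>
     (\<forall>vs x. dir_derivs vs \<phi> differentiable at x) \<and>
     (\<exists>K. compact K \<and> K \<subseteq> S \<and> (\<forall>x. x \<notin> K \<longrightarrow> \<phi> x = 0))"

text \<open>
  Weak gradients and weak divergences are determined only up to null sets, so they enter as
  relations: \<open>H1 S w Dw\<close> says that w belongs to \<open>H\<^sup>1(S)\<close> and has weak gradient Dw, and
  \<open>Hdiv S q dq\<close> says that q belongs to \<open>H(S, div)\<close> and has weak divergence dq.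
\<close>

definition H1 :: "'a::euclidean_space set \<Rightarrow> ('a \<Rightarrow> real) \<Rightarrow> ('a \<Rightarrow> 'a) \<Rightarrow> bool" where
  "H1 S w Dw \<longleftrightarrow>
     L2 (lebesgue_on S) w \<and> L2 (lebesgue_on S) Dw \<and>
     (\<forall>\<phi>. test_function S \<phi> \<longrightarrow> (\<forall>i\<in>Basis.
        (\<integral>x. w x * frechet_derivative \<phi> (at x) i \<partial>lebesgue_on S)
          = - (\<integral>x. (Dw x \<bullet> i) * \<phi> x \<partial>lebesgue_on S)))"

definition Hdiv :: "'a::euclidean_space set \<Rightarrow> ('a \<Rightarrow> 'a) \<Rightarrow> ('a \<Rightarrow> real) \<Rightarrow> bool" where
  "Hdiv S q dq \<longleftrightarrow>
     L2 (lebesgue_on S) q \<and> L2 (lebesgue_on S) dq \<and>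
     (\<forall>\<phi>. test_function S \<phi> \<longrightarrow>
        (\<integral>x. frechet_derivative \<phi> (at x) (q x) \<partial>lebesgue_on S)
          = - (\<integral>x. dq x * \<phi> x \<partial>lebesgue_on S))"


section \<open>Traces\<close>

definition C1_with_gradient :: "('a::euclidean_space \<Rightarrow> real) \<Rightarrow> ('a \<Rightarrow> 'a) \<Rightarrow> bool" where
  "C1_with_gradient \<phi> D\<phi> \<longleftrightarrow>
     (\<forall>x. (\<phi> has_derivative (\<lambda>h. D\<phi> x \<bullet> h)) (at x)) \<and> continuous_on UNIV D\<phi>"

text \<open>
  The trace operator of a bounded Lipschitz domain S is the continuous extension to
  \<open>H\<^sup>1(S)\<close>, with values in \<open>L\<^sup>2\<close> of the boundary, of the restriction of continuously
  differentiable functions to the boundary. It is given here by its graph.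
\<close>

definition has_trace ::
    "'a::euclidean_space set \<Rightarrow> ('a \<Rightarrow> real) \<Rightarrow> ('a \<Rightarrow> 'a) \<Rightarrow> ('a \<Rightarrow> real) \<Rightarrow> bool" where
  "has_trace S w Dw t \<longleftrightarrow>
     H1 S w Dw \<and> L2 (surface_on (frontier S)) t \<and>
     (\<exists>\<phi> D\<phi>. (\<forall>m::nat. C1_with_gradient (\<phi> m) (D\<phi> m)) \<and>
        (\<lambda>m. L2norm (lebesgue_on S) (\<lambda>x. \<phi> m x - w x)) \<longlonglongrightarrow> 0 \<and>
        (\<lambda>m. L2norm (lebesgue_on S) (\<lambda>x. D\<phi> m x - Dw x)) \<longlonglongrightarrow> 0 \<and>
        (\<lambda>m. L2norm (surface_on (frontier S)) (\<lambda>x. \<phi> m x - t x)) \<longlonglongrightarrow> 0)"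

definition equal_traces ::
    "'a::euclidean_space set \<Rightarrow> ('a \<Rightarrow> real) \<Rightarrow> ('a \<Rightarrow> 'a) \<Rightarrow> ('a \<Rightarrow> real) \<Rightarrow> ('a \<Rightarrow> 'a) \<Rightarrow> bool" where
  "equal_traces S v Dv w Dw \<longleftrightarrow> (\<exists>t. has_trace S v Dv t \<and> has_trace S w Dw t)"

definition H10 :: "'a::euclidean_space set \<Rightarrow> ('a \<Rightarrow> real) \<Rightarrow> ('a \<Rightarrow> 'a) \<Rightarrow> bool" where
  "H10 S w Dw \<longleftrightarrow> has_trace S w Dw (\<lambda>_. 0)"

text \<open>
  The normal trace of q (with weak divergence dq) on the boundary of S is the functional
  \<open>w \<mapsto> \<integral>\<^sub>S q \<bullet> \<nabla>w + (div q) w\<close>. On a part R of the boundary it is the function g in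
  \<open>L\<^sup>2(R)\<close> if this functional is \<open>w \<mapsto> \<integral>\<^sub>R g w ds\<close> for all w in \<open>H\<^sup>1(S)\<close> whose trace
  vanishes on the rest of the boundary. The function g is then the component of q along the
  outward normal of S.
\<close>

definition has_outer_normal_trace ::
    "'a::euclidean_space set \<Rightarrow> 'a set \<Rightarrow> ('a \<Rightarrow> 'a) \<Rightarrow> ('a \<Rightarrow> real) \<Rightarrow> ('a \<Rightarrow> real) \<Rightarrow> bool" where
  "has_outer_normal_trace S R q dq g \<longleftrightarrow>
     Hdiv S q dq \<and> L2 (surface_on R) g \<and>
     (\<forall>w Dw t. has_trace S w Dw t \<and> (AE x in surface_on (frontier S - R). t x = 0) \<longrightarrow>
        (\<integral>x. q x \<bullet> Dw x + dq x * w x \<partial>lebesgue_on S) = (\<integral>x. g x * t x \<partial>surface_on R))"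

definition is_unit_normal :: "'a::euclidean_space set \<Rightarrow> 'a \<Rightarrow> bool" where
  "is_unit_normal R n \<longleftrightarrow> norm n = 1 \<and> (\<forall>x\<in>R. \<forall>z\<in>R. n \<bullet> (x - z) = 0)"

text \<open>
  A unit normal n of a flat part R of the boundary of a convex set S is either the outward
  normal of S or its negative, so the component along n on R of a field with outer normal
  trace g is g or -g.
\<close>

definition normal_component ::
    "'a::euclidean_space set \<Rightarrow> 'a set \<Rightarrow> 'a \<Rightarrow> ('a \<Rightarrow> real) \<Rightarrow> 'a \<Rightarrow> real" where
  "normal_component S R n g x = (if \<forall>a\<in>S. \<forall>z\<in>R. n \<bullet> a \<le> n \<bullet> z then g x else - g x)"


section \<open>Polyhedral Lipschitz domains and their partitions\<close>

text \<open>In the coordinates \<open>(x - (e \<bullet> x) e, e \<bullet> x)\<close> the set is locally a Lipschitz subgraph.\<close>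

definition lipschitz_boundary :: "'a::euclidean_space set \<Rightarrow> bool" where
  "lipschitz_boundary S \<longleftrightarrow>
     (\<forall>p\<in>frontier S. \<exists>U e \<psi> L. open U \<and> p \<in> U \<and> norm e = 1 \<and> L-lipschitz_on UNIV \<psi> \<and>
        S \<inter> U = {x \<in> U. e \<bullet> x < (\<psi> :: 'a \<Rightarrow> real) (x - (e \<bullet> x) *\<^sub>R e)})"

definition polyhedral_lipschitz_domain :: "'a::euclidean_space set \<Rightarrow> bool" where
  "polyhedral_lipschitz_domain S \<longleftrightarrow>
     open S \<and> connected S \<and> S \<noteq> {} \<and> bounded S \<and> lipschitz_boundary S \<and>
     (\<exists>P. finite P \<and> (\<forall>p\<in>P. polytope p) \<and> closure S = \<Union>P)"

definition convex_partition ::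
    "'a::euclidean_space set \<Rightarrow> nat \<Rightarrow> (nat \<Rightarrow> 'a set) \<Rightarrow> bool" where
  "convex_partition S N \<omega> \<longleftrightarrow>
     (\<forall>k\<in>{1..N}. open (\<omega> k) \<and> convex (\<omega> k) \<and> \<omega> k \<noteq> {} \<and> \<omega> k \<subseteq> S) \<and>
     (\<forall>i\<in>{1..N}. \<forall>j\<in>{1..N}. i \<noteq> j \<longrightarrow> \<omega> i \<inter> \<omega> j = {}) \<and>
     closure S = (\<Union>k\<in>{1..N}. closure (\<omega> k))"

definition interface :: "(nat \<Rightarrow> 'a::euclidean_space set) \<Rightarrow> nat \<Rightarrow> nat \<Rightarrow> 'a set" where
  "interface \<omega> k j = closure (\<omega> k) \<inter> closure (\<omega> j)"

definition neighbours :: "(nat \<Rightarrow> 'a::euclidean_space set) \<Rightarrow> nat \<Rightarrow> nat \<Rightarrow> nat set" where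
  "neighbours \<omega> N k = {j \<in> {1..N}. j \<noteq> k \<and> emeasure surface (interface \<omega> k j) > 0}"

text \<open>Each interior interface is listed once, by its pair of indices \<open>(k, j)\<close> with \<open>k < j\<close>.\<close>

definition interfaces :: "(nat \<Rightarrow> 'a::euclidean_space set) \<Rightarrow> nat \<Rightarrow> (nat \<times> nat) set" where
  "interfaces \<omega> N = {(k, j). k \<in> {1..N} \<and> j \<in> neighbours \<omega> N k \<and> k < j}"

definition interior_boundary :: "(nat \<Rightarrow> 'a::euclidean_space set) \<Rightarrow> nat \<Rightarrow> nat \<Rightarrow> 'a set" where
  "interior_boundary \<omega> N k = (\<Union>j\<in>neighbours \<omega> N k. interface \<omega> k j)"

definition Emax :: "(nat \<Rightarrow> 'a::euclidean_space set) \<Rightarrow> nat \<Rightarrow> nat" where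
  "Emax \<omega> N = Max ((\<lambda>k. card {(i, j) \<in> interfaces \<omega> N. i = k \<or> j = k}) ` {1..N})"


section \<open>Constants in Poincare type inequalities\<close>

definition poincare_const :: "'a::euclidean_space set \<Rightarrow> real \<Rightarrow> bool" where
  "poincare_const S C \<longleftrightarrow>
     (\<forall>w Dw. H1 S w Dw \<longrightarrow>
        L2norm (lebesgue_on S)
            (\<lambda>x. w x - (1 / measure lebesgue S) * (\<integral>z. w z \<partial>lebesgue_on S))
          \<le> C * L2norm (lebesgue_on S) Dw)"

definition trace_poincare_const :: "'a::euclidean_space set \<Rightarrow> 'a set \<Rightarrow> real \<Rightarrow> bool" where
  "trace_poincare_const R S C \<longleftrightarrow>
     (\<forall>w Dw t. has_trace S w Dw t \<and>
        (1 / measure surface R) * (\<integral>x. t x \<partial>surface_on R) = 0 \<longrightarrow>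
        L2norm (surface_on R) t \<le> C * L2norm (lebesgue_on S) Dw)"

definition interface_const ::
    "('a set \<Rightarrow> 'a set \<Rightarrow> real) \<Rightarrow> (nat \<Rightarrow> 'a::euclidean_space set) \<Rightarrow> nat \<Rightarrow> nat \<Rightarrow> real" where
  "interface_const CPt \<omega> k j =
     sqrt (((CPt (interface \<omega> k j) (\<omega> j))\<^sup>2 + (CPt (interface \<omega> k j) (\<omega> k))\<^sup>2) / 2)"

end

(*
  Idea. The error w = u - v has zero trace, so testing the weak formulation with w turns the
  energy of w into a sum over the cells. Inserting y there produces three terms per cell: the
  flux defect (Cauchy-Schwarz in the energy), the residual div y + f, which has mean value
  zero and thus only sees w minus its mean, and the normal trace of y against the trace of w.
  Over both sides of an interface the last terms add up to the jump of y, which again has mean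
  value zero, so that the trace of w may be replaced by its deviation from the mean.

  This needs the trace of w on the interfaces. It is constructed as the L2 limit of the smooth
  functions that approximate w in H1 of the whole domain; the sequence is Cauchy by a trace
  inequality for flat pieces of the boundary of a convex cell. One limit serves for all cells,
  so both sides of an interface see the same trace.
*)

theory Submission
  imports Defs
begin

text \<open>Normal traces are defined by duality: pairing \<open>y\<close> with a function gives an
  integral over the interior boundary of a cell only if the function has a trace on the frontier of
  that cell which vanishes off the interior boundary. \<open>H10\<close> speaks of the frontier of
  the whole domain only. The frontier of a cell splits into pieces of the frontier of the domain,
  where the approximants converge by assumption, and interfaces. Disjoint convex cells are separated
  by hyperplanes, so interfaces are flat, and a trace inequality inside a hyperplane is enough. It
  integrates along segments from the interface into the cell; as area is the volume of a prism of
  height 1, the change of variables reduces to Tonelli and translations. Constants: both cells bound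
  the same deviation of the trace from its mean, and averaging the two squared bounds yields
  \<open>interface_const\<close>. Each cell gradient is then counted once per interface, whence
  \<open>Emax\<close>. \<open>Cmin\<close> enters where gradient norms are replaced by the energy
  norm.\<close>

section \<open>Square integrable functions\<close>

lemma L2_measurable: "L2 M f \<Longrightarrow> f \<in> borel_measurable M"
  by (simp add: L2_def)

lemma L2norm_nonneg [simp]: "0 \<le> L2norm M f"
  by (simp add: L2norm_def)

lemma L2norm_square: "(L2norm M f)\<^sup>2 = (\<integral>x. (norm (f x))\<^sup>2 \<partial>M)"
  by (simp add: L2norm_def)

lemma L2_integrable_norm_mult:
  fixes f :: "'a \<Rightarrow> 'b::euclidean_space" and g :: "'a \<Rightarrow> 'c::euclidean_space"
  assumes "L2 M f" "L2 M g"
  shows "integrable M (\<lambda>x. norm (f x) * norm (g x))"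
proof (rule Bochner_Integration.integrable_bound)
  show "integrable M (\<lambda>x. (norm (f x))\<^sup>2 + (norm (g x))\<^sup>2)"
    using assms by (simp add: L2_def)
  show "(\<lambda>x. norm (f x) * norm (g x)) \<in> borel_measurable M"
    using assms by (auto simp: L2_def)
  have "a * b \<le> a\<^sup>2 + b\<^sup>2" if "0 \<le> a" "0 \<le> b" for a b :: real
    using sum_squares_bound[of a b] that mult_nonneg_nonneg[OF that] by linarith
  then show "AE x in M. norm (norm (f x) * norm (g x)) \<le> norm ((norm (f x))\<^sup>2 + (norm (g x))\<^sup>2)"
    by simp
qed

lemma L2_integrable_inner:
  fixes f g :: "'a \<Rightarrow> 'b::euclidean_space"
  assumes "L2 M f" "L2 M g"
  shows "integrable M (\<lambda>x. f x \<bullet> g x)"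
  by (rule Bochner_Integration.integrable_bound[OF L2_integrable_norm_mult[OF assms]])
    (use assms in \<open>auto simp: L2_def Cauchy_Schwarz_ineq2\<close>)

lemma L2_integrable_mult:
  fixes f g :: "'a \<Rightarrow> real"
  assumes "L2 M f" "L2 M g"
  shows "integrable M (\<lambda>x. f x * g x)"
  using L2_integrable_inner[OF assms] by simp

lemma L2_scaleR: "L2 M f \<Longrightarrow> L2 M (\<lambda>x. c *\<^sub>R f x)"
  by (auto simp: L2_def power_mult_distrib)

lemma L2_add:
  assumes "L2 M f" "L2 M g"
  shows "L2 M (\<lambda>x. f x + g x)"
  unfolding L2_def
proof
  show "(\<lambda>x. f x + g x) \<in> borel_measurable M"
    using assms by (auto simp: L2_def)
  have "integrable M (\<lambda>x. (norm (f x))\<^sup>2 + 2 * (f x \<bullet> g x) + (norm (g x))\<^sup>2)"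
    using assms L2_integrable_inner[OF assms] by (auto simp: L2_def)
  then show "integrable M (\<lambda>x. (norm (f x + g x))\<^sup>2)"
    by (rule Bochner_Integration.integrable_cong[THEN iffD1, rotated 2])
      (simp_all add: power2_norm_eq_inner algebra_simps inner_commute)
qed

lemma L2_diff: "L2 M f \<Longrightarrow> L2 M g \<Longrightarrow> L2 M (\<lambda>x. f x - g x)"
  using L2_add[of M f "\<lambda>x. (-1) *\<^sub>R g x"] L2_scaleR[of M g "-1"] by simp

lemma (in finite_measure) L2_bounded:
  assumes "f \<in> borel_measurable M" "\<And>x. x \<in> space M \<Longrightarrow> norm (f x) \<le> B"
  shows "L2 M f"
  unfolding L2_def
proof
  show "integrable M (\<lambda>x. (norm (f x))\<^sup>2)"
    by (rule integrable_const_bound[where B="B\<^sup>2"]) (use assms in \<open>auto intro!: power_mono\<close>)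
qed fact

text \<open>Discriminant argument: the integral of
  \<open>(norm (f x) - t * norm (g x))\<^sup>2\<close> is a nonnegative polynomial in
  \<open>t\<close>. Norms appear in the statement so that \<open>f\<close> and \<open>g\<close> may
  take values in different spaces.\<close>

lemma L2_Cauchy_Schwarz:
  fixes f :: "'a \<Rightarrow> 'b::euclidean_space" and g :: "'a \<Rightarrow> 'c::euclidean_space"
  assumes f: "L2 M f" and g: "L2 M g"
  shows "(\<integral>x. norm (f x) * norm (g x) \<partial>M) \<le> L2norm M f * L2norm M g"
proof -
  define a b c where "a = (\<integral>x. (norm (f x))\<^sup>2 \<partial>M)" "b = (\<integral>x. norm (f x) * norm (g x) \<partial>M)"
    "c = (\<integral>x. (norm (g x))\<^sup>2 \<partial>M)"
  have i: "integrable M (\<lambda>x. (norm (f x))\<^sup>2)" "integrable M (\<lambda>x. (norm (g x))\<^sup>2)"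
    "integrable M (\<lambda>x. norm (f x) * norm (g x))"
    using f g L2_integrable_norm_mult[OF f g] by (auto simp: L2_def)
  have quadratic: "0 \<le> a - 2 * t * b + t\<^sup>2 * c" for t
  proof -
    have "0 \<le> (\<integral>x. (norm (f x) - t * norm (g x))\<^sup>2 \<partial>M)"
      by simp
    also have "\<dots> = (\<integral>x. (norm (f x))\<^sup>2 - 2 * t * (norm (f x) * norm (g x)) + t\<^sup>2 * (norm (g x))\<^sup>2 \<partial>M)"
      by (intro Bochner_Integration.integral_cong) (auto simp: power2_eq_square algebra_simps)
    also have "\<dots> = a - 2 * t * b + t\<^sup>2 * c"
      using i by (simp add: a_b_c_def)
    finally show ?thesis .
  qed
  have "a \<ge> 0" "b \<ge> 0" "c \<ge> 0"
    by (auto simp: a_b_c_def)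
  have "b\<^sup>2 \<le> a * c"
  proof (cases "c = 0")
    case True
    \<comment> \<open>For \<open>c = 0\<close> the polynomial is linear, and at this
      \<open>t\<close> it would equal -1 unless \<open>b = 0\<close>.\<close>
    have "b = 0"
      using quadratic[of "(a + 1) / (2 * b)"] True \<open>a \<ge> 0\<close> by (cases "b = 0") auto
    then show ?thesis
      using True by simp
  next
    case False
    then have "c > 0"
      using \<open>c \<ge> 0\<close> by simp
    \<comment> \<open>The polynomial attains its minimum at \<open>t = b / c\<close>.\<close>
    then show ?thesis
      using quadratic[of "b / c"] by (simp add: power2_eq_square field_simps)
  qed
  then have "b \<le> sqrt (a * c)"
    by (rule real_le_rsqrt)
  then show ?thesis
    by (simp add: L2norm_def a_b_c_def real_sqrt_mult)
qed

lemma L2_inner_bound: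
  fixes f g :: "'a \<Rightarrow> 'b::euclidean_space"
  assumes "L2 M f" "L2 M g"
  shows "\<bar>\<integral>x. f x \<bullet> g x \<partial>M\<bar> \<le> L2norm M f * L2norm M g"
proof -
  have "\<bar>\<integral>x. f x \<bullet> g x \<partial>M\<bar> \<le> (\<integral>x. norm (f x \<bullet> g x) \<partial>M)"
    using integral_norm_bound[of M "\<lambda>x. f x \<bullet> g x"] by simp
  also have "\<dots> \<le> (\<integral>x. norm (f x) * norm (g x) \<partial>M)"
    using assms
    by (intro integral_mono integrable_norm L2_integrable_inner L2_integrable_norm_mult)
      (auto simp: Cauchy_Schwarz_ineq2)
  finally show ?thesis
    using L2_Cauchy_Schwarz[OF assms] by simp
qed

lemma L2_mult_bound:
  fixes f g :: "'a \<Rightarrow> real"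
  assumes "L2 M f" "L2 M g"
  shows "\<bar>\<integral>x. f x * g x \<partial>M\<bar> \<le> L2norm M f * L2norm M g"
  using L2_inner_bound[OF assms] by simp

lemma L2norm_triangle:
  assumes f: "L2 M f" and g: "L2 M g"
  shows "L2norm M (\<lambda>x. f x + g x) \<le> L2norm M f + L2norm M g"
proof (rule power2_le_imp_le)
  have "(L2norm M (\<lambda>x. f x + g x))\<^sup>2 = (\<integral>x. (norm (f x))\<^sup>2 + 2 * (f x \<bullet> g x) + (norm (g x))\<^sup>2 \<partial>M)"
    unfolding L2norm_square
    by (intro Bochner_Integration.integral_cong)
      (simp_all add: power2_norm_eq_inner algebra_simps inner_commute)
  also have "\<dots> = (L2norm M f)\<^sup>2 + 2 * (\<integral>x. f x \<bullet> g x \<partial>M) + (L2norm M g)\<^sup>2"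
    using f g L2_integrable_inner[OF f g] by (simp add: L2_def L2norm_square)
  also have "\<dots> \<le> (L2norm M f)\<^sup>2 + 2 * (L2norm M f * L2norm M g) + (L2norm M g)\<^sup>2"
    using L2_inner_bound[OF f g] by simp
  finally show "(L2norm M (\<lambda>x. f x + g x))\<^sup>2 \<le> (L2norm M f + L2norm M g)\<^sup>2"
    by (simp add: power2_sum algebra_simps)
qed simp

lemma L2norm_triangle_diff:
  assumes "L2 M f" "L2 M g"
  shows "L2norm M (\<lambda>x. f x - g x) \<le> L2norm M f + L2norm M g"
proof -
  have "L2norm M (\<lambda>x. - g x) = L2norm M g"
    by (simp add: L2norm_def)
  moreover have "L2 M (\<lambda>x. - g x)"
    using L2_scaleR[OF assms(2), of "-1"] by simp
  ultimately show ?thesis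
    using L2norm_triangle[OF assms(1), of "\<lambda>x. - g x"] by simp
qed

section \<open>L2 norms as nonnegative integrals, restriction to subsets, completeness\<close>

lemma nn_integral_L2:
  assumes "L2 M f"
  shows "(\<integral>\<^sup>+x. ennreal ((norm (f x))\<^sup>2) \<partial>M) = ennreal ((L2norm M f)\<^sup>2)"
  unfolding L2norm_square using assms
  by (intro nn_integral_eq_integral) (auto simp: L2_def)

lemma L2_iff_nn_integral:
  "L2 M f \<longleftrightarrow> f \<in> borel_measurable M \<and> (\<integral>\<^sup>+x. ennreal ((norm (f x))\<^sup>2) \<partial>M) < \<infinity>"
  by (auto simp: L2_def integrable_iff_bounded)

lemma L2norm_le_nn_integral:
  assumes "f \<in> borel_measurable M" "0 \<le> B" "(\<integral>\<^sup>+x. ennreal ((norm (f x))\<^sup>2) \<partial>M) \<le> ennreal (B\<^sup>2)"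
  shows "L2norm M f \<le> B"
proof -
  have "(L2norm M f)\<^sup>2 = enn2real (\<integral>\<^sup>+x. ennreal ((norm (f x))\<^sup>2) \<partial>M)"
    unfolding L2norm_square using assms(1) by (intro integral_eq_nn_integral) auto
  also have "\<dots> \<le> B\<^sup>2"
    using enn2real_mono[OF assms(3)] by simp
  finally show ?thesis
    using assms(2) by (rule power2_le_imp_le)
qed

lemma L2_restrict_space:
  assumes "S \<in> sets M" "L2 M f"
  shows "L2 (restrict_space M S) f"
  unfolding L2_def
proof
  show "f \<in> borel_measurable (restrict_space M S)"
    using assms by (auto simp: L2_def intro: measurable_restrict_space1)
  have "integrable M (\<lambda>x. indicator S x *\<^sub>R (norm (f x))\<^sup>2)"
    using assms by (intro integrable_mult_indicator) (auto simp: L2_def)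
  then show "integrable (restrict_space M S) (\<lambda>x. (norm (f x))\<^sup>2)"
    using assms sets.sets_into_space[OF assms(1)]
    by (subst integrable_restrict_space) auto
qed

lemma L2norm_restrict_space_le:
  assumes "S \<in> sets M" "L2 M f"
  shows "L2norm (restrict_space M S) f \<le> L2norm M f"
proof -
  have "(\<integral>x. (norm (f x))\<^sup>2 \<partial>restrict_space M S) = (\<integral>x. indicator S x *\<^sub>R (norm (f x))\<^sup>2 \<partial>M)"
    using assms(1) by (subst integral_restrict_space) auto
  also have "\<dots> \<le> (\<integral>x. (norm (f x))\<^sup>2 \<partial>M)"
    using assms by (intro integral_mono integrable_mult_indicator) (auto simp: L2_def indicator_def)
  finally show ?thesis
    by (simp add: L2norm_def)
qed

lemma restrict_space_subset:
  assumes "S \<in> sets M" "T \<in> sets M" "S \<subseteq> T"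
  shows "restrict_space M S = restrict_space (restrict_space M T) S" "S \<in> sets (restrict_space M T)"
proof -
  show "restrict_space M S = restrict_space (restrict_space M T) S"
    using assms sets.sets_into_space[OF assms(2)]
    by (subst restrict_restrict_space) (auto simp: Int_absorb1)
  show "S \<in> sets (restrict_space M T)"
    using assms by (auto simp: sets_restrict_space_iff)
qed

lemma L2_restrict_subset:
  assumes "S \<in> sets M" "T \<in> sets M" "S \<subseteq> T" "L2 (restrict_space M T) f"
  shows "L2 (restrict_space M S) f" "L2norm (restrict_space M S) f \<le> L2norm (restrict_space M T) f"
  using restrict_space_subset[OF assms(1-3)] assms(4)
    L2_restrict_space[of S "restrict_space M T" f] L2norm_restrict_space_le[of S "restrict_space M T" f]
  by auto

text \<open>Riesz-Fischer. Along a subsequence the successive differences are summable in L1, by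
  Cauchy-Schwarz against the constant 1, which is where finiteness of the measure enters; so the
  subsequence converges almost everywhere. Fatou's lemma then bounds the distance of every late
  \<open>f m\<close> from the limit, not only along the subsequence.\<close>

lemma (in finite_measure) L2_complete:
  fixes f :: "nat \<Rightarrow> 'a \<Rightarrow> real"
  assumes f: "\<And>m. L2 M (f m)"
    and Cauchy: "\<And>e. e > 0 \<Longrightarrow> \<exists>K. \<forall>m\<ge>K. \<forall>l\<ge>K. L2norm M (\<lambda>x. f m x - f l x) < e"
  shows "\<exists>t. L2 M t \<and> (\<lambda>m. L2norm M (\<lambda>x. f m x - t x)) \<longlonglongrightarrow> 0"
proof -
  have [measurable]: "f m \<in> borel_measurable M" for m
    using f by (rule L2_measurable)
  have "\<forall>i. \<exists>K. \<forall>m\<ge>K. \<forall>l\<ge>K. L2norm M (\<lambda>x. f m x - f l x) < (1/2)^i"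
    using Cauchy by simp
  then obtain K where K: "\<And>i m l. m \<ge> K i \<Longrightarrow> l \<ge> K i \<Longrightarrow> L2norm M (\<lambda>x. f m x - f l x) < (1/2)^i"
    by metis
  \<comment> \<open>A sum in place of a maximum: \<open>r i\<close> is at least every
    \<open>K j\<close> with \<open>j \<le> i\<close>.\<close>
  define r where "r i = (\<Sum>j\<le>i. K j)" for i
  have rK: "r i \<ge> K j" if "j \<le> i" for i j
    unfolding r_def using that by (intro member_le_sum) auto
  have nn: "(\<integral>\<^sup>+x. ennreal ((f m x - f l x)\<^sup>2) \<partial>M) = ennreal ((L2norm M (\<lambda>x. f m x - f l x))\<^sup>2)" for m l
    using nn_integral_L2[OF L2_diff[OF f f], of m l] by simp
  define B where "B = L2norm M (\<lambda>_. 1::real)"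
  have step: "(\<integral>\<^sup>+x. ennreal \<bar>f (r (Suc i)) x - f (r i) x\<bar> \<partial>M) \<le> ennreal (B * (1/2)^i)" for i
  proof -
    have one: "L2 M (\<lambda>_. 1::real)"
      by (rule L2_bounded[where B=1]) auto
    have int: "integrable M (\<lambda>x. \<bar>f (r (Suc i)) x - f (r i) x\<bar>)"
      using L2_integrable_norm_mult[OF L2_diff[OF f f] one] by simp
    have "(\<integral>x. \<bar>f (r (Suc i)) x - f (r i) x\<bar> \<partial>M) \<le> L2norm M (\<lambda>x. f (r (Suc i)) x - f (r i) x) * B"
      using L2_Cauchy_Schwarz[OF L2_diff[OF f f] one, of "r (Suc i)" "r i"] by (simp add: B_def)
    also have "\<dots> \<le> (1/2)^i * B"
      by (intro mult_right_mono less_imp_le[OF K]) (auto simp: B_def rK)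
    finally show ?thesis
      by (subst nn_integral_eq_integral[OF int]) (auto simp: mult.commute intro: ennreal_leI)
  qed
  have "(\<integral>\<^sup>+x. (\<Sum>i. ennreal \<bar>f (r (Suc i)) x - f (r i) x\<bar>) \<partial>M)
      = (\<Sum>i. \<integral>\<^sup>+x. ennreal \<bar>f (r (Suc i)) x - f (r i) x\<bar> \<partial>M)"
    by (intro nn_integral_suminf) auto
  also have "\<dots> \<le> (\<Sum>i. ennreal (B * (1/2)^i))"
    by (intro suminf_le step) auto
  also have "\<dots> = ennreal (\<Sum>i. B * (1/2)^i)"
    by (intro suminf_ennreal2) (auto simp: B_def intro!: summable_mult)
  finally have "(\<integral>\<^sup>+x. (\<Sum>i. ennreal \<bar>f (r (Suc i)) x - f (r i) x\<bar>) \<partial>M) \<noteq> \<infinity>"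
    by (auto simp: top_unique)
  then have "AE x in M. (\<Sum>i. ennreal \<bar>f (r (Suc i)) x - f (r i) x\<bar>) \<noteq> \<infinity>"
    by (intro nn_integral_PInf_AE) auto
  then have conv: "AE x in M. (\<lambda>i. f (r i) x) \<longlonglongrightarrow> lim (\<lambda>i. f (r i) x)"
  proof eventually_elim
    case (elim x)
    then have "summable (\<lambda>i. \<bar>f (r (Suc i)) x - f (r i) x\<bar>)"
      by (intro summable_suminf_not_top) auto
    then have "summable (\<lambda>i. f (r (Suc i)) x - f (r i) x)"
      by (rule summable_rabs_cancel)
    then have "convergent (\<lambda>n. \<Sum>i<n. f (r (Suc i)) x - f (r i) x)"
      by (simp add: summable_iff_convergent)
    then have "convergent (\<lambda>n. f (r n) x - f (r 0) x)"
      using sum_lessThan_telescope[of "\<lambda>i. f (r i) x"] by simp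
    then have "convergent (\<lambda>n. (f (r n) x - f (r 0) x) + f (r 0) x)"
      by (intro convergent_add convergent_const)
    then show ?case
      by (simp add: convergent_LIMSEQ_iff)
  qed
  define t where "t = (\<lambda>x. lim (\<lambda>i. f (r i) x))"
  have t[measurable]: "t \<in> borel_measurable M"
    unfolding t_def by (rule borel_measurable_lim_metric) simp
  \<comment> \<open>Fatou in \<open>j\<close> with \<open>m\<close> fixed: from \<open>j = i\<close>
    on, both \<open>m\<close> and \<open>r j\<close> are beyond \<open>K i\<close>.\<close>
  have bound: "(\<integral>\<^sup>+x. ennreal ((norm (f m x - t x))\<^sup>2) \<partial>M) \<le> ennreal (((1/2)^i)\<^sup>2)" if "m \<ge> K i" for m i
  proof -
    have "(\<integral>\<^sup>+x. ennreal ((norm (f m x - t x))\<^sup>2) \<partial>M) = (\<integral>\<^sup>+x. liminf (\<lambda>j. ennreal ((f m x - f (r j) x)\<^sup>2)) \<partial>M)"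
    proof (rule nn_integral_cong_AE, use conv in eventually_elim)
      case (elim x)
      have "(\<lambda>j. ennreal ((f m x - f (r j) x)\<^sup>2)) \<longlonglongrightarrow> ennreal ((f m x - t x)\<^sup>2)"
        using elim by (intro tendsto_ennrealI tendsto_intros) (simp add: t_def)
      then show ?case
        using lim_imp_Liminf[OF sequentially_bot] by (metis (no_types, lifting) real_norm_def power2_abs)
    qed
    also have "\<dots> \<le> liminf (\<lambda>j. \<integral>\<^sup>+x. ennreal ((f m x - f (r j) x)\<^sup>2) \<partial>M)"
      by (rule nn_integral_liminf) simp
    also have "\<dots> \<le> liminf (\<lambda>j::nat. ennreal (((1/2)^i)\<^sup>2))"
    proof (rule Liminf_mono, rule eventually_sequentiallyI[of i])
      fix j assume "i \<le> j"
      then show "(\<integral>\<^sup>+x. ennreal ((f m x - f (r j) x)\<^sup>2) \<partial>M) \<le> ennreal (((1/2)^i)\<^sup>2)"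
        unfolding nn using K[OF that rK[OF \<open>i \<le> j\<close>]] by (intro ennreal_leI power_mono) auto
    qed
    also have "\<dots> = ennreal (((1/2)^i)\<^sup>2)"
      by (rule Liminf_const) simp
    finally show ?thesis .
  qed
  \<comment> \<open>For \<open>i = 0\<close> the bound is 1, and its finiteness puts
    \<open>f (K 0) - t\<close>, hence \<open>t\<close>, into L2.\<close>
  have "L2 M (\<lambda>x. f (K 0) x - t x)"
    using bound[of 0 "K 0"] by (auto simp: L2_iff_nn_integral le_less_trans)
  then have "L2 M t"
    using L2_diff[OF f[of "K 0"]] by fastforce
  moreover have "(\<lambda>m. L2norm M (\<lambda>x. f m x - t x)) \<longlonglongrightarrow> 0"
  proof (rule LIMSEQ_I)
    fix e :: real assume "e > 0"
    then obtain i where i: "(1/2::real)^i < e"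
      using real_arch_pow_inv[of e "1/2"] by auto
    have "L2norm M (\<lambda>x. f m x - t x) \<le> (1/2)^i" if "m \<ge> K i" for m
      using bound[OF that] by (intro L2norm_le_nn_integral) auto
    then show "\<exists>no. \<forall>n\<ge>no. norm (L2norm M (\<lambda>x. f n x - t x) - 0) < e"
      using i by (intro exI[of _ "K i"]) (auto intro: le_less_trans)
  qed
  ultimately show ?thesis
    by blast
qed

section \<open>Surface measure on hyperplanes\<close>

lemma closest_point_hyperplane:
  fixes m :: "'a::euclidean_space"
  assumes m: "norm m = 1"
  shows "closest_point {x. m \<bullet> x = c} x = x - (m \<bullet> x - c) *\<^sub>R m"
proof (rule closest_point_unique[symmetric])
  have mm: "m \<bullet> m = 1"
    using m by (simp add: norm_eq_1)
  then show "x - (m \<bullet> x - c) *\<^sub>R m \<in> {x. m \<bullet> x = c}"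
    by (simp add: inner_diff_right)
  show "\<forall>z\<in>{x. m \<bullet> x = c}. dist x (x - (m \<bullet> x - c) *\<^sub>R m) \<le> dist x z"
  proof
    fix z assume "z \<in> {x. m \<bullet> x = c}"
    then have "\<bar>m \<bullet> x - c\<bar> = \<bar>m \<bullet> (x - z)\<bar>"
      by (simp add: inner_diff_right)
    also have "\<dots> \<le> norm m * norm (x - z)"
      by (rule Cauchy_Schwarz_ineq2)
    finally show "dist x (x - (m \<bullet> x - c) *\<^sub>R m) \<le> dist x z"
      by (simp add: dist_norm m)
  qed
qed (simp_all add: convex_hyperplane closed_hyperplane)

lemma infdist_hyperplane:
  fixes m :: "'a::euclidean_space"
  assumes m: "norm m = 1"
  shows "infdist x {x. m \<bullet> x = c} = \<bar>m \<bullet> x - c\<bar>"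
proof -
  have "m \<bullet> (c *\<^sub>R m) = c"
    using m by (simp add: norm_eq_1)
  then have "{x. m \<bullet> x = c} \<noteq> {}"
    by blast
  then have "infdist x {x. m \<bullet> x = c} = dist x (closest_point {x. m \<bullet> x = c} x)"
    by (simp add: infdist_eq_setdist setdist_closest_point closed_hyperplane)
  then show ?thesis
    by (simp add: closest_point_hyperplane m dist_norm)
qed

lemma flat_area_hyperplane:
  fixes m :: "'a::euclidean_space"
  assumes "norm m = 1"
  shows "flat_area {x. m \<bullet> x = c} S
    = emeasure lborel {x. \<bar>m \<bullet> x - c\<bar> \<le> 1/2 \<and> x - (m \<bullet> x - c) *\<^sub>R m \<in> S}"
  by (simp add: flat_area_def closest_point_hyperplane infdist_hyperplane assms)

text \<open>Let \<open>d\<close> be the part of \<open>m\<close> orthogonal to \<open>n\<close>.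
  Projecting along \<open>n\<close> does not change \<open>d \<bullet> x\<close>, so this is
  constant on the prism over \<open>S\<close>: for \<open>d \<noteq> 0\<close> the prism lies in a
  null hyperplane, and for \<open>d = 0\<close> the two hyperplanes are parallel and distinct, so
  that the prism is empty.\<close>

lemma flat_area_other_hyperplane:
  fixes m n :: "'a::euclidean_space"
  assumes m: "norm m = 1" and n: "norm n = 1"
    and S: "S \<subseteq> {x. m \<bullet> x = c}" and ne: "{x. m \<bullet> x = c} \<noteq> {x. n \<bullet> x = b}"
  shows "flat_area {x. n \<bullet> x = b} S = 0"
proof -
  have mm: "m \<bullet> m = 1" "n \<bullet> n = 1"
    using m n by (simp_all add: norm_eq_1)
  define d where "d = m - (m \<bullet> n) *\<^sub>R n"
  define Q where "Q = {x. \<bar>n \<bullet> x - b\<bar> \<le> 1/2 \<and> x - (n \<bullet> x - b) *\<^sub>R n \<in> S}"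
  have Q: "d \<bullet> x = c - b * (m \<bullet> n)" if "x \<in> Q" for x
  proof -
    have "m \<bullet> (x - (n \<bullet> x - b) *\<^sub>R n) = c"
      using that S by (auto simp: Q_def)
    then show ?thesis
      by (simp add: d_def inner_diff_right inner_diff_left algebra_simps)
  qed
  have "emeasure lborel Q = 0"
  proof (cases "d = 0")
    case True
    have "Q = {}"
    proof (rule ccontr)
      assume "Q \<noteq> {}"
      then have c: "c = b * (m \<bullet> n)"
        using Q True by auto
      have mn: "m = (m \<bullet> n) *\<^sub>R n"
        using True by (simp add: d_def)
      then have "m \<bullet> n \<noteq> 0"
        using m by auto
      have "m \<bullet> x = (m \<bullet> n) * (n \<bullet> x)" for x
        using arg_cong[OF mn, of "\<lambda>y. y \<bullet> x"] by simp
      then have "{x. m \<bullet> x = c} = {x. n \<bullet> x = b}"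
        using c \<open>m \<bullet> n \<noteq> 0\<close> by (metis (no_types, opaque_lifting) mult.commute mult_cancel_left)
      then show False
        using ne by simp
    qed
    then show ?thesis
      by simp
  next
    case False
    have "negligible {x. d \<bullet> x = c - b * (m \<bullet> n)}"
      using False by (intro negligible_hyperplane) auto
    moreover have "{x. d \<bullet> x = c - b * (m \<bullet> n)} \<in> sets borel"
      by (intro borel_closed closed_hyperplane)
    ultimately have "{x. d \<bullet> x = c - b * (m \<bullet> n)} \<in> null_sets lborel"
      by (simp add: negligible_iff_null_sets null_sets_completion_iff)
    then have "emeasure lborel Q \<le> 0"
      using Q emeasure_mono[of Q "{x. d \<bullet> x = c - b * (m \<bullet> n)}" lborel]
      by (auto simp: null_sets_def subset_iff)
    then show ?thesis
      by simp
  qed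
  then show ?thesis
    unfolding flat_area_hyperplane[OF n] Q_def .
qed

text \<open>The sum over all hyperplanes reduces to the single term of the one that contains
  \<open>S\<close>.\<close>

lemma emeasure_surface_hyperplane:
  fixes m :: "'a::euclidean_space"
  assumes m: "norm m = 1" and S: "S \<in> sets borel" "S \<subseteq> {x. m \<bullet> x = c}"
  shows "emeasure surface S
    = emeasure lborel {x. \<bar>m \<bullet> x - c\<bar> \<le> 1/2 \<and> x - (m \<bullet> x - c) *\<^sub>R m \<in> S}"
proof -
  let ?H = "{x. m \<bullet> x = c}"
  have H: "?H \<in> hyperplanes"
    using m by (auto simp: hyperplanes_def)
  have "emeasure surface S = (\<Sum>H\<in>{?H}. flat_area H S)"
    unfolding emeasure_surface[OF S(1)]
  proof (rule nn_integral_count_space')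
    fix H' assume H': "H' \<in> hyperplanes" "H' \<notin> {?H}"
    then obtain n b where n: "norm n = 1" "H' = {x. n \<bullet> x = b}"
      by (auto simp: hyperplanes_def)
    then show "flat_area H' S = 0"
      using flat_area_other_hyperplane[OF m n(1) S(2)] H'(2) by auto
  qed (use H in auto)
  then show ?thesis
    by (simp add: flat_area_hyperplane m)
qed

lemma emeasure_surface_two_hyperplanes:
  fixes m n :: "'a::euclidean_space"
  assumes m: "norm m = 1" and n: "norm n = 1" and S: "S \<in> sets borel"
    "S \<subseteq> {x. m \<bullet> x = c}" "S \<subseteq> {x. n \<bullet> x = b}" and ne: "{x. m \<bullet> x = c} \<noteq> {x. n \<bullet> x = b}"
  shows "emeasure surface S = 0"
  using flat_area_other_hyperplane[OF m n S(2) ne] emeasure_surface_hyperplane[OF n S(1,3)]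
  by (simp add: flat_area_hyperplane n)

lemma emeasure_surface_bounded_hyperplane:
  fixes m :: "'a::euclidean_space"
  assumes m: "norm m = 1" and S: "S \<in> sets borel" "S \<subseteq> {x. m \<bullet> x = c}" "bounded S"
  shows "emeasure surface S < \<infinity>"
proof -
  obtain B where B: "\<And>x. x \<in> S \<Longrightarrow> norm x \<le> B"
    using S(3) by (auto simp: bounded_iff)
  let ?Q = "{x. \<bar>m \<bullet> x - c\<bar> \<le> 1/2 \<and> x - (m \<bullet> x - c) *\<^sub>R m \<in> S}"
  have "norm x \<le> B + 1/2" if "x \<in> ?Q" for x
  proof -
    have "norm x \<le> norm (x - (m \<bullet> x - c) *\<^sub>R m) + norm ((m \<bullet> x - c) *\<^sub>R m)"
      by (metis norm_triangle_ineq diff_add_cancel)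
    then show ?thesis
      using that B[of "x - (m \<bullet> x - c) *\<^sub>R m"] m by auto
  qed
  then have "?Q \<subseteq> cball 0 (B + 1/2)"
    by auto
  then have "emeasure lborel ?Q \<le> emeasure lborel (cball 0 (B + 1/2) :: 'a set)"
    by (intro emeasure_mono) auto
  also have "\<dots> < \<infinity>"
    using emeasure_lborel_cball_finite by (auto simp: top.not_eq_extremum)
  finally show ?thesis
    using emeasure_surface_hyperplane[OF m S(1,2)] by simp
qed

text \<open>On \<open>S\<close> the area is the image of Lebesgue measure on the prism over
  \<open>S\<close> under the orthogonal projection. The indicator of the slab is kept as a separate
  outer factor to match the slab formulas that follow.\<close>

lemma nn_integral_surface_hyperplane:
  fixes m :: "'a::euclidean_space"
  assumes m: "norm m = 1" and S[measurable]: "S \<in> sets borel" and SH: "S \<subseteq> {x. m \<bullet> x = c}"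
    and F[measurable]: "F \<in> borel_measurable borel"
  shows "(\<integral>\<^sup>+x. F x \<partial>surface_on S)
    = (\<integral>\<^sup>+x. indicator {x. \<bar>m \<bullet> x - c\<bar> \<le> 1/2} x * (indicator S (x - (m \<bullet> x - c) *\<^sub>R m)
        * F (x - (m \<bullet> x - c) *\<^sub>R m)) \<partial>lborel)"
proof -
  define p where "p = (\<lambda>x. x - (m \<bullet> x - c) *\<^sub>R m)"
  have [measurable]: "p \<in> borel_measurable borel"
    unfolding p_def by measurable
  define M where "M = density lborel (indicator {x. \<bar>m \<bullet> x - c\<bar> \<le> 1/2 \<and> p x \<in> S} :: 'a \<Rightarrow> ennreal)"
  have eq: "density surface (indicator S) = distr M borel p"
  proof (rule measure_eqI)
    fix B :: "'a set" assume "B \<in> sets (density surface (indicator S))"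
    then have B[measurable]: "B \<in> sets borel"
      by simp
    have "emeasure (density surface (indicator S)) B = emeasure surface (S \<inter> B)"
      by (subst emeasure_density) (auto simp: nn_integral_indicator[symmetric] indicator_inter_arith)
    also have "\<dots> = emeasure lborel {x. \<bar>m \<bullet> x - c\<bar> \<le> 1/2 \<and> p x \<in> S \<inter> B}"
      using SH by (subst emeasure_surface_hyperplane[OF m, of _ c]) (auto simp: p_def)
    also have "\<dots> = (\<integral>\<^sup>+x. indicator {x. \<bar>m \<bullet> x - c\<bar> \<le> 1/2 \<and> p x \<in> S \<inter> B} x \<partial>lborel)"
      by (rule nn_integral_indicator[symmetric]) measurable
    also have "\<dots> = (\<integral>\<^sup>+x. indicator {x. \<bar>m \<bullet> x - c\<bar> \<le> 1/2 \<and> p x \<in> S} x * indicator (p -` B) x \<partial>lborel)"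
      by (intro nn_integral_cong) (auto simp: indicator_def)
    also have "\<dots> = emeasure M (p -` B)"
    proof -
      have "p -` B \<in> sets lborel"
        using measurable_sets_borel[of p borel B] by simp
      then show ?thesis
        unfolding M_def by (rule emeasure_density[symmetric, rotated]) measurable
    qed
    also have "\<dots> = emeasure (distr M borel p) B"
      by (subst emeasure_distr) (auto simp: M_def)
    finally show "emeasure (density surface (indicator S)) B = emeasure (distr M borel p) B" .
  qed (simp add: M_def)
  have "(\<integral>\<^sup>+x. F x \<partial>surface_on S) = (\<integral>\<^sup>+x. F x * indicator S x \<partial>surface)"
    unfolding surface_on_def by (subst nn_integral_restrict_space) auto
  also have "\<dots> = (\<integral>\<^sup>+x. F x \<partial>density surface (indicator S))"
    by (subst nn_integral_density) (auto simp: mult.commute)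
  also have "\<dots> = (\<integral>\<^sup>+x. F (p x) \<partial>M)"
    unfolding eq by (subst nn_integral_distr) (auto simp: M_def)
  also have "\<dots> = (\<integral>\<^sup>+x. indicator {x. \<bar>m \<bullet> x - c\<bar> \<le> 1/2 \<and> p x \<in> S} x * F (p x) \<partial>lborel)"
    unfolding M_def by (rule nn_integral_density) measurable
  also have "\<dots> = (\<integral>\<^sup>+x. indicator {x. \<bar>m \<bullet> x - c\<bar> \<le> 1/2} x * (indicator S (p x) * F (p x)) \<partial>lborel)"
    by (intro nn_integral_cong) (auto simp: indicator_def)
  finally show ?thesis
    by (simp add: p_def)
qed

section \<open>A trace inequality\<close>

lemma nn_integral_translate:
  fixes F :: "'a::euclidean_space \<Rightarrow> ennreal"
  assumes [measurable]: "F \<in> borel_measurable borel"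
  shows "(\<integral>\<^sup>+x. F (a + x) \<partial>lborel) = (\<integral>\<^sup>+x. F x \<partial>lborel)"
proof -
  have "(\<integral>\<^sup>+x. F x \<partial>lborel) = (\<integral>\<^sup>+x. F x \<partial>distr lborel borel ((+) a))"
    by (simp add: lborel_distr_plus)
  also have "\<dots> = (\<integral>\<^sup>+x. F (a + x) \<partial>lborel)"
    by (rule nn_integral_distr) auto
  finally show ?thesis ..
qed

text \<open>
  Integrating over the slab of width 1 around a hyperplane makes the projection onto it a
  parametrisation of the hyperplane. Cavalieri's principle then only needs Tonelli's theorem
  and translations: average over translates along the normal, and exchange the roles of the
  normal coordinate and the averaging parameter.
\<close>

lemma nn_integral_slab:
  fixes m :: "'a::euclidean_space" and F :: "'a \<Rightarrow> ennreal"
  assumes m: "norm m = 1" and F[measurable]: "F \<in> borel_measurable borel"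
  shows "(\<integral>\<^sup>+x. indicator {x. \<bar>m \<bullet> x - c\<bar> \<le> 1/2} x *
      (\<integral>\<^sup>+\<tau>. indicator {a..b} \<tau> * F (x - (m \<bullet> x - c) *\<^sub>R m + \<tau> *\<^sub>R m) \<partial>lborel) \<partial>lborel)
    = (\<integral>\<^sup>+x. indicator {x. m \<bullet> x - c \<in> {a..b}} x * F x \<partial>lborel)"
proof -
  have mm: "m \<bullet> m = 1"
    using m by (simp add: norm_eq_1)
  let ?I = "\<lambda>\<tau>. indicator {-1/2..1/2::real} \<tau> :: ennreal"
  let ?J = "\<lambda>\<tau>. indicator {a..b} \<tau> :: ennreal"
  have "(\<integral>\<^sup>+x. indicator {x. m \<bullet> x - c \<in> {a..b}} x * F x \<partial>lborel)
      = (\<integral>\<^sup>+\<tau>. ?I \<tau> * (\<integral>\<^sup>+x. ?J (m \<bullet> x - c) * F x \<partial>lborel) \<partial>lborel)"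
  proof -
    have "(\<integral>\<^sup>+\<tau>. ?I \<tau> * (\<integral>\<^sup>+x. ?J (m \<bullet> x - c) * F x \<partial>lborel) \<partial>lborel)
        = (\<integral>\<^sup>+\<tau>. ?I \<tau> \<partial>lborel) * (\<integral>\<^sup>+x. ?J (m \<bullet> x - c) * F x \<partial>lborel)"
      by (rule nn_integral_multc) simp
    also have "(\<integral>\<^sup>+\<tau>. ?I \<tau> \<partial>lborel) = 1"
      by simp
    finally show ?thesis
      by (simp add: indicator_def)
  qed
  also have "\<dots> = (\<integral>\<^sup>+\<tau>. (\<integral>\<^sup>+x. ?I \<tau> * (?J (m \<bullet> (\<tau> *\<^sub>R m + x) - c) * F (\<tau> *\<^sub>R m + x)) \<partial>lborel) \<partial>lborel)"
    by (intro nn_integral_cong)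
      (simp add: nn_integral_cmult nn_integral_translate[of "\<lambda>x. ?J (m \<bullet> x - c) * F x"])
  also have "\<dots> = (\<integral>\<^sup>+x. (\<integral>\<^sup>+\<tau>. ?I \<tau> * (?J (m \<bullet> (\<tau> *\<^sub>R m + x) - c) * F (\<tau> *\<^sub>R m + x)) \<partial>lborel) \<partial>lborel)"
    by (rule lborel_pair.Fubini') measurable
  \<comment> \<open>Substituting \<open>\<tau> - (m \<bullet> x - c)\<close> for
    \<open>\<tau>\<close> makes \<open>\<tau>\<close> the height over the hyperplane and moves the
    position of \<open>x\<close> in the slab into \<open>?I\<close>.\<close>
  also have "\<dots> = (\<integral>\<^sup>+x. (\<integral>\<^sup>+\<tau>. ?I (\<tau> - (m \<bullet> x - c)) * (?J \<tau> * F (x - (m \<bullet> x - c) *\<^sub>R m + \<tau> *\<^sub>R m)) \<partial>lborel) \<partial>lborel)"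
  proof (rule nn_integral_cong)
    fix x :: 'a
    show "(\<integral>\<^sup>+\<tau>. ?I \<tau> * (?J (m \<bullet> (\<tau> *\<^sub>R m + x) - c) * F (\<tau> *\<^sub>R m + x)) \<partial>lborel)
      = (\<integral>\<^sup>+\<tau>. ?I (\<tau> - (m \<bullet> x - c)) * (?J \<tau> * F (x - (m \<bullet> x - c) *\<^sub>R m + \<tau> *\<^sub>R m)) \<partial>lborel)"
      by (subst nn_integral_translate[of _ "- (m \<bullet> x - c)", symmetric])
        (simp_all add: inner_add_right mm algebra_simps)
  qed
  also have "\<dots> = (\<integral>\<^sup>+\<tau>. (\<integral>\<^sup>+x. ?I (\<tau> - (m \<bullet> x - c)) * (?J \<tau> * F (x - (m \<bullet> x - c) *\<^sub>R m + \<tau> *\<^sub>R m)) \<partial>lborel) \<partial>lborel)"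
    by (rule lborel_pair.Fubini'[symmetric]) measurable
  \<comment> \<open>Translating \<open>x\<close> by \<open>\<tau> *\<^sub>R m\<close> leaves the
    projection unchanged and removes \<open>\<tau>\<close> from the argument of
    \<open>?I\<close>.\<close>
  also have "\<dots> = (\<integral>\<^sup>+\<tau>. (\<integral>\<^sup>+x. ?I (- (m \<bullet> x - c)) * (?J \<tau> * F (x - (m \<bullet> x - c) *\<^sub>R m + \<tau> *\<^sub>R m)) \<partial>lborel) \<partial>lborel)"
  proof (rule nn_integral_cong)
    fix \<tau> :: real
    show "(\<integral>\<^sup>+x. ?I (\<tau> - (m \<bullet> x - c)) * (?J \<tau> * F (x - (m \<bullet> x - c) *\<^sub>R m + \<tau> *\<^sub>R m)) \<partial>lborel)
      = (\<integral>\<^sup>+x. ?I (- (m \<bullet> x - c)) * (?J \<tau> * F (x - (m \<bullet> x - c) *\<^sub>R m + \<tau> *\<^sub>R m)) \<partial>lborel)"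
      by (subst nn_integral_translate[of _ "\<tau> *\<^sub>R m", symmetric])
        (simp_all add: inner_add_right mm algebra_simps)
  qed
  also have "\<dots> = (\<integral>\<^sup>+x. (\<integral>\<^sup>+\<tau>. ?I (- (m \<bullet> x - c)) * (?J \<tau> * F (x - (m \<bullet> x - c) *\<^sub>R m + \<tau> *\<^sub>R m)) \<partial>lborel) \<partial>lborel)"
    by (rule lborel_pair.Fubini') measurable
  also have "\<dots> = (\<integral>\<^sup>+x. indicator {x. \<bar>m \<bullet> x - c\<bar> \<le> 1/2} x *
      (\<integral>\<^sup>+\<tau>. ?J \<tau> * F (x - (m \<bullet> x - c) *\<^sub>R m + \<tau> *\<^sub>R m) \<partial>lborel) \<partial>lborel)"
  proof (rule nn_integral_cong)
    fix x :: 'a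
    have "?I (- (m \<bullet> x - c)) = indicator {x. \<bar>m \<bullet> x - c\<bar> \<le> 1/2} x"
    proof -
      have "- (m \<bullet> x - c) \<in> {-1/2..1/2} \<longleftrightarrow> x \<in> {x. \<bar>m \<bullet> x - c\<bar> \<le> 1/2}"
        unfolding atLeastAtMost_iff mem_Collect_eq by (smt (verit) field_sum_of_halves)
      then show ?thesis
        unfolding indicator_def by (simp only:)
    qed
    then show "(\<integral>\<^sup>+\<tau>. ?I (- (m \<bullet> x - c)) * (?J \<tau> * F (x - (m \<bullet> x - c) *\<^sub>R m + \<tau> *\<^sub>R m)) \<partial>lborel)
      = indicator {x. \<bar>m \<bullet> x - c\<bar> \<le> 1/2} x * (\<integral>\<^sup>+\<tau>. ?J \<tau> * F (x - (m \<bullet> x - c) *\<^sub>R m + \<tau> *\<^sub>R m) \<partial>lborel)"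
      by (simp add: nn_integral_cmult)
  qed
  finally show ?thesis ..
qed

text \<open>For fixed \<open>\<tau>\<close> the directions \<open>e\<close> and \<open>m\<close>
  differ by a translation along \<open>\<tau> *\<^sub>R (e - m)\<close>, which is parallel to the
  hyperplane because \<open>m \<bullet> (e - m) = 0\<close>. Slanted directions are required since
  the normal line at a boundary point of a convex cell can leave the cell at once.\<close>

lemma nn_integral_slanted_slab:
  fixes m e :: "'a::euclidean_space" and F :: "'a \<Rightarrow> ennreal"
  assumes m: "norm m = 1" and e: "m \<bullet> e = 1" and F[measurable]: "F \<in> borel_measurable borel"
  shows "(\<integral>\<^sup>+x. indicator {x. \<bar>m \<bullet> x - c\<bar> \<le> 1/2} x *
      (\<integral>\<^sup>+\<tau>. indicator {a..b} \<tau> * F (x - (m \<bullet> x - c) *\<^sub>R m + \<tau> *\<^sub>R e) \<partial>lborel) \<partial>lborel)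
    = (\<integral>\<^sup>+x. indicator {x. m \<bullet> x - c \<in> {a..b}} x * F x \<partial>lborel)"
proof -
  have mm: "m \<bullet> m = 1"
    using m by (simp add: norm_eq_1)
  let ?I = "\<lambda>x. indicator {x. \<bar>m \<bullet> x - c\<bar> \<le> 1/2} x :: ennreal"
  let ?p = "\<lambda>x. x - (m \<bullet> x - c) *\<^sub>R m"
  have swap: "(\<integral>\<^sup>+x. ?I x * (\<integral>\<^sup>+\<tau>. indicator {a..b} \<tau> * F (?p x + \<tau> *\<^sub>R d) \<partial>lborel) \<partial>lborel)
    = (\<integral>\<^sup>+\<tau>. (\<integral>\<^sup>+x. ?I x * (indicator {a..b} \<tau> * F (?p x + \<tau> *\<^sub>R d)) \<partial>lborel) \<partial>lborel)" for d
  proof -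
    have "(\<integral>\<^sup>+x. ?I x * (\<integral>\<^sup>+\<tau>. indicator {a..b} \<tau> * F (?p x + \<tau> *\<^sub>R d) \<partial>lborel) \<partial>lborel)
      = (\<integral>\<^sup>+x. (\<integral>\<^sup>+\<tau>. ?I x * (indicator {a..b} \<tau> * F (?p x + \<tau> *\<^sub>R d)) \<partial>lborel) \<partial>lborel)"
      by (simp add: nn_integral_cmult)
    also have "\<dots> = (\<integral>\<^sup>+\<tau>. (\<integral>\<^sup>+x. ?I x * (indicator {a..b} \<tau> * F (?p x + \<tau> *\<^sub>R d)) \<partial>lborel) \<partial>lborel)"
      by (rule lborel_pair.Fubini') measurable
    finally show ?thesis .
  qed
  have "(\<integral>\<^sup>+x. ?I x * (indicator {a..b} \<tau> * F (?p x + \<tau> *\<^sub>R e)) \<partial>lborel)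
    = (\<integral>\<^sup>+x. ?I x * (indicator {a..b} \<tau> * F (?p x + \<tau> *\<^sub>R m)) \<partial>lborel)" for \<tau>
    by (subst nn_integral_translate[of "\<lambda>x. ?I x * (indicator {a..b} \<tau> * F (?p x + \<tau> *\<^sub>R m))" "\<tau> *\<^sub>R (e - m)", symmetric])
      (simp_all add: inner_add_right inner_diff_right mm e algebra_simps indicator_def)
  then show ?thesis
    unfolding swap nn_integral_slab[OF m F, symmetric] by simp
qed

section \<open>Traces of C1 functions on flat compact sets\<close>

lemma C1_with_gradientD:
  assumes "C1_with_gradient \<phi> D\<phi>"
  shows "(\<phi> has_derivative (\<lambda>h. D\<phi> x \<bullet> h)) (at x)" "continuous_on UNIV D\<phi>" "continuous_on UNIV \<phi>"
proof -
  show 1: "(\<phi> has_derivative (\<lambda>h. D\<phi> x \<bullet> h)) (at x)" for x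
    using assms by (simp add: C1_with_gradient_def)
  show "continuous_on UNIV D\<phi>"
    using assms by (simp add: C1_with_gradient_def)
  show "continuous_on UNIV \<phi>"
    using 1 by (auto intro: has_derivative_continuous continuous_at_imp_continuous_on)
qed

lemma C1_borel:
  assumes "C1_with_gradient \<phi> D\<phi>"
  shows "\<phi> \<in> borel_measurable borel" "D\<phi> \<in> borel_measurable borel"
  using C1_with_gradientD[OF assms] by (auto intro: borel_measurable_continuous_onI)

text \<open>The weight \<open>h - \<tau>\<close> is \<open>h\<close> at 0 and 0 at \<open>h\<close>,
  so \<open>h * (\<phi> z)\<^sup>2\<close> is the integral of minus the derivative of
  \<open>(h - \<tau>) * (P \<tau>)\<^sup>2\<close>. In the constant, the summand 1 of
  \<open>1 + h\<close> pays for the square of \<open>P\<close>, the summand \<open>h\<close> for the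
  mixed term split by the arithmetic-geometric mean, and the quotient comes from dividing by
  \<open>h\<close>.\<close>

lemma line_trace_bound:
  fixes e :: "'a::euclidean_space"
  assumes \<phi>: "C1_with_gradient \<phi> D\<phi>" and h: "h > 0"
  shows "ennreal ((\<phi> z)\<^sup>2) \<le> ennreal ((1 + h) * (1 + (norm e)\<^sup>2) / h) *
    (\<integral>\<^sup>+\<tau>. indicator {0..h} \<tau> * ennreal ((\<phi> (z + \<tau> *\<^sub>R e))\<^sup>2 + (norm (D\<phi> (z + \<tau> *\<^sub>R e)))\<^sup>2) \<partial>lborel)"
proof -
  note C1 = C1_with_gradientD[OF \<phi>]
  define P where "P \<tau> = \<phi> (z + \<tau> *\<^sub>R e)" for \<tau>
  define P' where "P' \<tau> = D\<phi> (z + \<tau> *\<^sub>R e)" for \<tau>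
  define G where "G \<tau> = (P \<tau>)\<^sup>2 + (norm (P' \<tau>))\<^sup>2" for \<tau>
  define K where "K = (1 + h) * (1 + (norm e)\<^sup>2)"
  have dP: "(P has_real_derivative (P' \<tau> \<bullet> e)) (at \<tau>)" for \<tau>
  proof -
    have "(P has_derivative (\<lambda>s. D\<phi> (z + \<tau> *\<^sub>R e) \<bullet> (s *\<^sub>R e))) (at \<tau>)"
      unfolding P_def
      by (rule has_derivative_compose[where f="\<lambda>\<tau>. z + \<tau> *\<^sub>R e", OF _ C1(1)]) (auto intro!: derivative_eq_intros)
    then show ?thesis
      by (simp add: has_field_derivative_def P'_def mult.commute[of _ "D\<phi> (z + \<tau> *\<^sub>R e) \<bullet> e"])
  qed
  have cont: "continuous_on UNIV P" "continuous_on UNIV P'"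
    unfolding P_def P'_def
    by (auto intro!: continuous_on_compose2[OF C1(3)] continuous_on_compose2[OF C1(2)] continuous_intros)
  let ?k = "\<lambda>\<tau>. (h - \<tau>) * (P \<tau>)\<^sup>2"
  let ?k' = "\<lambda>\<tau>. (P \<tau>)\<^sup>2 - (h - \<tau>) * (2 * P \<tau> * (P' \<tau> \<bullet> e))"
  have "(?k' has_integral (- ?k h - (- ?k 0))) {0..h}"
    using h dP
    by (intro fundamental_theorem_of_calculus)
      (auto intro!: derivative_eq_intros DERIV_subset[OF dP] simp: has_real_derivative_iff_has_vector_derivative[symmetric] algebra_simps)
  then have k': "(?k' has_integral (h * (\<phi> z)\<^sup>2)) {0..h}"
    by (simp add: P_def)
  have "continuous_on {0..h} (\<lambda>\<tau>. K * G \<tau>)"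
    unfolding G_def using cont by (intro continuous_intros) (auto elim: continuous_on_subset)
  then have "(\<lambda>\<tau>. K * G \<tau>) integrable_on {0..h}"
    by (rule integrable_continuous_real)
  then obtain I where I: "((\<lambda>\<tau>. K * G \<tau>) has_integral I) {0..h}"
    by auto
  have bound: "?k' \<tau> \<le> K * G \<tau>" if \<tau>: "\<tau> \<in> {0..h}" for \<tau>
  proof -
    have "- (2 * P \<tau> * (P' \<tau> \<bullet> e)) \<le> 2 * \<bar>P \<tau>\<bar> * (norm (P' \<tau>) * norm e)"
    proof -
      have "- (2 * P \<tau> * (P' \<tau> \<bullet> e)) \<le> \<bar>2 * P \<tau> * (P' \<tau> \<bullet> e)\<bar>"
        by simp
      also have "\<dots> = 2 * \<bar>P \<tau>\<bar> * \<bar>P' \<tau> \<bullet> e\<bar>"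
        by (simp add: abs_mult)
      also have "\<dots> \<le> 2 * \<bar>P \<tau>\<bar> * (norm (P' \<tau>) * norm e)"
        by (intro mult_left_mono Cauchy_Schwarz_ineq2) simp
      finally show ?thesis .
    qed
    also have "\<dots> \<le> (P \<tau>)\<^sup>2 + (norm (P' \<tau>) * norm e)\<^sup>2"
      using sum_squares_bound[of "\<bar>P \<tau>\<bar>" "norm (P' \<tau>) * norm e"] by simp
    also have "\<dots> \<le> (1 + (norm e)\<^sup>2) * G \<tau>"
      by (simp add: G_def power_mult_distrib algebra_simps)
    finally have *: "- (2 * P \<tau> * (P' \<tau> \<bullet> e)) \<le> (1 + (norm e)\<^sup>2) * G \<tau>" .
    have G0: "0 \<le> (1 + (norm e)\<^sup>2) * G \<tau>"
      by (simp add: G_def)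
    have "(h - \<tau>) * (- (2 * P \<tau> * (P' \<tau> \<bullet> e))) \<le> (h - \<tau>) * ((1 + (norm e)\<^sup>2) * G \<tau>)"
      using \<tau> by (intro mult_left_mono *) auto
    also have "\<dots> \<le> h * ((1 + (norm e)\<^sup>2) * G \<tau>)"
      using \<tau> G0 by (intro mult_right_mono) auto
    finally have "?k' \<tau> \<le> (P \<tau>)\<^sup>2 + h * ((1 + (norm e)\<^sup>2) * G \<tau>)"
      by simp
    also have "(P \<tau>)\<^sup>2 \<le> (1 + (norm e)\<^sup>2) * G \<tau>"
      by (simp add: G_def algebra_simps)
    finally show ?thesis
      by (simp add: K_def algebra_simps)
  qed
  have "h * (\<phi> z)\<^sup>2 \<le> I"
    using has_integral_le[OF k' I bound] by auto
  moreover have "K \<ge> 0" "\<And>\<tau>. G \<tau> \<ge> 0"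
    using h by (auto simp: K_def G_def)
  then have "(\<integral>\<^sup>+\<tau>. ennreal (indicator {0..h} \<tau> * (K * G \<tau>)) \<partial>lborel) = I"
    by (intro nn_integral_has_integral_lebesgue I) auto
  ultimately have "ennreal (h * (\<phi> z)\<^sup>2) \<le> (\<integral>\<^sup>+\<tau>. ennreal (indicator {0..h} \<tau> * (K * G \<tau>)) \<partial>lborel)"
    by (auto intro: ennreal_leI)
  also have "\<dots> = (\<integral>\<^sup>+\<tau>. ennreal K * (indicator {0..h} \<tau> * ennreal (G \<tau>)) \<partial>lborel)"
    using \<open>K \<ge> 0\<close> \<open>\<And>\<tau>. G \<tau> \<ge> 0\<close>
    by (intro nn_integral_cong) (auto simp: indicator_def ennreal_mult)
  also have "\<dots> = ennreal K * (\<integral>\<^sup>+\<tau>. indicator {0..h} \<tau> * ennreal (G \<tau>) \<partial>lborel)"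
  proof (rule nn_integral_cmult)
    have [measurable]: "P \<in> borel_measurable borel" "P' \<in> borel_measurable borel"
      using cont by (auto intro: borel_measurable_continuous_onI)
    show "(\<lambda>\<tau>. indicator {0..h} \<tau> * ennreal (G \<tau>)) \<in> borel_measurable lborel"
      unfolding G_def by measurable
  qed
  finally have "ennreal (1 / h) * ennreal (h * (\<phi> z)\<^sup>2)
      \<le> ennreal (1 / h) * (ennreal K * (\<integral>\<^sup>+\<tau>. indicator {0..h} \<tau> * ennreal (G \<tau>) \<partial>lborel))"
    by (rule mult_left_mono) simp
  then show ?thesis
    using h \<open>K \<ge> 0\<close>
    by (simp add: mult.assoc[symmetric] ennreal_mult[symmetric] G_def P_def P'_def K_def)
qed

text \<open>From every point of \<open>R\<close> a segment runs into \<open>S\<close>, and the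
  one-dimensional bound along it is integrated over \<open>R\<close>. The slab formula wants one
  direction, and a direction serves only near a given point of \<open>R\<close>, so compactness
  splits \<open>R\<close> into finitely many pieces. \<open>C\<close> is chosen before \<phi>, as
  the Cauchy argument on the skeleton demands.\<close>

lemma trace_inequality:
  fixes S R :: "'a::euclidean_space set"
  assumes S: "open S" "convex S" "S \<noteq> {}" and R: "compact R" "R \<subseteq> closure S"
    and m: "norm m = 1" and RH: "R \<subseteq> {x. m \<bullet> x = c}" and above: "\<And>x. x \<in> S \<Longrightarrow> m \<bullet> x > c"
  obtains C where "C \<ge> 0" "\<And>\<phi> D\<phi>. C1_with_gradient \<phi> D\<phi> \<Longrightarrow>
    (\<integral>\<^sup>+x. ennreal ((\<phi> x)\<^sup>2) \<partial>surface_on R)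
      \<le> ennreal C * (\<integral>\<^sup>+x. indicator (closure S) x * ennreal ((\<phi> x)\<^sup>2 + (norm (D\<phi> x))\<^sup>2) \<partial>lborel)"
proof -
  obtain x0 where x0: "x0 \<in> S"
    using S by auto
  obtain r where r: "r > 0" "ball x0 r \<subseteq> S"
    using S(1) x0 openE by blast
  have R_borel: "R \<in> sets borel"
    using R(1) by (simp add: borel_compact)
  \<comment> \<open>Height of \<open>x0\<close> over the hyperplane. Division by \<open>h\<close>
    gives the direction \<open>(x0 - p) /\<^sub>R h\<close> normal component 1, and the parameter
    runs over \<open>{0..h}\<close>.\<close>
  define h where "h = m \<bullet> x0 - c"
  have h: "h > 0"
    using above[OF x0] by (simp add: h_def)
  define K where "K p = (1 + h) * (1 + (norm ((x0 - p) /\<^sub>R h))\<^sup>2) / h" for p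
  have K0: "K p \<ge> 0" for p
    using h by (simp add: K_def)
  have piece: "(\<integral>\<^sup>+x. ennreal ((\<phi> x)\<^sup>2) \<partial>surface_on (R \<inter> ball p r))
      \<le> ennreal (K p) * (\<integral>\<^sup>+x. indicator (closure S) x * ennreal ((\<phi> x)\<^sup>2 + (norm (D\<phi> x))\<^sup>2) \<partial>lborel)"
    if \<phi>: "C1_with_gradient \<phi> D\<phi>" and p: "p \<in> R" for \<phi> D\<phi> p
  proof -
    define e where "e = (x0 - p) /\<^sub>R h"
    have me: "m \<bullet> e = 1"
      using p RH h by (auto simp: e_def h_def inner_diff_right)
    define G where "G x = indicator (closure S) x * ennreal ((\<phi> x)\<^sup>2 + (norm (D\<phi> x))\<^sup>2)" for x
    note [measurable] = C1_borel[OF \<phi>]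
    have [measurable]: "closure S \<in> sets borel"
      by simp
    have G[measurable]: "G \<in> borel_measurable borel"
      unfolding G_def by measurable
    let ?p = "\<lambda>x. x - (m \<bullet> x - c) *\<^sub>R m"
    let ?I = "\<lambda>x. indicator {x. \<bar>m \<bullet> x - c\<bar> \<le> 1/2} x :: ennreal"
    \<comment> \<open>At \<open>\<tau> = h\<close> the segment ends in \<open>x0 + (z - p)\<close>,
      which lies in the ball around \<open>x0\<close> because \<open>z\<close> is within
      \<open>r\<close> of \<open>p\<close>; convexity of the closure covers the rest.\<close>
    have inside: "z + \<tau> *\<^sub>R e \<in> closure S" if z: "z \<in> R \<inter> ball p r" and \<tau>: "\<tau> \<in> {0..h}" for z \<tau>
    proof -
      define q where "q = x0 + (z - p)"
      have "q \<in> closure S"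
        using z r(2) closure_subset[of S] by (auto simp: q_def dist_norm norm_minus_commute subset_iff)
      moreover have "z \<in> closure S"
        using z R by auto
      moreover have "convex (closure S)"
        using S by (simp add: convex_closure)
      moreover have "z + \<tau> *\<^sub>R e = (1 - \<tau> / h) *\<^sub>R z + (\<tau> / h) *\<^sub>R q"
        by (simp add: q_def e_def algebra_simps divide_inverse)
      ultimately show ?thesis
        using \<tau> h by (simp add: convex_alt)
    qed
    have "(\<integral>\<^sup>+x. ennreal ((\<phi> x)\<^sup>2) \<partial>surface_on (R \<inter> ball p r))
      = (\<integral>\<^sup>+x. ?I x * (indicator (R \<inter> ball p r) (?p x) * ennreal ((\<phi> (?p x))\<^sup>2)) \<partial>lborel)"
      using RH R_borel by (intro nn_integral_surface_hyperplane m) auto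
    also have "\<dots> \<le> (\<integral>\<^sup>+x. ennreal (K p) * (?I x * (\<integral>\<^sup>+\<tau>. indicator {0..h} \<tau> * G (?p x + \<tau> *\<^sub>R e) \<partial>lborel)) \<partial>lborel)"
    proof (rule nn_integral_mono)
      fix x :: 'a
      have "indicator (R \<inter> ball p r) (?p x) * ennreal ((\<phi> (?p x))\<^sup>2)
          \<le> ennreal (K p) * (\<integral>\<^sup>+\<tau>. indicator {0..h} \<tau> * G (?p x + \<tau> *\<^sub>R e) \<partial>lborel)"
      proof (cases "?p x \<in> R \<inter> ball p r")
        case True
        have "(\<integral>\<^sup>+\<tau>. indicator {0..h} \<tau> * G (?p x + \<tau> *\<^sub>R e) \<partial>lborel)
          = (\<integral>\<^sup>+\<tau>. indicator {0..h} \<tau> * ennreal ((\<phi> (?p x + \<tau> *\<^sub>R e))\<^sup>2 + (norm (D\<phi> (?p x + \<tau> *\<^sub>R e)))\<^sup>2) \<partial>lborel)"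
          using inside[OF True] by (intro nn_integral_cong) (auto simp: G_def indicator_def)
        then show ?thesis
          using line_trace_bound[OF \<phi> h, of "?p x" e] True by (simp add: K_def e_def)
      qed simp
      then show "?I x * (indicator (R \<inter> ball p r) (?p x) * ennreal ((\<phi> (?p x))\<^sup>2))
          \<le> ennreal (K p) * (?I x * (\<integral>\<^sup>+\<tau>. indicator {0..h} \<tau> * G (?p x + \<tau> *\<^sub>R e) \<partial>lborel))"
        by (auto simp: indicator_def)
    qed
    also have "\<dots> = ennreal (K p) * (\<integral>\<^sup>+x. ?I x * (\<integral>\<^sup>+\<tau>. indicator {0..h} \<tau> * G (?p x + \<tau> *\<^sub>R e) \<partial>lborel) \<partial>lborel)"
      by (rule nn_integral_cmult) measurable
    also have "\<dots> = ennreal (K p) * (\<integral>\<^sup>+x. indicator {x. m \<bullet> x - c \<in> {0..h}} x * G x \<partial>lborel)"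
      by (rule arg_cong[OF nn_integral_slanted_slab[OF m me G]])
    also have "\<dots> \<le> ennreal (K p) * (\<integral>\<^sup>+x. G x \<partial>lborel)"
      by (intro mult_left_mono nn_integral_mono) (auto simp: indicator_def)
    finally show ?thesis
      by (simp add: G_def)
  qed
  obtain X where X: "finite X" "X \<subseteq> R" "R \<subseteq> (\<Union>p\<in>X. ball p r)"
  proof -
    have "R \<subseteq> (\<Union>p\<in>R. ball p r)"
      using r by auto
    then show ?thesis
      using compactE_image[OF R(1), of R "\<lambda>p. ball p r"] that by (metis open_ball)
  qed
  show ?thesis
  proof (rule that)
    show "(\<Sum>p\<in>X. K p) \<ge> 0"
      by (intro sum_nonneg K0)
    fix \<phi> :: "'a \<Rightarrow> real" and D\<phi> assume \<phi>: "C1_with_gradient \<phi> D\<phi>"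
    note [measurable] = C1_borel[OF \<phi>] R_borel borel_open[OF open_ball]
    let ?G = "\<integral>\<^sup>+x. indicator (closure S) x * ennreal ((\<phi> x)\<^sup>2 + (norm (D\<phi> x))\<^sup>2) \<partial>lborel"
    have "(\<integral>\<^sup>+x. ennreal ((\<phi> x)\<^sup>2) \<partial>surface_on R) = (\<integral>\<^sup>+x. ennreal ((\<phi> x)\<^sup>2) * indicator R x \<partial>surface)"
      unfolding surface_on_def by (subst nn_integral_restrict_space) auto
    also have "\<dots> \<le> (\<integral>\<^sup>+x. (\<Sum>p\<in>X. ennreal ((\<phi> x)\<^sup>2) * indicator (R \<inter> ball p r) x) \<partial>surface)"
    proof (rule nn_integral_mono)
      fix x
      show "ennreal ((\<phi> x)\<^sup>2) * indicator R x \<le> (\<Sum>p\<in>X. ennreal ((\<phi> x)\<^sup>2) * indicator (R \<inter> ball p r) x)"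
      proof (cases "x \<in> R")
        case True
        then obtain p where "p \<in> X" "x \<in> ball p r"
          using X by auto
        then show ?thesis
          using True X(1) member_le_sum[of p X "\<lambda>p. ennreal ((\<phi> x)\<^sup>2) * indicator (R \<inter> ball p r) x"]
          by simp
      qed simp
    qed
    also have "\<dots> = (\<Sum>p\<in>X. \<integral>\<^sup>+x. ennreal ((\<phi> x)\<^sup>2) * indicator (R \<inter> ball p r) x \<partial>surface)"
      by (rule nn_integral_sum) measurable
    also have "\<dots> = (\<Sum>p\<in>X. \<integral>\<^sup>+x. ennreal ((\<phi> x)\<^sup>2) \<partial>surface_on (R \<inter> ball p r))"
      unfolding surface_on_def by (subst nn_integral_restrict_space) auto
    also have "\<dots> \<le> (\<Sum>p\<in>X. ennreal (K p) * ?G)"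
      using X by (intro sum_mono piece \<phi>) auto
    also have "\<dots> = ennreal (\<Sum>p\<in>X. K p) * ?G"
      by (simp add: sum_distrib_right[symmetric] sum_ennreal K0)
    finally show "(\<integral>\<^sup>+x. ennreal ((\<phi> x)\<^sup>2) \<partial>surface_on R) \<le> ennreal (\<Sum>p\<in>X. K p) * ?G" .
  qed
qed

section \<open>Sobolev functions\<close>

lemma test_functionE:
  assumes "test_function S \<phi>"
  obtains D\<phi> K where "C1_with_gradient \<phi> D\<phi>" "\<And>x h. frechet_derivative \<phi> (at x) h = D\<phi> x \<bullet> h"
    "compact K" "K \<subseteq> S" "\<And>x. x \<notin> K \<Longrightarrow> \<phi> x = 0" "\<And>x. x \<notin> K \<Longrightarrow> D\<phi> x = 0"
proof -
  have diff: "dir_derivs vs \<phi> differentiable at x" for vs x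
    using assms by (simp add: test_function_def)
  obtain K where K: "compact K" "K \<subseteq> S" "\<And>x. x \<notin> K \<Longrightarrow> \<phi> x = 0"
    using assms by (auto simp: test_function_def)
  define D\<phi> where "D\<phi> x = (\<Sum>i\<in>Basis. frechet_derivative \<phi> (at x) i *\<^sub>R i)" for x
  have deriv: "(\<phi> has_derivative frechet_derivative \<phi> (at x)) (at x)" for x
    using diff[of "[]" x] by (simp add: frechet_derivative_works)
  have eq: "frechet_derivative \<phi> (at x) h = D\<phi> x \<bullet> h" for x h
  proof -
    have "linear (frechet_derivative \<phi> (at x))"
      using deriv by (rule has_derivative_linear)
    then have "frechet_derivative \<phi> (at x) (\<Sum>i\<in>Basis. (h \<bullet> i) *\<^sub>R i)
        = (\<Sum>i\<in>Basis. (h \<bullet> i) *\<^sub>R frechet_derivative \<phi> (at x) i)"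
      by (simp add: linear_sum linear_scale)
    then show ?thesis
      by (simp add: D\<phi>_def inner_sum_right inner_commute[of _ h] euclidean_representation mult.commute)
  qed
  have zero: "D\<phi> x = 0" if "x \<notin> K" for x
  proof -
    have "(\<phi> has_derivative (\<lambda>_. 0)) (at x)"
    proof (rule has_derivative_transform_within_open[of "\<lambda>_. 0"])
      show "open (- K)"
        using K(1) by (simp add: compact_imp_closed open_Compl)
    qed (use that K(3) in auto)
    then have "frechet_derivative \<phi> (at x) = (\<lambda>_. 0)"
      using deriv has_derivative_unique by blast
    then show ?thesis
      by (simp add: D\<phi>_def)
  qed
  \<comment> \<open>The iterated derivative in the single direction \<open>i\<close> is again
    differentiable, hence continuous: this is the continuity of the gradient that
    \<open>C1_with_gradient\<close> asks for.\<close>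
  have "continuous_on UNIV (\<lambda>x. frechet_derivative \<phi> (at x) i)" for i
    using diff[of "[i]"]
    by (auto simp: differentiable_on_def intro!: differentiable_imp_continuous_on differentiable_at_withinI)
  then have "continuous_on UNIV D\<phi>"
    unfolding D\<phi>_def by (intro continuous_intros)
  moreover have "frechet_derivative \<phi> (at x) = (\<lambda>h. D\<phi> x \<bullet> h)" for x
    using eq by auto
  ultimately have "C1_with_gradient \<phi> D\<phi>"
    using deriv unfolding C1_with_gradient_def by metis
  then show ?thesis
    using that eq K zero by blast
qed

lemma integral_lebesgue_on_support:
  fixes F :: "'a::euclidean_space \<Rightarrow> 'b::euclidean_space"
  assumes "S \<in> sets lebesgue" "\<And>x. x \<notin> S \<Longrightarrow> F x = 0"
  shows "integral\<^sup>L (lebesgue_on S) F = integral\<^sup>L lebesgue F"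
proof -
  have "integral\<^sup>L (lebesgue_on S) F = (\<integral>x. indicator S x *\<^sub>R F x \<partial>lebesgue)"
    using assms(1) by (subst integral_restrict_space) auto
  also have "\<dots> = integral\<^sup>L lebesgue F"
    using assms(2) by (intro Bochner_Integration.integral_cong) (auto simp: indicator_def)
  finally show ?thesis .
qed

lemma integral_lebesgue_on_subset_support:
  fixes F :: "'a::euclidean_space \<Rightarrow> 'b::euclidean_space"
  assumes "S \<in> sets lebesgue" "T \<in> sets lebesgue" "S \<subseteq> T" "\<And>x. x \<notin> S \<Longrightarrow> F x = 0"
  shows "integral\<^sup>L (lebesgue_on S) F = integral\<^sup>L (lebesgue_on T) F"
  using integral_lebesgue_on_support[of S F] integral_lebesgue_on_support[of T F] assms
  by (metis subset_iff)

text \<open>A divergence theorem without boundary: difference quotients of a compactly supported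
  function have integral 0 by translation invariance, and dominated convergence passes to the
  derivative.\<close>

lemma C1_integral_gradient:
  fixes \<psi> :: "'a::euclidean_space \<Rightarrow> real"
  assumes \<psi>: "C1_with_gradient \<psi> D\<psi>" and K: "compact K" "\<And>x. x \<notin> K \<Longrightarrow> \<psi> x = 0" "\<And>x. x \<notin> K \<Longrightarrow> D\<psi> x = 0"
  shows "(\<integral>x. D\<psi> x \<bullet> i \<partial>lborel) = 0"
proof -
  note C1 = C1_with_gradientD[OF \<psi>]
  note [measurable] = C1_borel[OF \<psi>]
  have "bounded (D\<psi> ` K)"
    using C1(2) K(1) by (meson compact_continuous_image compact_imp_bounded continuous_on_subset top_greatest)
  then obtain B where B: "\<And>x. x \<in> K \<Longrightarrow> norm (D\<psi> x) \<le> B" "B > 0"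
    by (auto simp: bounded_pos)
  have B': "norm (D\<psi> x) \<le> B" for x
    using B K(3)[of x] by (cases "x \<in> K") auto
  \<comment> \<open>The mean value inequality bounds all difference quotients by one
    constant.\<close>
  have lip: "\<bar>\<psi> y - \<psi> x\<bar> \<le> B * norm (y - x)" for x y
  proof -
    have "onorm (\<lambda>h. D\<psi> z \<bullet> h) \<le> B" for z
    proof (rule onorm_bound)
      fix h show "norm (D\<psi> z \<bullet> h) \<le> B * norm h"
        using Cauchy_Schwarz_ineq2[of "D\<psi> z" h] mult_right_mono[OF B'[of z], of "norm h"] by auto
    qed (use B in auto)
    then have "norm (\<psi> y - \<psi> x) \<le> B * norm (y - x)"
      using differentiable_bound[of UNIV \<psi> "\<lambda>z h. D\<psi> z \<bullet> h" B y x] C1(1) by auto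
    then show ?thesis
      by simp
  qed
  obtain M where M: "\<And>x. x \<in> K \<Longrightarrow> norm x \<le> M"
    using compact_imp_bounded[OF K(1)] by (auto simp: bounded_iff)
  define q where "q n x = real (Suc n) * (\<psi> (i /\<^sub>R real (Suc n) + x) - \<psi> x)" for n x
  have q_lim: "(\<lambda>n. q n x) \<longlonglongrightarrow> D\<psi> x \<bullet> i" for x
  proof -
    have "((\<lambda>h. \<psi> (x + h *\<^sub>R i)) has_derivative (\<lambda>h. D\<psi> (x + 0 *\<^sub>R i) \<bullet> (h *\<^sub>R i))) (at 0)"
      by (rule has_derivative_compose[where f="\<lambda>h. x + h *\<^sub>R i", OF _ C1(1)]) (auto intro!: derivative_eq_intros)
    then have "((\<lambda>h. \<psi> (x + h *\<^sub>R i)) has_real_derivative (D\<psi> x \<bullet> i)) (at 0)"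
      by (simp add: has_field_derivative_def mult.commute[of _ "D\<psi> x \<bullet> i"])
    then have "((\<lambda>h. (\<psi> (x + h *\<^sub>R i) - \<psi> x) / h) \<longlongrightarrow> D\<psi> x \<bullet> i) (at 0)"
      by (simp add: DERIV_def)
    then have "(\<lambda>n. (\<psi> (x + inverse (real (Suc n)) *\<^sub>R i) - \<psi> x) / inverse (real (Suc n))) \<longlonglongrightarrow> D\<psi> x \<bullet> i"
      by (rule filterlim_compose)
        (use LIMSEQ_inverse_real_of_nat in \<open>auto simp: filterlim_at\<close>)
    then show ?thesis
      by (simp add: q_def add.commute divide_inverse mult.commute)
  qed
  have int_\<psi>: "integrable lborel \<psi>"
  proof -
    have "set_integrable lborel K \<psi>"
      using C1(3) K(1) unfolding set_integrable_def
      by (intro borel_integrable_compact) (auto elim: continuous_on_subset)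
    then have "integrable lborel (\<lambda>x. indicator K x *\<^sub>R \<psi> x)"
      by (simp add: set_integrable_def)
    also have "(\<lambda>x. indicator K x *\<^sub>R \<psi> x) = \<psi>"
      using K(2) by (force simp: indicator_def)
    finally show ?thesis .
  qed
  have shift: "integrable lborel (\<lambda>x. \<psi> (a + x))" "(\<integral>x. \<psi> (a + x) \<partial>lborel) = (\<integral>x. \<psi> x \<partial>lborel)" for a
  proof -
    have "integrable (distr lborel borel ((+) a)) \<psi>"
      using int_\<psi> by (simp add: lborel_distr_plus)
    then show "integrable lborel (\<lambda>x. \<psi> (a + x))"
      by (subst (asm) integrable_distr_eq) auto
    have "(\<integral>x. \<psi> x \<partial>lborel) = (\<integral>x. \<psi> x \<partial>distr lborel borel ((+) a))"
      by (simp add: lborel_distr_plus)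
    also have "\<dots> = (\<integral>x. \<psi> (a + x) \<partial>lborel)"
      by (rule integral_distr) auto
    finally show "(\<integral>x. \<psi> (a + x) \<partial>lborel) = (\<integral>x. \<psi> x \<partial>lborel)" ..
  qed
  have "(\<integral>x. q n x \<partial>lborel) = 0" for n
    unfolding q_def using shift int_\<psi> by simp
  \<comment> \<open>The steps \<open>i /\<^sub>R real (Suc n)\<close> have length at most
    \<open>norm i\<close>, so all quotients vanish outside the ball of radius
    \<open>M + norm i\<close>.\<close>
  moreover have "(\<lambda>n. \<integral>x. q n x \<partial>lborel) \<longlonglongrightarrow> (\<integral>x. D\<psi> x \<bullet> i \<partial>lborel)"
  proof (rule integral_dominated_convergence[where w="\<lambda>x. indicator (cball 0 (M + norm i)) x *\<^sub>R (B * norm i)"])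
    show "integrable lborel (\<lambda>x::'a. indicator (cball 0 (M + norm i)) x *\<^sub>R (B * norm i))"
      by (intro integrable_scaleR_left integrable_real_indicator)
        (use emeasure_lborel_cball_finite in \<open>auto simp: less_top[symmetric]\<close>)
    fix n
    have "norm (q n x) \<le> indicator (cball 0 (M + norm i)) x *\<^sub>R (B * norm i)" for x
    proof (cases "x \<in> cball 0 (M + norm i)")
      case True
      have "norm (q n x) \<le> real (Suc n) * (B * norm (i /\<^sub>R real (Suc n)))"
        using lip[of "i /\<^sub>R real (Suc n) + x" x] by (simp add: q_def abs_mult mult_left_mono del: of_nat_Suc)
      then show ?thesis
        using True by (simp add: field_simps del: of_nat_Suc)
    next
      case False
      have "norm x \<le> norm (i /\<^sub>R real (Suc n) + x) + norm (i /\<^sub>R real (Suc n))"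
        by (metis add.commute add_diff_cancel_right' norm_triangle_ineq4)
      moreover have "norm (i /\<^sub>R real (Suc n)) \<le> norm i"
        by (simp add: field_simps mult_le_cancel_left1)
      ultimately have "i /\<^sub>R real (Suc n) + x \<notin> K" "x \<notin> K"
        using M[of x] M[of "i /\<^sub>R real (Suc n) + x"] False norm_ge_zero[of i]
        unfolding mem_cball_0 by linarith+
      then show ?thesis
        using B(2) by (simp add: q_def K(2) del: of_nat_Suc)
    qed
    then show "AE x in lborel. norm (q n x) \<le> indicator (cball 0 (M + norm i)) x *\<^sub>R (B * norm i)"
      by simp
  qed (use q_lim in \<open>auto simp: q_def\<close>)
  ultimately show ?thesis
    using LIMSEQ_unique[of "\<lambda>_::nat. 0::real"] by auto
qed

section \<open>C1 functions on bounded sets; differences and restrictions of Sobolev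
  functions\<close>

lemma finite_measure_lebesgue_on_bounded:
  "bounded S \<Longrightarrow> open S \<Longrightarrow> finite_measure (lebesgue_on S)"
  by (intro finite_measure_lebesgue_on) (simp add: lmeasurable_open)

lemma borel_measurable_lebesgue_on: "f \<in> borel_measurable borel \<Longrightarrow> f \<in> borel_measurable (lebesgue_on S)"
  by (intro measurable_restrict_space1 measurable_completion) simp

lemma continuous_bounded_on:
  fixes f :: "'a::euclidean_space \<Rightarrow> 'b::euclidean_space"
  assumes "continuous_on UNIV f" "bounded S"
  obtains B where "\<And>x. x \<in> S \<Longrightarrow> norm (f x) \<le> B"
proof -
  have "compact (f ` closure S)"
    using assms by (intro compact_continuous_image) (auto elim: continuous_on_subset)
  then obtain B where "\<And>x. x \<in> closure S \<Longrightarrow> norm (f x) \<le> B"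
    using compact_imp_bounded[of "f ` closure S"] unfolding bounded_iff by blast
  then show ?thesis
    using that closure_subset[of S] by blast
qed

lemma continuous_L2_lebesgue_on:
  fixes f :: "'a::euclidean_space \<Rightarrow> 'b::euclidean_space"
  assumes f: "continuous_on UNIV f" and S: "open S" "bounded S"
  shows "L2 (lebesgue_on S) f"
proof -
  interpret finite_measure "lebesgue_on S"
    using S by (simp add: finite_measure_lebesgue_on_bounded)
  obtain B where "\<And>x. x \<in> S \<Longrightarrow> norm (f x) \<le> B"
    using continuous_bounded_on[OF f S(2)] by blast
  then show ?thesis
    using f by (intro L2_bounded[where B=B]) (auto intro!: borel_measurable_lebesgue_on borel_measurable_continuous_onI)
qed

lemma finite_measure_surface_on:
  "S \<in> sets borel \<Longrightarrow> emeasure surface S < \<infinity> \<Longrightarrow> finite_measure (surface_on S)"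
  by (intro finite_measureI) (auto simp: surface_on_def space_restrict_space emeasure_restrict_space)

lemma continuous_L2_surface_on:
  fixes f :: "'a::euclidean_space \<Rightarrow> 'b::euclidean_space"
  assumes f: "continuous_on UNIV f" and S: "S \<in> sets borel" "bounded S" "emeasure surface S < \<infinity>"
  shows "L2 (surface_on S) f"
proof -
  interpret finite_measure "surface_on S"
    using S by (intro finite_measure_surface_on)
  obtain B where "\<And>x. x \<in> S \<Longrightarrow> norm (f x) \<le> B"
    using continuous_bounded_on[OF f S(2)] by blast
  moreover have "f \<in> borel_measurable surface"
    using borel_measurable_continuous_onI[OF f] by (simp cong: measurable_cong_sets)
  ultimately show ?thesis
    by (intro L2_bounded[where B=B]) (auto simp: surface_on_def space_restrict_space intro!: measurable_restrict_space1)
qed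

text \<open>Integration by parts: the gradient of \<open>\<phi> x * \<theta> x\<close> has integral
  0 because the test function \<theta> has compact support.\<close>

lemma C1_H1:
  fixes \<phi> :: "'a::euclidean_space \<Rightarrow> real"
  assumes \<phi>: "C1_with_gradient \<phi> D\<phi>" and S: "open S" "bounded S"
  shows "H1 S \<phi> D\<phi>"
  unfolding H1_def
proof (intro conjI allI impI ballI)
  note C1 = C1_with_gradientD[OF \<phi>]
  show "L2 (lebesgue_on S) \<phi>" "L2 (lebesgue_on S) D\<phi>"
    using C1 S by (auto intro: continuous_L2_lebesgue_on)
  fix \<theta> and i :: 'a assume "test_function S \<theta>"
  then obtain D\<theta> K where \<theta>: "C1_with_gradient \<theta> D\<theta>" "\<And>x h. frechet_derivative \<theta> (at x) h = D\<theta> x \<bullet> h"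
    "compact K" "K \<subseteq> S" "\<And>x. x \<notin> K \<Longrightarrow> \<theta> x = 0" "\<And>x. x \<notin> K \<Longrightarrow> D\<theta> x = 0"
    by (rule test_functionE) blast
  note T = C1_with_gradientD[OF \<theta>(1)]
  define D\<psi> where "D\<psi> x = \<phi> x *\<^sub>R D\<theta> x + \<theta> x *\<^sub>R D\<phi> x" for x
  have \<psi>: "C1_with_gradient (\<lambda>x. \<phi> x * \<theta> x) D\<psi>"
    unfolding C1_with_gradient_def
  proof (intro conjI allI)
    fix x
    show "((\<lambda>x. \<phi> x * \<theta> x) has_derivative (\<bullet>) (D\<psi> x)) (at x)"
      by (rule has_derivative_eq_rhs[OF has_derivative_mult[OF C1(1) T(1)]])
        (simp add: D\<psi>_def fun_eq_iff inner_add_left)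
    show "continuous_on UNIV D\<psi>"
      unfolding D\<psi>_def by (intro continuous_intros C1 T)
  qed
  have "0 = (\<integral>x. D\<psi> x \<bullet> i \<partial>lborel)"
    using C1_integral_gradient[OF \<psi> \<theta>(3)] \<theta>(5,6) by (simp add: D\<psi>_def)
  also have "\<dots> = (\<integral>x. D\<psi> x \<bullet> i \<partial>lebesgue)"
    using C1_borel[OF \<psi>] by (intro integral_completion[symmetric]) auto
  also have "\<dots> = (\<integral>x. D\<psi> x \<bullet> i \<partial>lebesgue_on S)"
    using S(1) \<theta>(4-6) by (intro integral_lebesgue_on_support[symmetric]) (auto simp: D\<psi>_def \<theta>(5,6)[OF contra_subsetD[OF \<theta>(4)]])
  also have "\<dots> = (\<integral>x. \<phi> x * (D\<theta> x \<bullet> i) + (D\<phi> x \<bullet> i) * \<theta> x \<partial>lebesgue_on S)"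
    by (simp add: D\<psi>_def inner_add_left mult.commute)
  also have "\<dots> = (\<integral>x. \<phi> x * (D\<theta> x \<bullet> i) \<partial>lebesgue_on S) + (\<integral>x. (D\<phi> x \<bullet> i) * \<theta> x \<partial>lebesgue_on S)"
    using S by (intro Bochner_Integration.integral_add L2_integrable_mult continuous_L2_lebesgue_on continuous_intros C1 T)
  finally show "(\<integral>x. \<phi> x * frechet_derivative \<theta> (at x) i \<partial>lebesgue_on S)
      = - (\<integral>x. D\<phi> x \<bullet> i * \<theta> x \<partial>lebesgue_on S)"
    by (simp add: \<theta>(2))
qed

lemma L2_inner_const:
  fixes f :: "'a \<Rightarrow> 'b::euclidean_space"
  assumes "L2 M f"
  shows "L2 M (\<lambda>x. f x \<bullet> i)"
  unfolding L2_def
proof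
  show m: "(\<lambda>x. f x \<bullet> i) \<in> borel_measurable M"
    using assms by (auto simp: L2_def)
  show "integrable M (\<lambda>x. (norm (f x \<bullet> i))\<^sup>2)"
  proof (rule Bochner_Integration.integrable_bound)
    show "integrable M (\<lambda>x. (norm i)\<^sup>2 * (norm (f x))\<^sup>2)"
      using assms by (auto simp: L2_def)
    show "(\<lambda>x. (norm (f x \<bullet> i))\<^sup>2) \<in> borel_measurable M"
      using m by auto
    have "(f x \<bullet> i)\<^sup>2 \<le> (norm i)\<^sup>2 * (norm (f x))\<^sup>2" for x
      using power_mono[OF Cauchy_Schwarz_ineq2, of "f x" i 2] by (simp add: power_mult_distrib mult.commute)
    then show "AE x in M. norm ((norm (f x \<bullet> i))\<^sup>2) \<le> norm ((norm i)\<^sup>2 * (norm (f x))\<^sup>2)"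
      by simp
  qed
qed

lemma H1_diff:
  assumes w: "H1 S w Dw" and v: "H1 S v Dv" and S: "open S" "bounded S"
  shows "H1 S (\<lambda>x. w x - v x) (\<lambda>x. Dw x - Dv x)"
  unfolding H1_def
proof (intro conjI allI impI ballI)
  have L: "L2 (lebesgue_on S) w" "L2 (lebesgue_on S) Dw" "L2 (lebesgue_on S) v" "L2 (lebesgue_on S) Dv"
    using w v by (auto simp: H1_def)
  show "L2 (lebesgue_on S) (\<lambda>x. w x - v x)" "L2 (lebesgue_on S) (\<lambda>x. Dw x - Dv x)"
    using L by (auto intro: L2_diff)
  fix \<theta> and i :: 'a assume \<theta>: "test_function S \<theta>" and i: "i \<in> Basis"
  obtain D\<theta> where T: "C1_with_gradient \<theta> D\<theta>" "\<And>x h. frechet_derivative \<theta> (at x) h = D\<theta> x \<bullet> h"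
    using test_functionE[OF \<theta>] by metis
  have LT: "L2 (lebesgue_on S) \<theta>" "L2 (lebesgue_on S) (\<lambda>x. frechet_derivative \<theta> (at x) i)"
    unfolding T(2) using S C1_with_gradientD[OF T(1)] by (auto intro!: continuous_L2_lebesgue_on continuous_intros)
  show "(\<integral>x. (w x - v x) * frechet_derivative \<theta> (at x) i \<partial>lebesgue_on S)
      = - (\<integral>x. (Dw x - Dv x) \<bullet> i * \<theta> x \<partial>lebesgue_on S)"
    using w v \<theta> i L LT unfolding H1_def
    by (simp add: left_diff_distrib inner_diff_left Bochner_Integration.integral_diff L2_integrable_mult L2_inner_const)
qed

lemma H1_subset:
  assumes w: "H1 T w Dw" and S: "open S" "open T" "S \<subseteq> T"
  shows "H1 S w Dw"
  unfolding H1_def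
proof (intro conjI allI impI ballI)
  have sets: "S \<in> sets lebesgue" "T \<in> sets lebesgue"
    using S by auto
  show "L2 (lebesgue_on S) w" "L2 (lebesgue_on S) Dw"
    using w L2_restrict_subset(1)[OF sets S(3)] by (auto simp: H1_def)
  fix \<theta> and i :: 'a assume \<theta>: "test_function S \<theta>" and i: "i \<in> Basis"
  then obtain D\<theta> K where T: "\<And>x h. frechet_derivative \<theta> (at x) h = D\<theta> x \<bullet> h"
    "K \<subseteq> S" "\<And>x. x \<notin> K \<Longrightarrow> \<theta> x = 0" "\<And>x. x \<notin> K \<Longrightarrow> D\<theta> x = 0"
    using test_functionE[OF \<theta>] by metis
  have "test_function T \<theta>"
    using \<theta> S(3) unfolding test_function_def by (meson subset_trans)
  then have "(\<integral>x. w x * frechet_derivative \<theta> (at x) i \<partial>lebesgue_on T)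
      = - (\<integral>x. Dw x \<bullet> i * \<theta> x \<partial>lebesgue_on T)"
    using w i by (auto simp: H1_def)
  moreover have "(\<integral>x. w x * frechet_derivative \<theta> (at x) i \<partial>lebesgue_on S) = (\<integral>x. w x * frechet_derivative \<theta> (at x) i \<partial>lebesgue_on T)"
    using T by (intro integral_lebesgue_on_subset_support sets S(3)) (metis inner_zero_left mult_zero_right subset_iff)
  moreover have "(\<integral>x. Dw x \<bullet> i * \<theta> x \<partial>lebesgue_on S) = (\<integral>x. Dw x \<bullet> i * \<theta> x \<partial>lebesgue_on T)"
    using T by (intro integral_lebesgue_on_subset_support sets S(3)) (metis mult_zero_right subset_iff)
  ultimately show "(\<integral>x. w x * frechet_derivative \<theta> (at x) i \<partial>lebesgue_on S)
      = - (\<integral>x. Dw x \<bullet> i * \<theta> x \<partial>lebesgue_on S)"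
    by simp
qed

lemma C1_with_gradient_diff:
  assumes "C1_with_gradient \<phi> D\<phi>" "C1_with_gradient \<psi> D\<psi>"
  shows "C1_with_gradient (\<lambda>x. \<phi> x - \<psi> x) (\<lambda>x. D\<phi> x - D\<psi> x)"
  using assms unfolding C1_with_gradient_def
  by (auto intro!: continuous_intros has_derivative_eq_rhs[OF has_derivative_diff] simp: inner_diff_left)

lemma L2norm_diff_tendsto_0:
  assumes lim: "(\<lambda>m. L2norm M (\<lambda>x. \<phi> m x - w x)) \<longlonglongrightarrow> 0" "(\<lambda>m. L2norm M (\<lambda>x. \<psi> m x - v x)) \<longlonglongrightarrow> 0"
    and L2: "\<And>m. L2 M (\<phi> m)" "L2 M w" "\<And>m. L2 M (\<psi> m)" "L2 M v"
  shows "(\<lambda>m. L2norm M (\<lambda>x. (\<phi> m x - \<psi> m x) - (w x - v x))) \<longlonglongrightarrow> 0"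
proof (rule real_tendsto_sandwich[OF _ _ tendsto_const tendsto_add_zero[OF lim]])
  have "L2norm M (\<lambda>x. (\<phi> m x - \<psi> m x) - (w x - v x))
      \<le> L2norm M (\<lambda>x. \<phi> m x - w x) + L2norm M (\<lambda>x. \<psi> m x - v x)" for m
  proof -
    have "(\<lambda>x. (\<phi> m x - \<psi> m x) - (w x - v x)) = (\<lambda>x. (\<phi> m x - w x) - (\<psi> m x - v x))"
      by auto
    then show ?thesis
      using L2norm_triangle_diff[OF L2_diff[OF L2(1,2)] L2_diff[OF L2(3,4)], of m m] by simp
  qed
  then show "\<forall>\<^sub>F m in sequentially. L2norm M (\<lambda>x. (\<phi> m x - \<psi> m x) - (w x - v x))
      \<le> L2norm M (\<lambda>x. \<phi> m x - w x) + L2norm M (\<lambda>x. \<psi> m x - v x)"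
    by simp
qed simp

lemma has_traceE:
  assumes "has_trace S w Dw t"
  obtains \<phi> D\<phi> where "\<And>m::nat. C1_with_gradient (\<phi> m) (D\<phi> m)"
    "(\<lambda>m. L2norm (lebesgue_on S) (\<lambda>x. \<phi> m x - w x)) \<longlonglongrightarrow> 0"
    "(\<lambda>m. L2norm (lebesgue_on S) (\<lambda>x. D\<phi> m x - Dw x)) \<longlonglongrightarrow> 0"
    "(\<lambda>m. L2norm (surface_on (frontier S)) (\<lambda>x. \<phi> m x - t x)) \<longlonglongrightarrow> 0"
  using assms unfolding has_trace_def by (elim conjE exE) (rule that; simp)

text \<open>The finite area of the frontier puts the approximants, which are merely continuous
  there, into L2 of the frontier, so that the triangle inequality applies.\<close>

lemma has_trace_diff:
  assumes w: "has_trace S w Dw t" and v: "has_trace S v Dv s"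
    and S: "open S" "bounded S" "emeasure surface (frontier S) < \<infinity>"
  shows "has_trace S (\<lambda>x. w x - v x) (\<lambda>x. Dw x - Dv x) (\<lambda>x. t x - s x)"
proof -
  have W: "H1 S w Dw" "L2 (surface_on (frontier S)) t"
    and V: "H1 S v Dv" "L2 (surface_on (frontier S)) s"
    using w v by (auto simp: has_trace_def)
  obtain \<phi> D\<phi> where \<phi>: "\<And>m::nat. C1_with_gradient (\<phi> m) (D\<phi> m)"
    "(\<lambda>m. L2norm (lebesgue_on S) (\<lambda>x. \<phi> m x - w x)) \<longlonglongrightarrow> 0"
    "(\<lambda>m. L2norm (lebesgue_on S) (\<lambda>x. D\<phi> m x - Dw x)) \<longlonglongrightarrow> 0"
    "(\<lambda>m. L2norm (surface_on (frontier S)) (\<lambda>x. \<phi> m x - t x)) \<longlonglongrightarrow> 0"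
    by (rule has_traceE[OF w]; rule that; assumption)
  obtain \<psi> D\<psi> where \<psi>: "\<And>m::nat. C1_with_gradient (\<psi> m) (D\<psi> m)"
    "(\<lambda>m. L2norm (lebesgue_on S) (\<lambda>x. \<psi> m x - v x)) \<longlonglongrightarrow> 0"
    "(\<lambda>m. L2norm (lebesgue_on S) (\<lambda>x. D\<psi> m x - Dv x)) \<longlonglongrightarrow> 0"
    "(\<lambda>m. L2norm (surface_on (frontier S)) (\<lambda>x. \<psi> m x - s x)) \<longlonglongrightarrow> 0"
    by (rule has_traceE[OF v]; rule that; assumption)
  have fr: "frontier S \<in> sets borel" "bounded (frontier S)"
    using S(2) by (auto simp: frontier_def bounded_diff)
  have L: "L2 (lebesgue_on S) (\<phi> m)" "L2 (lebesgue_on S) (D\<phi> m)" "L2 (surface_on (frontier S)) (\<phi> m)"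
    "L2 (lebesgue_on S) (\<psi> m)" "L2 (lebesgue_on S) (D\<psi> m)" "L2 (surface_on (frontier S)) (\<psi> m)" for m
    using C1_with_gradientD[OF \<phi>(1)[of m]] C1_with_gradientD[OF \<psi>(1)[of m]] S fr
    by (auto intro: continuous_L2_lebesgue_on continuous_L2_surface_on)
  show ?thesis
    unfolding has_trace_def
  proof (intro conjI exI allI)
    show "C1_with_gradient (\<lambda>x. \<phi> m x - \<psi> m x) (\<lambda>x. D\<phi> m x - D\<psi> m x)" for m
      by (intro C1_with_gradient_diff \<phi> \<psi>)
    show "H1 S (\<lambda>x. w x - v x) (\<lambda>x. Dw x - Dv x)"
      by (intro H1_diff W V S)
    show "L2 (surface_on (frontier S)) (\<lambda>x. t x - s x)"
      by (intro L2_diff W V)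
    have H: "L2 (lebesgue_on S) w" "L2 (lebesgue_on S) Dw" "L2 (lebesgue_on S) v" "L2 (lebesgue_on S) Dv"
      using W(1) V(1) by (auto simp: H1_def)
    show "(\<lambda>m. L2norm (lebesgue_on S) (\<lambda>x. (\<phi> m x - \<psi> m x) - (w x - v x))) \<longlonglongrightarrow> 0"
      "(\<lambda>m. L2norm (lebesgue_on S) (\<lambda>x. (D\<phi> m x - D\<psi> m x) - (Dw x - Dv x))) \<longlonglongrightarrow> 0"
      using L2norm_diff_tendsto_0[OF \<phi>(2) \<psi>(2) L(1) H(1) L(4) H(3)]
        L2norm_diff_tendsto_0[OF \<phi>(3) \<psi>(3) L(2) H(2) L(5) H(4)] by simp_all
    show "(\<lambda>m. L2norm (surface_on (frontier S)) (\<lambda>x. (\<phi> m x - \<psi> m x) - (t x - s x))) \<longlonglongrightarrow> 0"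
      by (rule L2norm_diff_tendsto_0[OF \<phi>(4) \<psi>(4) L(3) W(2) L(6) V(2)])
  qed
qed

text \<open>The constant sequence approximates \<phi>. This serves to subtract a mean value from a
  function and its trace at the same time.\<close>

lemma C1_has_trace:
  assumes \<phi>: "C1_with_gradient \<phi> D\<phi>" and S: "open S" "bounded S" "emeasure surface (frontier S) < \<infinity>"
  shows "has_trace S \<phi> D\<phi> \<phi>"
  unfolding has_trace_def
proof (intro conjI exI allI)
  show "L2 (surface_on (frontier S)) \<phi>"
    using C1_with_gradientD(3)[OF \<phi>] S
    by (intro continuous_L2_surface_on) (auto simp: frontier_def bounded_diff)
  show "C1_with_gradient \<phi> D\<phi>"
    by fact
qed (use C1_H1[OF \<phi> S(1,2)] in \<open>auto simp: L2norm_def\<close>)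

text \<open>The two boundary conditions may come with different representatives \<open>t\<close> and
  \<open>s\<close> of the trace of \<open>w\<close>. Writing \<open>u - v\<close> as
  \<open>(u - w) - (v - w)\<close> gives the trace \<open>(t - t) - (s - s)\<close>, which is 0
  without an appeal to uniqueness of traces.\<close>

lemma H10_diff:
  assumes "equal_traces S u Du w Dw" "equal_traces S v Dv w Dw"
    and S: "open S" "bounded S" "emeasure surface (frontier S) < \<infinity>"
  shows "H10 S (\<lambda>x. u x - v x) (\<lambda>x. Du x - Dv x)"
proof -
  obtain t s where "has_trace S u Du t" "has_trace S w Dw t" "has_trace S v Dv s" "has_trace S w Dw s"
    using assms by (auto simp: equal_traces_def)
  then have "has_trace S (\<lambda>x. (u x - w x) - (v x - w x)) (\<lambda>x. (Du x - Dw x) - (Dv x - Dw x))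
      (\<lambda>x. (t x - t x) - (s x - s x))"
    using S by (intro has_trace_diff)
  then show ?thesis
    by (simp add: H10_def)
qed

section \<open>Polyhedral domains and convex cells\<close>

lemma subset_unit_hyperplane:
  fixes a :: "'a::euclidean_space"
  assumes "a \<noteq> 0" "S \<subseteq> {x. a \<bullet> x = b}"
  obtains m c where "norm m = 1" "S \<subseteq> {x. m \<bullet> x = c}"
proof (rule that)
  show "norm (a /\<^sub>R norm a) = 1"
    using assms(1) by simp
  show "S \<subseteq> {x. (a /\<^sub>R norm a) \<bullet> x = b / norm a}"
    using assms by (auto simp: divide_inverse mult.commute)
qed

lemma emeasure_surface_lowdim:
  fixes S :: "'a::euclidean_space set"
  assumes "aff_dim S < DIM('a)" "S \<in> sets borel" "bounded S"
  shows "emeasure surface S < \<infinity>"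
proof -
  obtain a b where "a \<noteq> 0" "S \<subseteq> {x. a \<bullet> x = b}"
    using aff_lowdim_subset_hyperplane[OF assms(1)] .
  then obtain m c where "norm m = 1" "S \<subseteq> {x. m \<bullet> x = c}"
    by (rule subset_unit_hyperplane)
  then show ?thesis
    using emeasure_surface_bounded_hyperplane assms by blast
qed

lemma emeasure_surface_UN_finite:
  fixes A :: "'i \<Rightarrow> 'a::euclidean_space set"
  assumes "finite I" "\<And>i. i \<in> I \<Longrightarrow> A i \<in> sets borel" "\<And>i. i \<in> I \<Longrightarrow> emeasure surface (A i) < \<infinity>"
  shows "emeasure surface (\<Union>i\<in>I. A i) < \<infinity>"
proof -
  have "emeasure surface (\<Union>i\<in>I. A i) \<le> (\<Sum>i\<in>I. emeasure surface (A i))"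
    using assms by (intro emeasure_subadditive_finite) auto
  also have "\<dots> < \<infinity>"
    using assms by simp
  finally show ?thesis .
qed

text \<open>A polytope of lower dimension lies in one hyperplane and contains its frontier; the
  frontier of a full-dimensional one is the finite union of its facets, each bounded and contained
  in a hyperplane.\<close>

lemma emeasure_surface_frontier_polytope:
  fixes p :: "'a::euclidean_space set"
  assumes p: "polytope p"
  shows "emeasure surface (frontier p) < \<infinity>"
proof (cases "aff_dim p < DIM('a)")
  case True
  have "closed p" "bounded p"
    using p by (auto simp: polytope_imp_closed polytope_imp_bounded)
  then have "emeasure surface p < \<infinity>"
    using emeasure_surface_lowdim[OF True] by (simp add: borel_closed)
  moreover have "emeasure surface (frontier p) \<le> emeasure surface p"
    using \<open>closed p\<close> by (intro emeasure_mono) (auto simp: frontier_subset_closed borel_closed)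
  ultimately show ?thesis
    by (rule le_less_trans[rotated])
next
  case False
  then have full: "aff_dim p = DIM('a)"
    using aff_dim_le_DIM[of p] by simp
  then have "affine hull p = UNIV"
    by (simp add: aff_dim_eq_full)
  then have "frontier p = rel_frontier p"
    by (simp add: frontier_def rel_frontier_def rel_interior_interior)
  also have "\<dots> = (\<Union>F\<in>{F. F facet_of p}. F)"
    using rel_frontier_of_polyhedron[OF polytope_imp_polyhedron[OF p]] by simp
  finally have "frontier p = (\<Union>F\<in>{F. F facet_of p}. F)" .
  moreover have "polytope F" "aff_dim F < DIM('a)" if "F facet_of p" for F
    using that p full by (auto simp: facet_of_def face_of_polytope_polytope)
  then have "F \<in> sets borel" "emeasure surface F < \<infinity>" if "F facet_of p" for F
    using that emeasure_surface_lowdim[of F]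
    by (auto simp: polytope_imp_closed polytope_imp_bounded borel_closed)
  moreover have "finite {F. F facet_of p}"
    by (rule finite_polytope_facets[OF p])
  ultimately show ?thesis
    using emeasure_surface_UN_finite[of "{F. F facet_of p}" "\<lambda>F. F"] by simp
qed

text \<open>A Lipschitz domain has no slits. Moving from \<open>p\<close> a little along
  \<open>e\<close> keeps the argument of \<open>\<psi>\<close> and raises the height strictly above
  the graph; near the point \<open>q\<close> reached there is nothing of \<open>S\<close>, so
  \<open>q\<close> is not in the closure.\<close>

lemma lipschitz_boundary_frontier_interior_closure:
  fixes S :: "'a::euclidean_space set"
  assumes "lipschitz_boundary S" "open S" "p \<in> frontier S"
  shows "p \<notin> interior (closure S)"
proof
  assume "p \<in> interior (closure S)"
  obtain U e \<psi> L where U: "open U" "p \<in> U" "norm e = 1" "L-lipschitz_on UNIV (\<psi> :: 'a \<Rightarrow> real)"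
    and eq: "S \<inter> U = {x \<in> U. e \<bullet> x < \<psi> (x - (e \<bullet> x) *\<^sub>R e)}"
    using bspec[OF assms(1)[unfolded lipschitz_boundary_def] assms(3)]
    by (elim exE conjE) (rule that; assumption)
  have ee: "e \<bullet> e = 1"
    using U(3) by (simp add: norm_eq_1)
  have cont: "continuous_on UNIV (\<lambda>x. \<psi> (x - (e \<bullet> x) *\<^sub>R e))"
    by (intro continuous_on_compose2[OF lipschitz_on_continuous_on[OF U(4)]] continuous_intros) auto
  have "p \<notin> S"
    using assms by (simp add: frontier_def interior_open)
  then have pp: "e \<bullet> p \<ge> \<psi> (p - (e \<bullet> p) *\<^sub>R e)"
    using eq U(2) by force
  have "open (U \<inter> interior (closure S))"
    using U by auto
  then obtain r where r: "r > 0" "ball p r \<subseteq> U \<inter> interior (closure S)"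
    using U(2) \<open>p \<in> interior (closure S)\<close> by (meson IntI openE)
  define q where "q = p + (r / 2) *\<^sub>R e"
  have "dist p q < r"
    using r(1) U(3) by (simp add: q_def dist_norm)
  then have q: "q \<in> U" "q \<in> closure S"
    using r(2) interior_subset by (auto simp: subset_iff)
  have "q - (e \<bullet> q) *\<^sub>R e = p - (e \<bullet> p) *\<^sub>R e" "e \<bullet> q = e \<bullet> p + r / 2"
    by (simp_all add: q_def inner_add_right ee algebra_simps)
  then have above: "e \<bullet> q > \<psi> (q - (e \<bullet> q) *\<^sub>R e)"
    using pp r(1) by simp
  have "open {x. \<psi> (x - (e \<bullet> x) *\<^sub>R e) < e \<bullet> x}"
    by (intro open_Collect_less cont continuous_intros)
  then have "open (U \<inter> {x. \<psi> (x - (e \<bullet> x) *\<^sub>R e) < e \<bullet> x})"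
    using U(1) by auto
  moreover have "(U \<inter> {x. \<psi> (x - (e \<bullet> x) *\<^sub>R e) < e \<bullet> x}) \<inter> S = {}"
    using eq by force
  ultimately show False
    using q above open_Int_closure_eq_empty by blast
qed

text \<open>A frontier point in the interior of one of the polytopes would be interior to the
  closure of \<open>S\<close>, which the Lipschitz boundary excludes; so the frontier is covered by
  the frontiers of the polytopes.\<close>

lemma emeasure_surface_frontier_domain:
  assumes "polyhedral_lipschitz_domain S"
  shows "emeasure surface (frontier S) < \<infinity>"
proof -
  obtain P where P: "finite P" "\<And>p. p \<in> P \<Longrightarrow> polytope p" "closure S = \<Union>P"
    using assms by (auto simp: polyhedral_lipschitz_domain_def)
  have "frontier S \<subseteq> (\<Union>p\<in>P. frontier p)"
  proof
    fix x assume x: "x \<in> frontier S"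
    then obtain p where p: "p \<in> P" "x \<in> p"
      using P(3) by (auto simp: frontier_def)
    moreover have "x \<notin> interior p"
      using lipschitz_boundary_frontier_interior_closure[OF _ _ x] assms p(1) P(3) interior_mono[of p "closure S"]
      by (auto simp: polyhedral_lipschitz_domain_def)
    ultimately show "x \<in> (\<Union>p\<in>P. frontier p)"
      using closure_subset by (auto simp: frontier_def)
  qed
  then have "emeasure surface (frontier S) \<le> emeasure surface (\<Union>p\<in>P. frontier p)"
    using P(1) by (intro emeasure_mono) (auto intro!: sets.finite_UN borel_closed)
  also have "\<dots> < \<infinity>"
    using P by (intro emeasure_surface_UN_finite emeasure_surface_frontier_polytope) (auto intro: borel_closed)
  finally show ?thesis .
qed

section \<open>Hyperplanes between disjoint convex cells\<close>

text \<open>Weak separation becomes strict because the sets are open: a short step along the normal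
  stays in the set and would cross the hyperplane. The closures lie in opposite closed half-spaces,
  which is why an interface is flat.\<close>

lemma open_convex_separation:
  fixes S T :: "'a::euclidean_space set"
  assumes S: "open S" "convex S" "S \<noteq> {}" and T: "open T" "convex T" "T \<noteq> {}" and disj: "S \<inter> T = {}"
  obtains m c where "norm m = 1" "\<And>x. x \<in> S \<Longrightarrow> m \<bullet> x < c" "\<And>x. x \<in> T \<Longrightarrow> m \<bullet> x > c"
    "closure S \<inter> closure T \<subseteq> {x. m \<bullet> x = c}"
proof -
  obtain a b where a: "a \<noteq> 0" and ab: "\<And>x. x \<in> S \<Longrightarrow> a \<bullet> x \<le> b" "\<And>x. x \<in> T \<Longrightarrow> a \<bullet> x \<ge> b"
    using separating_hyperplane_sets[OF S(2) T(2) S(3) T(3) disj] by blast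
  define m where "m = a /\<^sub>R norm a"
  define c where "c = b / norm a"
  have m: "norm m = 1"
    using a by (simp add: m_def)
  then have mm: "m \<bullet> m = 1"
    by (simp add: norm_eq_1)
  have le: "m \<bullet> x \<le> c" if "x \<in> S" for x
    using ab(1)[OF that] a by (simp add: m_def c_def field_simps)
  have ge: "m \<bullet> x \<ge> c" if "x \<in> T" for x
    using ab(2)[OF that] a by (simp add: m_def c_def field_simps)
  have "m \<bullet> x < c" if x: "x \<in> S" for x
  proof -
    obtain r where r: "r > 0" "ball x r \<subseteq> S"
      using S(1) x openE by blast
    have "x + (r / 2) *\<^sub>R m \<in> S"
      using r m by (intro subsetD[OF r(2)]) (simp add: dist_norm)
    then show ?thesis
      using le[of "x + (r / 2) *\<^sub>R m"] r(1) by (simp add: inner_add_right mm)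
  qed
  moreover have "m \<bullet> x > c" if x: "x \<in> T" for x
  proof -
    obtain r where r: "r > 0" "ball x r \<subseteq> T"
      using T(1) x openE by blast
    have "x - (r / 2) *\<^sub>R m \<in> T"
      using r m by (intro subsetD[OF r(2)]) (simp add: dist_norm)
    then show ?thesis
      using ge[of "x - (r / 2) *\<^sub>R m"] r(1) by (simp add: inner_diff_right mm)
  qed
  moreover have "closure S \<subseteq> {x. m \<bullet> x \<le> c}"
    using le by (intro closure_minimal closed_halfspace_le) auto
  moreover have "closure T \<subseteq> {x. m \<bullet> x \<ge> c}"
    using ge by (intro closure_minimal closed_halfspace_ge) auto
  ultimately show ?thesis
    using that[OF m] by force
qed

text \<open>With \<open>v\<close> the part of \<open>n\<close> orthogonal to \<open>m\<close>, the
  points \<open>c *\<^sub>R m + s *\<^sub>R v\<close> all lie in the hyperplane. As \<open>n\<close>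
  has the same value on them, \<open>v = 0\<close>, and unit vectors that are multiples of each
  other agree up to sign.\<close>

lemma unit_hyperplane_eq:
  fixes m n :: "'a::euclidean_space"
  assumes m: "norm m = 1" and n: "norm n = 1" and eq: "{x. m \<bullet> x = c} = {x. n \<bullet> x = b}"
  shows "n = m \<and> b = c \<or> n = - m \<and> b = - c"
proof -
  have mm: "m \<bullet> m = 1"
    using m by (simp add: norm_eq_1)
  define v where "v = n - (n \<bullet> m) *\<^sub>R m"
  have mv: "m \<bullet> v = 0"
    by (simp add: v_def inner_diff_right mm inner_commute)
  have b: "n \<bullet> (c *\<^sub>R m + s *\<^sub>R v) = b" for s
  proof -
    have "c *\<^sub>R m + s *\<^sub>R v \<in> {x. m \<bullet> x = c}"
      using mv by (simp add: inner_add_right mm)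
    then show ?thesis
      using eq by simp
  qed
  have "n \<bullet> v = 0"
    using b[of 0] b[of 1] by (simp add: inner_add_right)
  then have "v \<bullet> v = 0"
    using mv by (simp add: v_def inner_diff_left)
  then have n_eq: "n = (n \<bullet> m) *\<^sub>R m"
    by (simp add: v_def)
  then have "\<bar>n \<bullet> m\<bar> = 1"
    using n m by (metis mult.right_neutral norm_scaleR)
  moreover have "b = c * (n \<bullet> m)"
    using b[of 0] by simp
  ultimately show ?thesis
    using n_eq by (cases "n \<bullet> m \<ge> 0") auto
qed

text \<open>
  A set of positive area determines the hyperplane that contains it; and three cells
  cannot be pairwise separated by one and the same hyperplane.
\<close>

lemma emeasure_surface_triple_intersection:
  fixes S T U :: "'a::euclidean_space set"
  assumes S: "open S" "convex S" "S \<noteq> {}" and T: "open T" "convex T" "T \<noteq> {}" and U: "open U" "convex U" "U \<noteq> {}"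
    and disj: "S \<inter> T = {}" "T \<inter> U = {}" "S \<inter> U = {}"
  shows "emeasure surface (closure S \<inter> closure T \<inter> closure U) = 0"
proof (rule ccontr)
  let ?R = "closure S \<inter> closure T \<inter> closure U"
  assume pos: "emeasure surface ?R \<noteq> 0"
  have R: "?R \<in> sets borel"
    by (intro borel_closed) auto
  obtain m c where m: "norm m = 1" "\<And>x. x \<in> S \<Longrightarrow> m \<bullet> x < c" "\<And>x. x \<in> T \<Longrightarrow> m \<bullet> x > c"
    "closure S \<inter> closure T \<subseteq> {x. m \<bullet> x = c}"
    using open_convex_separation[OF S T disj(1)] by blast
  obtain n b where n: "norm n = 1" "\<And>x. x \<in> T \<Longrightarrow> n \<bullet> x < b" "\<And>x. x \<in> U \<Longrightarrow> n \<bullet> x > b"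
    "closure T \<inter> closure U \<subseteq> {x. n \<bullet> x = b}"
    using open_convex_separation[OF T U disj(2)] by blast
  obtain l d where l: "norm l = 1" "\<And>x. x \<in> S \<Longrightarrow> l \<bullet> x < d" "\<And>x. x \<in> U \<Longrightarrow> l \<bullet> x > d"
    "closure S \<inter> closure U \<subseteq> {x. l \<bullet> x = d}"
    using open_convex_separation[OF S U disj(3)] by blast
  have "{x. m \<bullet> x = c} = {x. n \<bullet> x = b}"
    using emeasure_surface_two_hyperplanes[OF m(1) n(1) R, of c b] m(4) n(4) pos by auto
  then have nm: "n = m \<and> b = c \<or> n = - m \<and> b = - c"
    using unit_hyperplane_eq[OF m(1) n(1)] by simp
  have "{x. m \<bullet> x = c} = {x. l \<bullet> x = d}"
    using emeasure_surface_two_hyperplanes[OF m(1) l(1) R, of c d] m(4) l(4) pos by auto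
  then have lm: "l = m \<and> d = c \<or> l = - m \<and> d = - c"
    using unit_hyperplane_eq[OF m(1) l(1)] by simp
  obtain s t u where "s \<in> S" "t \<in> T" "u \<in> U"
    using S T U by auto
  then show False
    using nm lm m(2)[of s] m(3)[of t] n(2)[of t] n(3)[of u] l(2)[of s] l(3)[of u] by auto
qed

text \<open>Positive area leaves only one hyperplane through the interface, so \<open>n\<close> is
  plus or minus the separating normal and points out of one cell and into the other. Hence
  \<open>normal_component\<close> flips the sign of the outer trace for just one of the two
  cells.\<close>

lemma outward_for_exactly_one_side:
  fixes S T :: "'a::euclidean_space set"
  assumes S: "open S" "convex S" "S \<noteq> {}" and T: "open T" "convex T" "T \<noteq> {}" and disj: "S \<inter> T = {}"
    and pos: "emeasure surface (closure S \<inter> closure T) > 0" and n: "is_unit_normal (closure S \<inter> closure T) n"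
  shows "(\<forall>a\<in>S. \<forall>z\<in>closure S \<inter> closure T. n \<bullet> a \<le> n \<bullet> z)
    \<longleftrightarrow> \<not> (\<forall>a\<in>T. \<forall>z\<in>closure S \<inter> closure T. n \<bullet> a \<le> n \<bullet> z)"
proof -
  let ?R = "closure S \<inter> closure T"
  have R: "?R \<in> sets borel"
    by (intro borel_closed) auto
  obtain m c where m: "norm m = 1" "\<And>x. x \<in> S \<Longrightarrow> m \<bullet> x < c" "\<And>x. x \<in> T \<Longrightarrow> m \<bullet> x > c"
    "?R \<subseteq> {x. m \<bullet> x = c}"
    using open_convex_separation[OF S T disj] by blast
  have "?R \<noteq> {}"
    using pos by (metis emeasure_empty less_irrefl)
  then obtain z where z: "z \<in> ?R"
    by blast
  have n1: "norm n = 1"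
    using n by (simp add: is_unit_normal_def)
  have Rn: "?R \<subseteq> {x. n \<bullet> x = n \<bullet> z}"
  proof
    fix x assume "x \<in> ?R"
    then have "n \<bullet> (x - z) = 0"
      using n z unfolding is_unit_normal_def by blast
    then show "x \<in> {x. n \<bullet> x = n \<bullet> z}"
      by (simp add: inner_diff_right)
  qed
  have "{x. m \<bullet> x = c} = {x. n \<bullet> x = n \<bullet> z}"
    using emeasure_surface_two_hyperplanes[OF m(1) n1 R m(4) Rn] pos by (metis less_irrefl)
  then consider "n = m" "n \<bullet> z = c" | "n = - m" "n \<bullet> z = - c"
    using unit_hyperplane_eq[OF m(1) n1] by auto
  then show ?thesis
  proof cases
    case 1
    have "\<forall>a\<in>S. \<forall>z\<in>?R. n \<bullet> a \<le> n \<bullet> z"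
      using m(2) m(4) 1(1) by (fastforce intro: less_imp_le)
    moreover obtain t where "t \<in> T"
      using T by auto
    then have "\<not> n \<bullet> t \<le> n \<bullet> z"
      using m(3)[of t] 1 by simp
    ultimately show ?thesis
      using z \<open>t \<in> T\<close> by blast
  next
    case 2
    have "\<forall>a\<in>T. \<forall>z\<in>?R. n \<bullet> a \<le> n \<bullet> z"
      using m(3) m(4) 2(1) by (fastforce intro: less_imp_le)
    moreover obtain s where "s \<in> S"
      using S by auto
    then have "\<not> n \<bullet> s \<le> n \<bullet> z"
      using m(2)[of s] 2 by simp
    ultimately show ?thesis
      using z \<open>s \<in> S\<close> by blast
  qed
qed

section \<open>Frontiers and interfaces of the cells of a partition\<close>

lemma convex_partitionD:
  assumes "convex_partition S N \<omega>" "k \<in> {1..N}"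
  shows "open (\<omega> k)" "convex (\<omega> k)" "\<omega> k \<noteq> {}" "\<omega> k \<subseteq> S"
    "j \<in> {1..N} \<Longrightarrow> j \<noteq> k \<Longrightarrow> \<omega> k \<inter> \<omega> j = {}"
  using assms unfolding convex_partition_def by auto

lemma interface_commute: "interface \<omega> k j = interface \<omega> j k"
  by (auto simp: interface_def)

lemma interface_subset_frontier:
  assumes "convex_partition S N \<omega>" "k \<in> {1..N}" "j \<in> {1..N}" "j \<noteq> k"
  shows "interface \<omega> k j \<subseteq> frontier (\<omega> k)"
proof -
  note P = convex_partitionD[OF assms(1,2)]
  have "\<omega> k \<inter> closure (\<omega> j) = {}"
    using P(1) P(5)[OF assms(3,4)] open_Int_closure_eq_empty by blast
  then show ?thesis
    using P(1) by (auto simp: interface_def frontier_def interior_open)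
qed

text \<open>Off the right-hand side, \<open>x\<close> has a neighbourhood in \<open>S\<close> that
  meets no other closed cell and is therefore contained in the closure of \<open>\<omega> k\<close>.
  An open convex set is the interior of its closure, which would put \<open>x\<close> into
  \<open>\<omega> k\<close>.\<close>

lemma frontier_cell_subset:
  assumes P: "convex_partition S N \<omega>" and S: "open S" and k: "k \<in> {1..N}"
  shows "frontier (\<omega> k) \<subseteq> frontier S \<union> (\<Union>j\<in>{1..N} - {k}. interface \<omega> k j)"
proof
  note C = convex_partitionD[OF P k]
  fix x assume x: "x \<in> frontier (\<omega> k)"
  show "x \<in> frontier S \<union> (\<Union>j\<in>{1..N} - {k}. interface \<omega> k j)"
  proof (rule ccontr)
    assume not: "\<not> ?thesis"
    have xk: "x \<in> closure (\<omega> k)" "x \<notin> \<omega> k"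
      using x C(1) by (auto simp: frontier_def interior_open)
    have "x \<in> S"
      using not closure_mono[OF C(4)] xk S by (auto simp: frontier_def interior_open)
    define V where "V = S - (\<Union>j\<in>{1..N} - {k}. closure (\<omega> j))"
    have "open V"
      unfolding V_def using S by (intro open_Diff closed_UN) auto
    moreover have "x \<in> V"
      using not xk \<open>x \<in> S\<close> by (auto simp: V_def interface_def)
    moreover have "V \<subseteq> closure (\<omega> k)"
    proof
      fix z assume "z \<in> V"
      then have "z \<in> closure S"
        using closure_subset by (auto simp: V_def)
      then obtain j where "j \<in> {1..N}" "z \<in> closure (\<omega> j)"
        using P unfolding convex_partition_def by auto
      then show "z \<in> closure (\<omega> k)"
        using \<open>z \<in> V\<close> by (cases "j = k") (auto simp: V_def)
    qed
    ultimately have "x \<in> interior (closure (\<omega> k))"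
      by (meson interior_maximal subsetD)
    then show False
      using xk(2) C(1,2) by (simp add: convex_interior_closure interior_open)
  qed
qed

lemma closed_interface: "closed (interface \<omega> k j)"
  by (simp add: interface_def closed_Int)

lemma bounded_frontier_cell:
  assumes "convex_partition S N \<omega>" "bounded S" "k \<in> {1..N}"
  shows "bounded (\<omega> k)" "bounded (frontier (\<omega> k))"
proof -
  show "bounded (\<omega> k)"
    using convex_partitionD(4)[OF assms(1,3)] assms(2) bounded_subset by blast
  then show "bounded (frontier (\<omega> k))"
    by (simp add: frontier_def bounded_diff bounded_closure)
qed

text \<open>The separation is applied in the order \<open>\<omega> j\<close>,
  \<open>\<omega> k\<close>, so that the normal points into \<open>\<omega> k\<close>, the
  orientation of \<open>trace_inequality\<close>.\<close>

lemma interface_hyperplane: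
  assumes P: "convex_partition S N \<omega>" and k: "k \<in> {1..N}" and j: "j \<in> {1..N}" "j \<noteq> k"
  obtains m c where "norm m = 1" "interface \<omega> k j \<subseteq> {x. m \<bullet> x = c}" "\<And>x. x \<in> \<omega> k \<Longrightarrow> m \<bullet> x > c"
proof -
  note K = convex_partitionD[OF P k] and J = convex_partitionD[OF P j(1)]
  have disj: "\<omega> j \<inter> \<omega> k = {}"
    using K(5)[OF j] by auto
  show ?thesis
  proof (rule open_convex_separation[OF J(1-3) K(1-3) disj])
    fix m c assume "norm m = 1" "\<And>x. x \<in> \<omega> k \<Longrightarrow> m \<bullet> x > c"
      "closure (\<omega> j) \<inter> closure (\<omega> k) \<subseteq> {x. m \<bullet> x = c}"
    then show thesis
      by (intro that[of m c]) (auto simp: interface_def)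
  qed
qed

lemma bounded_interface:
  assumes "convex_partition S N \<omega>" "bounded S" "k \<in> {1..N}"
  shows "bounded (interface \<omega> k j)"
  using bounded_frontier_cell(1)[OF assms] by (auto simp: interface_def intro: bounded_Int)

lemma emeasure_surface_interface:
  assumes "convex_partition S N \<omega>" "bounded S" "k \<in> {1..N}" "j \<in> {1..N}" "j \<noteq> k"
  shows "emeasure surface (interface \<omega> k j) < \<infinity>"
proof -
  obtain m c where "norm m = 1" "interface \<omega> k j \<subseteq> {x. m \<bullet> x = c}"
    by (rule interface_hyperplane[OF assms(1,3-5)])
  then show ?thesis
    using bounded_interface[OF assms(1-3)] closed_interface
    by (intro emeasure_surface_bounded_hyperplane borel_closed) auto
qed

lemma emeasure_surface_frontier_cell:
  assumes P: "convex_partition S N \<omega>" and S: "polyhedral_lipschitz_domain S" and k: "k \<in> {1..N}"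
  shows "emeasure surface (frontier (\<omega> k)) < \<infinity>"
proof -
  have b: "open S" "bounded S"
    using S by (auto simp: polyhedral_lipschitz_domain_def)
  let ?I = "\<Union>j\<in>{1..N} - {k}. interface \<omega> k j"
  have I: "?I \<in> sets borel"
    by (intro sets.finite_UN) (auto intro: borel_closed closed_interface)
  have "emeasure surface (frontier (\<omega> k)) \<le> emeasure surface (frontier S \<union> ?I)"
    using frontier_cell_subset[OF P b(1) k] I by (intro emeasure_mono) (auto intro!: borel_closed)
  also have "\<dots> \<le> emeasure surface (frontier S) + emeasure surface ?I"
    using I by (intro emeasure_subadditive) (auto intro!: borel_closed)
  also have "\<dots> < \<infinity>"
  proof -
    have "emeasure surface ?I < \<infinity>"
      using emeasure_surface_interface[OF P b(2) k]
      by (intro emeasure_surface_UN_finite) (auto intro: borel_closed closed_interface)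
    then show ?thesis
      using emeasure_surface_frontier_domain[OF S] by simp
  qed
  finally show ?thesis .
qed

section \<open>Traces on the skeleton of the partition\<close>

text \<open>The frontier of a convex set is null, so the closure in \<open>trace_inequality\<close>
  may be replaced by the open cell, on which the Sobolev norms are taken.\<close>

lemma nn_integral_closure_cell:
  fixes S :: "'a::euclidean_space set"
  assumes \<phi>: "C1_with_gradient \<phi> D\<phi>" and S: "open S" "convex S" "bounded S"
  shows "(\<integral>\<^sup>+x. indicator (closure S) x * ennreal ((\<phi> x)\<^sup>2 + (norm (D\<phi> x))\<^sup>2) \<partial>lborel)
    = ennreal ((L2norm (lebesgue_on S) \<phi>)\<^sup>2 + (L2norm (lebesgue_on S) D\<phi>)\<^sup>2)"
proof -
  note C1 = C1_with_gradientD[OF \<phi>]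
  note [measurable] = C1_borel[OF \<phi>]
  have L: "L2 (lebesgue_on S) \<phi>" "L2 (lebesgue_on S) D\<phi>"
    using C1 S by (auto intro: continuous_L2_lebesgue_on)
  note [measurable] = L2_measurable[OF L(1)] L2_measurable[OF L(2)]
  have [measurable]: "closure S \<in> sets borel" "S \<in> sets borel"
    using S(1) by auto
  let ?G = "\<lambda>x. ennreal ((\<phi> x)\<^sup>2 + (norm (D\<phi> x))\<^sup>2)"
  have "frontier S \<in> null_sets lebesgue"
    using negligible_convex_frontier[OF S(2)] by (simp add: negligible_iff_null_sets)
  then have "frontier S \<in> null_sets lborel"
    by (simp add: null_sets_completion_iff borel_closed)
  then have "AE x in lborel. x \<notin> frontier S"
    by (rule AE_not_in)
  then have "(\<integral>\<^sup>+x. indicator (closure S) x * ?G x \<partial>lborel) = (\<integral>\<^sup>+x. ?G x * indicator S x \<partial>lborel)"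
  proof (intro nn_integral_cong_AE, eventually_elim)
    case (elim x)
    then have "x \<in> closure S \<longleftrightarrow> x \<in> S"
      using S(1) closure_subset[of S] by (auto simp: frontier_def interior_open)
    then show ?case
      by (simp add: indicator_def)
  qed
  also have "\<dots> = (\<integral>\<^sup>+x. ?G x * indicator S x \<partial>lebesgue)"
    by (rule nn_integral_completion[symmetric])
  also have "\<dots> = (\<integral>\<^sup>+x. ?G x \<partial>lebesgue_on S)"
    using S(1) by (subst nn_integral_restrict_space) auto
  also have "\<dots> = (\<integral>\<^sup>+x. ennreal ((norm (\<phi> x))\<^sup>2) + ennreal ((norm (D\<phi> x))\<^sup>2) \<partial>lebesgue_on S)"
    by (simp add: ennreal_plus)
  also have "\<dots> = (\<integral>\<^sup>+x. ennreal ((norm (\<phi> x))\<^sup>2) \<partial>lebesgue_on S) + (\<integral>\<^sup>+x. ennreal ((norm (D\<phi> x))\<^sup>2) \<partial>lebesgue_on S)"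
    by (rule nn_integral_add) measurable
  also have "\<dots> = ennreal ((L2norm (lebesgue_on S) \<phi>)\<^sup>2) + ennreal ((L2norm (lebesgue_on S) D\<phi>)\<^sup>2)"
    using L by (simp only: nn_integral_L2)
  finally show ?thesis
    by (simp add: ennreal_plus)
qed

text \<open>The norms on the right are taken over all of \<open>S\<close>, since this is where the
  approximants of a Sobolev function converge.\<close>

lemma interface_trace_inequality:
  assumes P: "convex_partition S N \<omega>" and S: "open S" "bounded S" and k: "k \<in> {1..N}" and j: "j \<in> {1..N}" "j \<noteq> k"
  obtains C where "C \<ge> 0" "\<And>\<phi> D\<phi>. C1_with_gradient \<phi> D\<phi> \<Longrightarrow>
    (\<integral>\<^sup>+x. ennreal ((\<phi> x)\<^sup>2) \<partial>surface_on (interface \<omega> k j))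
      \<le> ennreal (C * ((L2norm (lebesgue_on S) \<phi>)\<^sup>2 + (L2norm (lebesgue_on S) D\<phi>)\<^sup>2))"
proof -
  note K = convex_partitionD[OF P k]
  have b: "bounded (\<omega> k)"
    by (rule bounded_frontier_cell[OF P S(2) k])
  obtain m c where m: "norm m = 1" "interface \<omega> k j \<subseteq> {x. m \<bullet> x = c}" "\<And>x. x \<in> \<omega> k \<Longrightarrow> m \<bullet> x > c"
    by (rule interface_hyperplane[OF P k j]; rule that; assumption)
  have comp: "compact (interface \<omega> k j)"
    using bounded_interface[OF P S(2) k] closed_interface by (simp add: compact_eq_bounded_closed)
  have sub: "interface \<omega> k j \<subseteq> closure (\<omega> k)"
    by (auto simp: interface_def)
  obtain C where C: "C \<ge> 0" "\<And>\<phi> D\<phi>. C1_with_gradient \<phi> D\<phi> \<Longrightarrow>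
    (\<integral>\<^sup>+x. ennreal ((\<phi> x)\<^sup>2) \<partial>surface_on (interface \<omega> k j))
      \<le> ennreal C * (\<integral>\<^sup>+x. indicator (closure (\<omega> k)) x * ennreal ((\<phi> x)\<^sup>2 + (norm (D\<phi> x))\<^sup>2) \<partial>lborel)"
    by (rule trace_inequality[OF K(1-3) comp sub m]; (rule that)?; assumption)
  show ?thesis
  proof (rule that[OF C(1)])
    fix \<phi> :: "'a \<Rightarrow> real" and D\<phi> assume \<phi>: "C1_with_gradient \<phi> D\<phi>"
    note C1 = C1_with_gradientD[OF \<phi>]
    have sets: "\<omega> k \<in> sets lebesgue" "S \<in> sets lebesgue"
      using K(1) S(1) by auto
    have "L2norm (lebesgue_on (\<omega> k)) \<phi> \<le> L2norm (lebesgue_on S) \<phi>"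
      "L2norm (lebesgue_on (\<omega> k)) D\<phi> \<le> L2norm (lebesgue_on S) D\<phi>"
      using C1 S by (auto intro!: L2_restrict_subset(2)[OF sets K(4)] continuous_L2_lebesgue_on)
    then have "(L2norm (lebesgue_on (\<omega> k)) \<phi>)\<^sup>2 + (L2norm (lebesgue_on (\<omega> k)) D\<phi>)\<^sup>2
        \<le> (L2norm (lebesgue_on S) \<phi>)\<^sup>2 + (L2norm (lebesgue_on S) D\<phi>)\<^sup>2"
      by (intro add_mono power_mono) auto
    then have "ennreal (C * ((L2norm (lebesgue_on (\<omega> k)) \<phi>)\<^sup>2 + (L2norm (lebesgue_on (\<omega> k)) D\<phi>)\<^sup>2))
        \<le> ennreal (C * ((L2norm (lebesgue_on S) \<phi>)\<^sup>2 + (L2norm (lebesgue_on S) D\<phi>)\<^sup>2))"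
      using C(1) by (intro ennreal_leI mult_left_mono)
    moreover have "(\<integral>\<^sup>+x. ennreal ((\<phi> x)\<^sup>2) \<partial>surface_on (interface \<omega> k j))
        \<le> ennreal (C * ((L2norm (lebesgue_on (\<omega> k)) \<phi>)\<^sup>2 + (L2norm (lebesgue_on (\<omega> k)) D\<phi>)\<^sup>2))"
      using C(2)[OF \<phi>] nn_integral_closure_cell[OF \<phi> K(1,2) b] C(1) by (simp add: ennreal_mult)
    ultimately show "(\<integral>\<^sup>+x. ennreal ((\<phi> x)\<^sup>2) \<partial>surface_on (interface \<omega> k j))
      \<le> ennreal (C * ((L2norm (lebesgue_on S) \<phi>)\<^sup>2 + (L2norm (lebesgue_on S) D\<phi>)\<^sup>2))"
      by (rule order_trans[rotated])
  qed
qed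

lemma nn_integral_surface_on:
  "S \<in> sets borel \<Longrightarrow> (\<integral>\<^sup>+x. f x \<partial>surface_on S) = (\<integral>\<^sup>+x. f x * indicator S x \<partial>surface)"
  unfolding surface_on_def by (subst nn_integral_restrict_space) auto

text \<open>Interfaces are covered by the trace inequality, while the frontier of \<open>S\<close>
  keeps its own term, because convergence there is part of \<open>H10\<close>. Overlaps and doubly
  listed interfaces only enlarge the upper bound. With \<open>K\<close> the sum of the interface
  constants, \<open>sqrt K\<close> arises when the sum of squares is bounded by the square of a
  sum.\<close>

lemma skeleton_trace_inequality:
  assumes P: "convex_partition S N \<omega>" and dom: "polyhedral_lipschitz_domain S"
  obtains C where "C \<ge> 0" "\<And>\<phi> D\<phi>. C1_with_gradient \<phi> D\<phi> \<Longrightarrow>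
    L2norm (surface_on (\<Union>k\<in>{1..N}. frontier (\<omega> k))) \<phi>
      \<le> L2norm (surface_on (frontier S)) \<phi> + C * (L2norm (lebesgue_on S) \<phi> + L2norm (lebesgue_on S) D\<phi>)"
proof -
  have S: "open S" "bounded S"
    using dom by (auto simp: polyhedral_lipschitz_domain_def)
  let ?F = "\<Union>k\<in>{1..N}. frontier (\<omega> k)"
  let ?I = "Sigma {1..N} (\<lambda>k. {1..N} - {k})"
  have "\<exists>C. C \<ge> 0 \<and> (\<forall>\<phi> D\<phi>. C1_with_gradient \<phi> D\<phi> \<longrightarrow>
    (\<integral>\<^sup>+x. ennreal ((\<phi> x)\<^sup>2) \<partial>surface_on (interface \<omega> (fst p) (snd p)))
      \<le> ennreal (C * ((L2norm (lebesgue_on S) \<phi>)\<^sup>2 + (L2norm (lebesgue_on S) D\<phi>)\<^sup>2)))"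
    if "p \<in> ?I" for p
  proof -
    have "fst p \<in> {1..N}" "snd p \<in> {1..N}" "snd p \<noteq> fst p"
      using that by auto
    then show ?thesis
      by (rule interface_trace_inequality[OF P S]) blast
  qed
  then obtain C where C: "\<And>p. p \<in> ?I \<Longrightarrow> C p \<ge> 0" "\<And>p \<phi> D\<phi>. p \<in> ?I \<Longrightarrow> C1_with_gradient \<phi> D\<phi> \<Longrightarrow>
    (\<integral>\<^sup>+x. ennreal ((\<phi> x)\<^sup>2) \<partial>surface_on (interface \<omega> (fst p) (snd p)))
      \<le> ennreal (C p * ((L2norm (lebesgue_on S) \<phi>)\<^sup>2 + (L2norm (lebesgue_on S) D\<phi>)\<^sup>2))"
    by metis
  define K where "K = (\<Sum>p\<in>?I. C p)"
  have K: "K \<ge> 0"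
    unfolding K_def using C(1) by (rule sum_nonneg)
  have fin: "finite ?I"
    by simp
  have F_borel: "?F \<in> sets borel"
    by (intro sets.finite_UN) (auto intro: borel_closed)
  show ?thesis
  proof (rule that[of "sqrt K"])
    fix \<phi> :: "'a \<Rightarrow> real" and D\<phi> assume \<phi>: "C1_with_gradient \<phi> D\<phi>"
    note C1 = C1_with_gradientD[OF \<phi>] and [measurable] = C1_borel[OF \<phi>]
    have [measurable]: "frontier S \<in> sets borel" "\<And>k j. interface \<omega> k j \<in> sets borel"
      by (auto intro: borel_closed closed_interface)
    define a b d where "a = L2norm (surface_on (frontier S)) \<phi>" "b = L2norm (lebesgue_on S) \<phi>" "d = L2norm (lebesgue_on S) D\<phi>"
    have pos: "a \<ge> 0" "b \<ge> 0" "d \<ge> 0"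
      by (auto simp: a_b_d_def)
    have L: "L2 (surface_on (frontier S)) \<phi>"
      using C1 S emeasure_surface_frontier_domain[OF dom]
      by (intro continuous_L2_surface_on) (auto simp: frontier_def bounded_diff)
    have [measurable]: "\<phi> \<in> borel_measurable surface"
      using C1_borel(1)[OF \<phi>] by (simp cong: measurable_cong_sets)
    have "(\<integral>\<^sup>+x. ennreal ((\<phi> x)\<^sup>2) \<partial>surface_on ?F) = (\<integral>\<^sup>+x. ennreal ((\<phi> x)\<^sup>2) * indicator ?F x \<partial>surface)"
      by (rule nn_integral_surface_on[OF F_borel])
    also have "\<dots> \<le> (\<integral>\<^sup>+x. ennreal ((\<phi> x)\<^sup>2) * indicator (frontier S) x
        + (\<Sum>p\<in>?I. ennreal ((\<phi> x)\<^sup>2) * indicator (interface \<omega> (fst p) (snd p)) x) \<partial>surface)"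
    proof (rule nn_integral_mono)
      fix x
      show "ennreal ((\<phi> x)\<^sup>2) * indicator ?F x \<le> ennreal ((\<phi> x)\<^sup>2) * indicator (frontier S) x
        + (\<Sum>p\<in>?I. ennreal ((\<phi> x)\<^sup>2) * indicator (interface \<omega> (fst p) (snd p)) x)"
      proof (cases "x \<in> ?F \<and> x \<notin> frontier S")
        case True
        then obtain k where k: "k \<in> {1..N}" "x \<in> frontier (\<omega> k)"
          by auto
        obtain j where j: "j \<in> {1..N} - {k}" "x \<in> interface \<omega> k j"
          using subsetD[OF frontier_cell_subset[OF P S(1) k(1)] k(2)] True by blast
        have "ennreal ((\<phi> x)\<^sup>2) = ennreal ((\<phi> x)\<^sup>2) * indicator (interface \<omega> (fst (k, j)) (snd (k, j))) x"
          using j by simp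
        also have "\<dots> \<le> (\<Sum>p\<in>?I. ennreal ((\<phi> x)\<^sup>2) * indicator (interface \<omega> (fst p) (snd p)) x)"
          using k j fin by (intro member_le_sum) auto
        finally show ?thesis
          using True by (simp add: indicator_def)
      qed (auto simp: indicator_def)
    qed
    also have "\<dots> = (\<integral>\<^sup>+x. ennreal ((\<phi> x)\<^sup>2) * indicator (frontier S) x \<partial>surface)
        + (\<Sum>p\<in>?I. \<integral>\<^sup>+x. ennreal ((\<phi> x)\<^sup>2) * indicator (interface \<omega> (fst p) (snd p)) x \<partial>surface)"
    proof -
      have m: "(\<lambda>x. ennreal ((\<phi> x)\<^sup>2) * indicator B x) \<in> borel_measurable surface"
        if [measurable]: "B \<in> sets borel" for B
        by measurable
      have "(\<integral>\<^sup>+x. (\<Sum>p\<in>?I. ennreal ((\<phi> x)\<^sup>2) * indicator (interface \<omega> (fst p) (snd p)) x) \<partial>surface)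
        = (\<Sum>p\<in>?I. \<integral>\<^sup>+x. ennreal ((\<phi> x)\<^sup>2) * indicator (interface \<omega> (fst p) (snd p)) x \<partial>surface)"
        by (rule nn_integral_sum) (rule m, measurable)
      moreover have "(\<lambda>x. \<Sum>p\<in>?I. ennreal ((\<phi> x)\<^sup>2) * indicator (interface \<omega> (fst p) (snd p)) x) \<in> borel_measurable surface"
        by (intro borel_measurable_sum m) measurable
      ultimately show ?thesis
        by (subst nn_integral_add[OF m]) (simp_all only: \<open>frontier S \<in> sets borel\<close>)
    qed
    also have "\<dots> = (\<integral>\<^sup>+x. ennreal ((norm (\<phi> x))\<^sup>2) \<partial>surface_on (frontier S))
        + (\<Sum>p\<in>?I. \<integral>\<^sup>+x. ennreal ((\<phi> x)\<^sup>2) \<partial>surface_on (interface \<omega> (fst p) (snd p)))"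
      by (simp add: nn_integral_surface_on)
    also have "\<dots> \<le> ennreal (a\<^sup>2) + (\<Sum>p\<in>?I. ennreal (C p * (b\<^sup>2 + d\<^sup>2)))"
      unfolding a_b_d_def nn_integral_L2[OF L] using C(2)[OF _ \<phi>] by (intro add_mono sum_mono) auto
    also have "\<dots> = ennreal (a\<^sup>2 + K * (b\<^sup>2 + d\<^sup>2))"
    proof -
      have "(\<Sum>p\<in>?I. ennreal (C p * (b\<^sup>2 + d\<^sup>2))) = ennreal (K * (b\<^sup>2 + d\<^sup>2))"
        unfolding K_def sum_distrib_right using C(1) by (intro sum_ennreal) auto
      then show ?thesis
        using K by (simp add: ennreal_plus)
    qed
    also have "\<dots> \<le> ennreal ((a + sqrt K * (b + d))\<^sup>2)"
    proof (rule ennreal_leI)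
      have "a\<^sup>2 + K * (b\<^sup>2 + d\<^sup>2) \<le> a\<^sup>2 + K * (b + d)\<^sup>2"
        using K pos by (intro add_left_mono mult_left_mono) (auto simp: power2_sum)
      also have "\<dots> = a\<^sup>2 + (sqrt K * (b + d))\<^sup>2"
        using K by (simp add: power_mult_distrib)
      also have "\<dots> \<le> (a + sqrt K * (b + d))\<^sup>2"
        using K pos by (simp add: power2_sum)
      finally show "a\<^sup>2 + K * (b\<^sup>2 + d\<^sup>2) \<le> (a + sqrt K * (b + d))\<^sup>2" .
    qed
    finally have "(\<integral>\<^sup>+x. ennreal ((norm (\<phi> x))\<^sup>2) \<partial>surface_on ?F) \<le> ennreal ((a + sqrt K * (b + d))\<^sup>2)"
      by simp
    then show "L2norm (surface_on ?F) \<phi> \<le> a + sqrt K * (b + d)"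
      using K pos by (intro L2norm_le_nn_integral) (auto simp: surface_on_def intro!: measurable_restrict_space1)
  qed (use K in simp)
qed

lemma L2norm_eq_0_AE:
  assumes "L2 M f" "L2norm M f = 0"
  shows "AE x in M. f x = 0"
proof -
  have "(\<integral>x. (norm (f x))\<^sup>2 \<partial>M) = 0"
    using assms(2) by (simp add: L2norm_def)
  then have "AE x in M. (norm (f x))\<^sup>2 = 0"
    using assms(1) by (subst (asm) integral_nonneg_eq_0_iff_AE) (auto simp: L2_def)
  then show ?thesis
    by simp
qed

text \<open>Applied to differences of approximants, the skeleton inequality makes them a Cauchy
  sequence in L2 of the skeleton. The limit is a trace on each single cell because L2 norms decrease
  under restriction to the cell and to its frontier.\<close>

lemma skeleton_trace:
  assumes P: "convex_partition S N \<omega>" and dom: "polyhedral_lipschitz_domain S" and w: "H10 S w Dw"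
  obtains t where "\<And>k. k \<in> {1..N} \<Longrightarrow> has_trace (\<omega> k) w Dw t"
    "AE x in surface_on (frontier S \<inter> (\<Union>k\<in>{1..N}. frontier (\<omega> k))). t x = 0"
proof -
  have S: "open S" "bounded S"
    using dom by (auto simp: polyhedral_lipschitz_domain_def)
  let ?F = "\<Union>k\<in>{1..N}. frontier (\<omega> k)"
  have sets: "?F \<in> sets surface" "frontier S \<in> sets surface" "frontier S \<inter> ?F \<in> sets surface"
    "\<And>k. frontier (\<omega> k) \<in> sets surface"
    by (auto intro!: sets.finite_UN sets.Int borel_closed)
  have "emeasure surface ?F < \<infinity>"
    using emeasure_surface_frontier_cell[OF P dom]
    by (intro emeasure_surface_UN_finite) (auto intro: borel_closed)
  moreover have "bounded ?F"
    using bounded_frontier_cell[OF P S(2)] by auto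
  ultimately have F: "emeasure surface ?F < \<infinity>" "bounded ?F" .
  interpret finite_measure "surface_on ?F"
    using F sets(1) by (intro finite_measure_surface_on) auto
  have fr: "emeasure surface (frontier S) < \<infinity>" "bounded (frontier S)"
    using emeasure_surface_frontier_domain[OF dom] S by (auto simp: frontier_def bounded_diff)
  have H: "H1 S w Dw" "has_trace S w Dw (\<lambda>_. 0)"
    using w by (auto simp: H10_def has_trace_def)
  have Lw: "L2 (lebesgue_on S) w" "L2 (lebesgue_on S) Dw"
    using H by (auto simp: H1_def)
  obtain \<phi> D\<phi> where \<phi>: "\<And>m::nat. C1_with_gradient (\<phi> m) (D\<phi> m)"
    "(\<lambda>m. L2norm (lebesgue_on S) (\<lambda>x. \<phi> m x - w x)) \<longlonglongrightarrow> 0"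
    "(\<lambda>m. L2norm (lebesgue_on S) (\<lambda>x. D\<phi> m x - Dw x)) \<longlonglongrightarrow> 0"
    "(\<lambda>m. L2norm (surface_on (frontier S)) (\<lambda>x. \<phi> m x - 0)) \<longlonglongrightarrow> 0"
    by (rule has_traceE[OF H(2)]; rule that; assumption)
  note C1 = C1_with_gradientD[OF \<phi>(1)]
  have L: "L2 (lebesgue_on S) (\<phi> m)" "L2 (lebesgue_on S) (D\<phi> m)" "L2 (surface_on (frontier S)) (\<phi> m)"
    "L2 (surface_on ?F) (\<phi> m)" for m
    using C1[of m] S fr F sets by (auto intro!: continuous_L2_lebesgue_on continuous_L2_surface_on simp del: UN_simps)
  obtain C where C: "C \<ge> 0" "\<And>\<phi> D\<phi>. C1_with_gradient \<phi> D\<phi> \<Longrightarrow> L2norm (surface_on ?F) \<phi>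
      \<le> L2norm (surface_on (frontier S)) \<phi> + C * (L2norm (lebesgue_on S) \<phi> + L2norm (lebesgue_on S) D\<phi>)"
    by (rule skeleton_trace_inequality[OF P dom]; rule that; assumption)
  \<comment> \<open>Distance of the \<open>m\<close>-th approximant from \<open>w\<close> and from
    the boundary values 0, with the weights of the skeleton inequality.\<close>
  define err where "err m = L2norm (surface_on (frontier S)) (\<phi> m) + C * (L2norm (lebesgue_on S) (\<lambda>x. \<phi> m x - w x)
      + L2norm (lebesgue_on S) (\<lambda>x. D\<phi> m x - Dw x))" for m
  have "(\<lambda>m. L2norm (surface_on (frontier S)) (\<phi> m) + C * (L2norm (lebesgue_on S) (\<lambda>x. \<phi> m x - w x)
      + L2norm (lebesgue_on S) (\<lambda>x. D\<phi> m x - Dw x))) \<longlonglongrightarrow> 0 + C * (0 + 0)"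
    using \<phi>(4) by (intro tendsto_add tendsto_mult tendsto_const \<phi>(2,3)) simp
  then have err: "err \<longlonglongrightarrow> 0"
    by (simp add: err_def[abs_def])
  have bound: "L2norm (surface_on ?F) (\<lambda>x. \<phi> m x - \<phi> l x) \<le> err m + err l" for m l
  proof -
    have tri: "L2norm M (\<lambda>x. f x - g x) \<le> L2norm M (\<lambda>x. f x - h x) + L2norm M (\<lambda>x. g x - h x)"
      if "L2 M f" "L2 M g" "L2 M h" for M and f g h :: "'a \<Rightarrow> 'c::euclidean_space"
    proof -
      have "(\<lambda>x. f x - g x) = (\<lambda>x. (f x - h x) - (g x - h x))"
        by auto
      then show ?thesis
        using L2norm_triangle_diff[OF L2_diff[OF that(1,3)] L2_diff[OF that(2,3)]] by simp
    qed
    have "L2norm (surface_on ?F) (\<lambda>x. \<phi> m x - \<phi> l x) \<le> L2norm (surface_on (frontier S)) (\<lambda>x. \<phi> m x - \<phi> l x)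
      + C * (L2norm (lebesgue_on S) (\<lambda>x. \<phi> m x - \<phi> l x) + L2norm (lebesgue_on S) (\<lambda>x. D\<phi> m x - D\<phi> l x))"
      by (rule C(2)[OF C1_with_gradient_diff[OF \<phi>(1) \<phi>(1)]])
    also have "\<dots> \<le> (L2norm (surface_on (frontier S)) (\<phi> m) + L2norm (surface_on (frontier S)) (\<phi> l))
      + C * ((L2norm (lebesgue_on S) (\<lambda>x. \<phi> m x - w x) + L2norm (lebesgue_on S) (\<lambda>x. \<phi> l x - w x))
        + (L2norm (lebesgue_on S) (\<lambda>x. D\<phi> m x - Dw x) + L2norm (lebesgue_on S) (\<lambda>x. D\<phi> l x - Dw x)))"
      by (intro add_mono mult_left_mono C(1) L2norm_triangle_diff tri L Lw)
    finally show ?thesis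
      by (simp add: err_def algebra_simps)
  qed
  have "\<exists>t. L2 (surface_on ?F) t \<and> (\<lambda>m. L2norm (surface_on ?F) (\<lambda>x. \<phi> m x - t x)) \<longlonglongrightarrow> 0"
  proof (rule L2_complete[OF L(4)])
    fix e :: real assume "e > 0"
    then obtain K where K: "\<And>m. m \<ge> K \<Longrightarrow> \<bar>err m\<bar> < e / 2"
      using LIMSEQ_D[OF err, of "e / 2"] by auto
    have "L2norm (surface_on ?F) (\<lambda>x. \<phi> m x - \<phi> l x) < e" if "m \<ge> K" "l \<ge> K" for m l
      using bound[of m l] K[OF that(1)] K[OF that(2)] by linarith
    then show "\<exists>K. \<forall>m\<ge>K. \<forall>l\<ge>K. L2norm (surface_on ?F) (\<lambda>x. \<phi> m x - \<phi> l x) < e"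
      by blast
  qed
  then obtain t where t: "L2 (surface_on ?F) t" "(\<lambda>m. L2norm (surface_on ?F) (\<lambda>x. \<phi> m x - t x)) \<longlonglongrightarrow> 0"
    by blast
  have sub: "(\<lambda>m. L2norm (restrict_space M A) (\<lambda>x. \<psi> m x - z x)) \<longlonglongrightarrow> 0"
    if AB: "A \<in> sets M" "B \<in> sets M" "A \<subseteq> B" and L: "\<And>m. L2 (restrict_space M B) (\<psi> m)" "L2 (restrict_space M B) z"
      and lim: "(\<lambda>m. L2norm (restrict_space M B) (\<lambda>x. \<psi> m x - z x)) \<longlonglongrightarrow> 0"
    for M :: "'a measure" and A B and \<psi> :: "nat \<Rightarrow> 'a \<Rightarrow> 'c::euclidean_space" and z
    by (rule real_tendsto_sandwich[OF _ _ tendsto_const lim])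
      (auto intro!: always_eventually L2_restrict_subset(2)[OF AB] L2_diff L)
  show ?thesis
  proof (rule that[of t])
    fix k assume k: "k \<in> {1..N}"
    note K = convex_partitionD[OF P k]
    have lsets: "\<omega> k \<in> sets lebesgue" "S \<in> sets lebesgue"
      using K(1) S(1) by auto
    have kF: "frontier (\<omega> k) \<subseteq> ?F"
      using k by auto
    show "has_trace (\<omega> k) w Dw t"
      unfolding has_trace_def
    proof (intro conjI exI allI)
      show "H1 (\<omega> k) w Dw"
        by (rule H1_subset[OF H(1) K(1) S(1) K(4)])
      show "L2 (surface_on (frontier (\<omega> k))) t"
        using t(1) unfolding surface_on_def by (rule L2_restrict_subset(1)[OF sets(4,1) kF])
      show "C1_with_gradient (\<phi> m) (D\<phi> m)" for m
        by (rule \<phi>)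
      show "(\<lambda>m. L2norm (lebesgue_on (\<omega> k)) (\<lambda>x. \<phi> m x - w x)) \<longlonglongrightarrow> 0"
        by (rule sub[OF lsets K(4) L(1) Lw(1) \<phi>(2)])
      show "(\<lambda>m. L2norm (lebesgue_on (\<omega> k)) (\<lambda>x. D\<phi> m x - Dw x)) \<longlonglongrightarrow> 0"
        by (rule sub[OF lsets K(4) L(2) Lw(2) \<phi>(3)])
      show "(\<lambda>m. L2norm (surface_on (frontier (\<omega> k))) (\<lambda>x. \<phi> m x - t x)) \<longlonglongrightarrow> 0"
        using sub[OF sets(4,1) kF, of \<phi> t] L(4) t unfolding surface_on_def by blast
    qed
  next
    let ?Z = "frontier S \<inter> ?F"
    have ZF: "?Z \<subseteq> ?F" and ZS: "?Z \<subseteq> frontier S"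
      by auto
    have tZ: "L2 (surface_on ?Z) t"
      using t(1) unfolding surface_on_def by (rule L2_restrict_subset(1)[OF sets(3,1) ZF])
    have LZ: "L2 (surface_on ?Z) (\<phi> m)" for m
      using L(4)[of m] unfolding surface_on_def by (rule L2_restrict_subset(1)[OF sets(3,1) ZF])
    \<comment> \<open>On the part of the skeleton inside the frontier of \<open>S\<close> the
      approximants tend both to \<open>t\<close> and to 0.\<close>
    have "(\<lambda>m. L2norm (surface_on ?Z) (\<lambda>x. \<phi> m x - t x)) \<longlonglongrightarrow> 0"
      using sub[OF sets(3,1) ZF, of \<phi> t] L(4) t unfolding surface_on_def by blast
    moreover have "(\<lambda>m. L2norm (surface_on ?Z) (\<lambda>x. \<phi> m x - 0)) \<longlonglongrightarrow> 0"
      using sub[OF sets(3,2) ZS, of \<phi> "\<lambda>_. 0"] L(3) \<phi>(4) unfolding surface_on_def by (auto simp: L2_def)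
    ultimately have lim: "(\<lambda>m. L2norm (surface_on ?Z) (\<lambda>x. \<phi> m x - 0) + L2norm (surface_on ?Z) (\<lambda>x. \<phi> m x - t x)) \<longlonglongrightarrow> 0"
      by (intro tendsto_add_zero)
    have "L2norm (surface_on ?Z) t \<le> 0"
    proof (rule LIMSEQ_le_const[OF lim], intro exI allI impI)
      fix m
      show "L2norm (surface_on ?Z) t \<le> L2norm (surface_on ?Z) (\<lambda>x. \<phi> m x - 0) + L2norm (surface_on ?Z) (\<lambda>x. \<phi> m x - t x)"
        using L2norm_triangle_diff[OF LZ L2_diff[OF LZ tZ], of m m] by simp
    qed
    then have "L2norm (surface_on ?Z) t = 0"
      using L2norm_nonneg by (rule antisym)
    then show "AE x in surface_on ?Z. t x = 0"
      by (rule L2norm_eq_0_AE[OF tZ])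
  qed
qed

text \<open>A frontier point off the interior boundary lies in the frontier of \<open>S\<close> or
  on an interface that was discarded for having area 0; the discarded interfaces form a null
  set.\<close>

lemma skeleton_trace_vanishes:
  assumes P: "convex_partition S N \<omega>" and S: "open S" and k: "k \<in> {1..N}"
    and t: "AE x in surface_on (frontier S \<inter> (\<Union>k\<in>{1..N}. frontier (\<omega> k))). t x = 0"
  shows "AE x in surface_on (frontier (\<omega> k) - interior_boundary \<omega> N k). t x = 0"
proof -
  have "finite (neighbours \<omega> N k)"
    by (simp add: neighbours_def)
  then have "interior_boundary \<omega> N k \<in> sets borel"
    unfolding interior_boundary_def by (intro sets.finite_UN) (auto intro: borel_closed closed_interface)
  then have D: "frontier (\<omega> k) - interior_boundary \<omega> N k \<in> sets surface"
    by (auto intro: borel_closed)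
  have Z: "frontier S \<inter> (\<Union>k\<in>{1..N}. frontier (\<omega> k)) \<in> sets surface"
    by (auto intro!: sets.Int sets.finite_UN borel_closed)
  \<comment> \<open>The range of \<open>j\<close> is a premise inside the statement, so that the
    rule for countably many almost-everywhere statements can quantify over all naturals.\<close>
  have null: "AE x in surface. j \<in> {1..N} - {k} \<longrightarrow> j \<notin> neighbours \<omega> N k \<longrightarrow> x \<notin> interface \<omega> k j" for j
  proof (cases "j \<in> {1..N} - {k} \<and> j \<notin> neighbours \<omega> N k")
    case True
    then have "interface \<omega> k j \<in> null_sets surface"
      by (intro null_setsI) (auto simp: neighbours_def zero_less_iff_neq_zero intro: borel_closed closed_interface)
    then show ?thesis
      using AE_not_in by auto
  qed auto
  then have "AE x in surface. \<forall>j. j \<in> {1..N} - {k} \<longrightarrow> j \<notin> neighbours \<omega> N k \<longrightarrow> x \<notin> interface \<omega> k j"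
    by (simp add: AE_all_countable)
  moreover have "AE x in surface. x \<in> frontier S \<inter> (\<Union>k\<in>{1..N}. frontier (\<omega> k)) \<longrightarrow> t x = 0"
    using t Z unfolding surface_on_def by (subst (asm) AE_restrict_space_iff) auto
  ultimately have "AE x in surface. x \<in> frontier (\<omega> k) - interior_boundary \<omega> N k \<longrightarrow> t x = 0"
  proof eventually_elim
    case (elim x)
    show ?case
    proof
      assume x: "x \<in> frontier (\<omega> k) - interior_boundary \<omega> N k"
      then have "x \<in> frontier S"
        using elim(1) frontier_cell_subset[OF P S k] unfolding interior_boundary_def by blast
      then show "t x = 0"
        using elim(2) x k by blast
    qed
  qed
  then show ?thesis
    using D unfolding surface_on_def by (subst AE_restrict_space_iff) auto
qed

section \<open>The energy norm\<close>

lemma sum_mult_le_sqrt: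
  fixes a b :: "'i \<Rightarrow> real"
  shows "(\<Sum>i\<in>I. a i * b i) \<le> sqrt (\<Sum>i\<in>I. (a i)\<^sup>2) * sqrt (\<Sum>i\<in>I. (b i)\<^sup>2)"
proof -
  have "(\<Sum>i\<in>I. a i * b i) \<le> (\<Sum>i\<in>I. \<bar>a i\<bar> * \<bar>b i\<bar>)"
    by (intro sum_mono) (metis abs_ge_self abs_mult)
  then show ?thesis
    using L2_set_mult_ineq[of a b I] by (simp add: L2_set_def)
qed

locale spd_matrix =
  fixes A :: "real^'n^'n" and c :: real
  assumes sym: "transpose A = A" and c_pos: "0 < c" and coercive: "\<And>\<xi>. c * (norm \<xi>)\<^sup>2 \<le> (A *v \<xi>) \<bullet> \<xi>"
begin

lemma inner_commute_matrix: "(A *v x) \<bullet> z = (A *v z) \<bullet> x"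
proof -
  have "(A *v x) \<bullet> z = (transpose A *v x) \<bullet> z"
    by (simp only: sym)
  also have "\<dots> = x \<bullet> (A *v z)"
    by (simp add: dot_lmul_matrix)
  finally show ?thesis
    by (simp add: inner_commute)
qed

lemma quadratic_nonneg: "0 \<le> (A *v x) \<bullet> x"
  using coercive[of x] c_pos by (smt (verit) mult_nonneg_nonneg zero_le_power2)

lemma quadratic_pos: "x \<noteq> 0 \<Longrightarrow> 0 < (A *v x) \<bullet> x"
  using coercive[of x] c_pos by (smt (verit) mult_pos_pos zero_less_norm_iff zero_less_power)

lemma invertible_matrix: "invertible A"
proof -
  have "x = 0" if "A *v x = 0" for x
    using quadratic_pos[of x] that by fastforce
  then have "\<exists>B. B ** A = mat 1"
    by (simp add: matrix_left_invertible_ker)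
  then show ?thesis
    by (simp add: invertible_left_inverse)
qed

lemma mult_inverse: "A *v (matrix_inv A *v x) = x"
proof -
  have "A ** matrix_inv A = mat 1"
    using invertible_matrix unfolding invertible_def matrix_inv_def by (rule someI2_ex) simp
  then show ?thesis
    by (simp add: matrix_vector_mul_assoc)
qed

text \<open>Nonnegativity of the quadratic form at \<open>z - l *\<^sub>R p\<close>, with the
  minimising \<open>l\<close>.\<close>

lemma Cauchy_Schwarz_matrix: "((A *v z) \<bullet> p)\<^sup>2 \<le> ((A *v z) \<bullet> z) * ((A *v p) \<bullet> p)"
proof (cases "p = 0")
  case False
  define l where "l = ((A *v z) \<bullet> p) / ((A *v p) \<bullet> p)"
  have pp: "0 < (A *v p) \<bullet> p"
    by (rule quadratic_pos[OF False])
  have "0 \<le> (A *v (z - l *\<^sub>R p)) \<bullet> (z - l *\<^sub>R p)"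
    by (rule quadratic_nonneg)
  also have "\<dots> = (A *v z) \<bullet> z - 2 * l * ((A *v z) \<bullet> p) + l\<^sup>2 * ((A *v p) \<bullet> p)"
    using inner_commute_matrix[of p z]
    by (simp add: matrix_vector_mult_diff_distrib matrix_vector_mult_scaleR inner_diff_left inner_diff_right power2_eq_square algebra_simps)
  also have "\<dots> = (A *v z) \<bullet> z - ((A *v z) \<bullet> p)\<^sup>2 / ((A *v p) \<bullet> p)"
    using pp by (simp add: l_def power2_eq_square field_simps)
  finally show ?thesis
    using pp by (simp add: field_simps)
qed simp

lemma inverse_quadratic_nonneg: "0 \<le> (matrix_inv A *v q) \<bullet> q"
  using quadratic_nonneg[of "matrix_inv A *v q"] by (simp add: mult_inverse inner_commute)

text \<open>Cauchy-Schwarz in the energy product with \<open>z = matrix_inv A *v q\<close>: then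
  \<open>A *v z = q\<close>, and the energy of \<open>z\<close> is the inverse energy of
  \<open>q\<close>.\<close>

lemma inner_le_energy: "\<bar>q \<bullet> p\<bar> \<le> sqrt ((matrix_inv A *v q) \<bullet> q) * sqrt ((A *v p) \<bullet> p)"
proof -
  have "(q \<bullet> p)\<^sup>2 \<le> ((matrix_inv A *v q) \<bullet> q) * ((A *v p) \<bullet> p)"
    using Cauchy_Schwarz_matrix[of "matrix_inv A *v q" p] by (simp add: mult_inverse inner_commute)
  then have "\<bar>q \<bullet> p\<bar> \<le> sqrt (((matrix_inv A *v q) \<bullet> q) * ((A *v p) \<bullet> p))"
    by (metis real_sqrt_abs real_sqrt_le_mono)
  then show ?thesis
    by (simp add: real_sqrt_mult)
qed

end

section \<open>The energy norm as an L2 norm\<close>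

lemma L2_matrix_vector:
  fixes B :: "real^'n^'m"
  assumes q: "L2 M q"
  shows "L2 M (\<lambda>x. B *v q x)"
  unfolding L2_def
proof
  have "(*v) B \<in> borel_measurable borel"
    by (intro borel_measurable_continuous_onI linear_continuous_on) simp
  then show m: "(\<lambda>x. B *v q x) \<in> borel_measurable M"
    using L2_measurable[OF q] by (rule measurable_compose[rotated])
  show "integrable M (\<lambda>x. (norm (B *v q x))\<^sup>2)"
  proof (rule Bochner_Integration.integrable_bound)
    show "integrable M (\<lambda>x. (onorm ((*v) B))\<^sup>2 * (norm (q x))\<^sup>2)"
      using q by (auto simp: L2_def)
    have "(norm (B *v q x))\<^sup>2 \<le> (onorm ((*v) B))\<^sup>2 * (norm (q x))\<^sup>2" for x
      using power_mono[OF onorm[OF matrix_vector_mul_bounded_linear, of B "q x"], of 2]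
      by (simp add: power_mult_distrib)
    then show "AE x in M. norm ((norm (B *v q x))\<^sup>2) \<le> norm ((onorm ((*v) B))\<^sup>2 * (norm (q x))\<^sup>2)"
      by simp
  qed (use m in auto)
qed

text \<open>Nonnegativity turns the energy norm into the L2 norm of a scalar function, so that one
  Cauchy-Schwarz inequality covers the norms of \<open>A\<close> and of its inverse.\<close>

lemma matrix_norm_on_L2norm:
  assumes q: "L2 (lebesgue_on S) q" and nonneg: "\<And>x. 0 \<le> (B *v x) \<bullet> x"
  shows "L2 (lebesgue_on S) (\<lambda>x. sqrt ((B *v q x) \<bullet> q x))"
    "matrix_norm_on B S q = L2norm (lebesgue_on S) (\<lambda>x. sqrt ((B *v q x) \<bullet> q x))"
    "(matrix_norm_on B S q)\<^sup>2 = (\<integral>x. (B *v q x) \<bullet> q x \<partial>lebesgue_on S)"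
proof -
  have i: "integrable (lebesgue_on S) (\<lambda>x. (B *v q x) \<bullet> q x)"
    by (intro L2_integrable_inner L2_matrix_vector q)
  then show "L2 (lebesgue_on S) (\<lambda>x. sqrt ((B *v q x) \<bullet> q x))"
    using nonneg borel_measurable_integrable[OF i] by (simp add: L2_def)
  show "matrix_norm_on B S q = L2norm (lebesgue_on S) (\<lambda>x. sqrt ((B *v q x) \<bullet> q x))"
    using nonneg by (simp add: matrix_norm_on_def L2norm_def)
  show "(matrix_norm_on B S q)\<^sup>2 = (\<integral>x. (B *v q x) \<bullet> q x \<partial>lebesgue_on S)"
    using nonneg by (simp add: matrix_norm_on_def)
qed

lemma matrix_norm_on_nonneg:
  assumes "\<And>x. 0 \<le> (B *v x) \<bullet> x"
  shows "0 \<le> matrix_norm_on B S q"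
  using assms by (simp add: matrix_norm_on_def)

lemma (in spd_matrix) energy_inner_bound:
  assumes q: "L2 (lebesgue_on S) q" and p: "L2 (lebesgue_on S) p"
  shows "(\<integral>x. q x \<bullet> p x \<partial>lebesgue_on S) \<le> matrix_norm_on (matrix_inv A) S q * matrix_norm_on A S p"
proof -
  note Q = matrix_norm_on_L2norm[OF q inverse_quadratic_nonneg] and P = matrix_norm_on_L2norm[OF p quadratic_nonneg]
  have "(\<integral>x. q x \<bullet> p x \<partial>lebesgue_on S)
      \<le> (\<integral>x. norm (sqrt ((matrix_inv A *v q x) \<bullet> q x)) * norm (sqrt ((A *v p x) \<bullet> p x)) \<partial>lebesgue_on S)"
    using inner_le_energy inverse_quadratic_nonneg quadratic_nonneg
    by (intro integral_mono L2_integrable_inner L2_integrable_norm_mult q p Q P)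
      (auto intro: order_trans[OF abs_ge_self])
  also have "\<dots> \<le> matrix_norm_on (matrix_inv A) S q * matrix_norm_on A S p"
    unfolding Q(2) P(2) by (rule L2_Cauchy_Schwarz[OF Q(1) P(1)])
  finally show ?thesis .
qed

text \<open>Source of the factor \<open>1 / sqrt Cmin\<close> in the estimate.\<close>

lemma (in spd_matrix) L2norm_le_energy:
  assumes p: "L2 (lebesgue_on S) p"
  shows "sqrt c * L2norm (lebesgue_on S) p \<le> matrix_norm_on A S p"
proof (rule power2_le_imp_le)
  have "(sqrt c * L2norm (lebesgue_on S) p)\<^sup>2 = (\<integral>x. c * (norm (p x))\<^sup>2 \<partial>lebesgue_on S)"
    using c_pos p by (simp add: power_mult_distrib L2norm_square)
  also have "\<dots> \<le> (\<integral>x. (A *v p x) \<bullet> p x \<partial>lebesgue_on S)"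
    using p by (intro integral_mono L2_integrable_inner L2_matrix_vector coercive) (auto simp: L2_def)
  also have "\<dots> = (matrix_norm_on A S p)\<^sup>2"
    by (rule matrix_norm_on_L2norm(3)[OF p quadratic_nonneg, symmetric])
  finally show "(sqrt c * L2norm (lebesgue_on S) p)\<^sup>2 \<le> (matrix_norm_on A S p)\<^sup>2" .
qed (simp add: matrix_norm_on_nonneg quadratic_nonneg)

section \<open>Integrals over the cells and the interfaces\<close>

text \<open>Frontiers of convex sets are null, and off them the domain is the disjoint union of its
  cells.\<close>

lemma integral_partition:
  fixes F :: "'a::euclidean_space \<Rightarrow> real"
  assumes P: "convex_partition S N \<omega>" and S: "open S" and F: "integrable (lebesgue_on S) F"
  shows "(\<integral>x. F x \<partial>lebesgue_on S) = (\<Sum>k=1..N. \<integral>x. F x \<partial>lebesgue_on (\<omega> k))"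
proof -
  have sets: "S \<in> sets lebesgue" "\<And>k. k \<in> {1..N} \<Longrightarrow> \<omega> k \<in> sets lebesgue"
    using S convex_partitionD(1)[OF P] by auto
  have FS: "set_integrable lebesgue S F"
    using F sets by (simp add: set_integrable_def integrable_restrict_space)
  then have Fk: "set_integrable lebesgue (\<omega> k) F" if "k \<in> {1..N}" for k
    using set_integrable_subset sets(2)[OF that] convex_partitionD(4)[OF P that] by blast
  have null: "(\<Union>k\<in>{1..N}. frontier (\<omega> k)) \<in> null_sets lebesgue"
  proof (rule null_sets.finite_UN)
    fix k assume "k \<in> {1..N}"
    then show "frontier (\<omega> k) \<in> null_sets lebesgue"
      using negligible_convex_frontier[OF convex_partitionD(2)[OF P]] by (simp add: negligible_iff_null_sets)
  qed simp
  have "(\<integral>x. F x \<partial>lebesgue_on S) = (LINT x:S|lebesgue. F x)"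
    using sets by (simp add: set_lebesgue_integral_def integral_restrict_space)
  also have "\<dots> = (LINT x:(\<Union>k\<in>{1..N}. \<omega> k)|lebesgue. F x)"
    unfolding set_lebesgue_integral_def
  proof (rule integral_cong_AE)
    show "(\<lambda>x. indicator S x *\<^sub>R F x) \<in> borel_measurable lebesgue"
      using FS by (simp add: set_integrable_def)
    have "set_integrable lebesgue (\<Union>k\<in>{1..N}. \<omega> k) F"
      using Fk sets by (intro set_integrable_UN) auto
    then show "(\<lambda>x. indicator (\<Union>k\<in>{1..N}. \<omega> k) x *\<^sub>R F x) \<in> borel_measurable lebesgue"
      by (simp add: set_integrable_def)
    show "AE x in lebesgue. indicator S x *\<^sub>R F x = indicator (\<Union>k\<in>{1..N}. \<omega> k) x *\<^sub>R F x"
      using AE_not_in[OF null]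
    proof eventually_elim
      case (elim x)
      have "x \<in> S \<longleftrightarrow> x \<in> (\<Union>k\<in>{1..N}. \<omega> k)"
      proof
        assume "x \<in> S"
        then have "x \<in> closure S"
          using closure_subset by auto
        then obtain k where k: "k \<in> {1..N}" "x \<in> closure (\<omega> k)"
          using P by (auto simp: convex_partition_def)
        then have "x \<in> \<omega> k"
          using elim convex_partitionD(1)[OF P k(1)] by (auto simp: frontier_def interior_open)
        then show "x \<in> (\<Union>k\<in>{1..N}. \<omega> k)"
          using k by auto
      next
        assume "x \<in> (\<Union>k\<in>{1..N}. \<omega> k)"
        then show "x \<in> S"
          using convex_partitionD(4)[OF P] by blast
      qed
      then show ?case
        by (simp add: indicator_def)
    qed
  qed
  also have "\<dots> = (\<Sum>k=1..N. LINT x:\<omega> k|lebesgue. F x)"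
    using sets Fk convex_partitionD(5)[OF P]
    by (intro set_integral_finite_Union) (auto simp: disjoint_family_on_def)
  also have "\<dots> = (\<Sum>k=1..N. \<integral>x. F x \<partial>lebesgue_on (\<omega> k))"
    using sets by (intro sum.cong) (auto simp: set_lebesgue_integral_def integral_restrict_space)
  finally show ?thesis .
qed

section \<open>Neighbouring cells and sums over interfaces\<close>

lemma neighboursD:
  assumes "j \<in> neighbours \<omega> N k"
  shows "j \<in> {1..N}" "j \<noteq> k" "emeasure surface (interface \<omega> k j) > 0"
  using assms by (auto simp: neighbours_def)

lemma finite_neighbours [simp]: "finite (neighbours \<omega> N k)"
  by (simp add: neighbours_def)

lemma neighbours_sym: "k \<in> {1..N} \<Longrightarrow> j \<in> neighbours \<omega> N k \<Longrightarrow> k \<in> neighbours \<omega> N j"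
  by (auto simp: neighbours_def interface_commute)

lemma interface_borel: "interface \<omega> k j \<in> sets surface"
  by (simp add: borel_closed closed_interface)

lemma interior_boundary_borel: "interior_boundary \<omega> N k \<in> sets surface"
  unfolding interior_boundary_def by (intro sets.finite_UN interface_borel) simp

text \<open>Two interfaces of one cell meet inside the closures of three cells, a set of area 0, so
  the integral over their union is additive although they may touch.\<close>

lemma integral_interior_boundary:
  fixes F :: "'a::euclidean_space \<Rightarrow> real"
  assumes P: "convex_partition S N \<omega>" and k: "k \<in> {1..N}"
    and F: "integrable (surface_on (interior_boundary \<omega> N k)) F"
  shows "(\<integral>x. F x \<partial>surface_on (interior_boundary \<omega> N k))
    = (\<Sum>j\<in>neighbours \<omega> N k. \<integral>x. F x \<partial>surface_on (interface \<omega> k j))"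
proof -
  have "set_integrable surface (interior_boundary \<omega> N k) F"
    using F interior_boundary_borel[of \<omega> N k] by (simp add: set_integrable_def surface_on_def integrable_restrict_space)
  then have Fj: "set_integrable surface (interface \<omega> k j) F" if "j \<in> neighbours \<omega> N k" for j
    using that interface_borel by (rule_tac set_integrable_subset) (auto simp: interior_boundary_def)
  have AE: "AE x in surface. (x \<in> interface \<omega> k i \<and> x \<in> interface \<omega> k j) \<longrightarrow> i = j"
    if "i \<in> neighbours \<omega> N k" "j \<in> neighbours \<omega> N k" for i j
  proof (cases "i = j")
    case False
    note I = neighboursD[OF that(1)] and J = neighboursD[OF that(2)]
    note Ck = convex_partitionD[OF P k] and Ci = convex_partitionD[OF P I(1)] and Cj = convex_partitionD[OF P J(1)]
    have "closure (\<omega> k) \<inter> closure (\<omega> i) \<inter> closure (\<omega> j) \<in> null_sets surface"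
      using emeasure_surface_triple_intersection[OF Ck(1-3) Ci(1-3) Cj(1-3) Ck(5)[OF I(1,2)]]
        Ci(5)[OF J(1)] Ck(5)[OF J(1,2)] False
      by (intro null_setsI) (auto intro: borel_closed)
    then have "AE x in surface. x \<notin> closure (\<omega> k) \<inter> closure (\<omega> i) \<inter> closure (\<omega> j)"
      by (rule AE_not_in)
    then show ?thesis
      by eventually_elim (auto simp: interface_def)
  qed simp
  have "(\<integral>x. F x \<partial>surface_on (interior_boundary \<omega> N k)) = (LINT x:(\<Union>j\<in>neighbours \<omega> N k. interface \<omega> k j)|surface. F x)"
    using interior_boundary_borel[of \<omega> N k]
    by (simp add: set_lebesgue_integral_def integral_restrict_space surface_on_def interior_boundary_def)
  also have "\<dots> = (\<Sum>j\<in>neighbours \<omega> N k. LINT x:interface \<omega> k j|surface. F x)"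
    using Fj AE interface_borel by (intro set_integral_finite_UN_AE) auto
  also have "\<dots> = (\<Sum>j\<in>neighbours \<omega> N k. \<integral>x. F x \<partial>surface_on (interface \<omega> k j))"
  proof (intro sum.cong refl)
    fix j
    have "interface \<omega> k j \<inter> space surface \<in> sets surface"
      using interface_borel[of \<omega> k j] by simp
    then show "(LINT x:interface \<omega> k j|surface. F x) = (\<integral>x. F x \<partial>surface_on (interface \<omega> k j))"
      unfolding set_lebesgue_integral_def surface_on_def by (rule integral_restrict_space[symmetric])
  qed
  finally show ?thesis .
qed

lemma finite_interfaces: "finite (interfaces \<omega> N)"
  by (rule finite_subset[of _ "{1..N} \<times> {1..N}"]) (auto simp: interfaces_def neighbours_def)

text \<open>An ordered pair of neighbours is an interface or the swap of one; this gathers both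
  sides of an interface in one summand.\<close>

lemma sum_neighbours:
  fixes a :: "nat \<Rightarrow> nat \<Rightarrow> real"
  shows "(\<Sum>k=1..N. \<Sum>j\<in>neighbours \<omega> N k. a k j) = (\<Sum>(k, j)\<in>interfaces \<omega> N. a k j + a j k)"
proof -
  let ?E = "interfaces \<omega> N" and ?E' = "prod.swap ` interfaces \<omega> N"
  have "(\<Sum>k=1..N. \<Sum>j\<in>neighbours \<omega> N k. a k j) = (\<Sum>(k, j)\<in>Sigma {1..N} (neighbours \<omega> N). a k j)"
    by (simp add: sum.Sigma)
  also have "Sigma {1..N} (neighbours \<omega> N) = ?E \<union> ?E'"
  proof (intro equalityI subsetI)
    fix p assume "p \<in> Sigma {1..N} (neighbours \<omega> N)"
    then obtain k j where p: "p = (k, j)" "k \<in> {1..N}" "j \<in> neighbours \<omega> N k"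
      by auto
    show "p \<in> ?E \<union> ?E'"
    proof (cases "k < j")
      case False
      then have "(j, k) \<in> ?E"
        using p neighboursD[OF p(3)] neighbours_sym[OF p(2,3)] by (auto simp: interfaces_def)
      then show ?thesis
        using p by (force simp: image_iff)
    qed (use p in \<open>auto simp: interfaces_def\<close>)
  next
    fix p assume "p \<in> ?E \<union> ?E'"
    then show "p \<in> Sigma {1..N} (neighbours \<omega> N)"
      by (auto simp: interfaces_def neighbours_sym) (auto simp: neighbours_def)
  qed
  also have "(\<Sum>(k, j)\<in>?E \<union> ?E'. a k j) = (\<Sum>(k, j)\<in>?E. a k j) + (\<Sum>(k, j)\<in>?E'. a k j)"
  proof (rule sum.union_disjoint)
    show "?E \<inter> ?E' = {}"
      by (auto simp: interfaces_def)
  qed (simp_all add: finite_interfaces)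
  also have "(\<Sum>(k, j)\<in>?E'. a k j) = (\<Sum>(k, j)\<in>?E. a j k)"
    by (subst sum.reindex) (auto simp: inj_on_def case_prod_unfold)
  finally show ?thesis
    by (simp add: sum.distrib case_prod_unfold)
qed

text \<open>Double counting: \<open>s i\<close> occurs once for each interface of cell
  \<open>i\<close>, and there are at most \<open>Emax\<close> of them.\<close>

lemma sum_interfaces_le_Emax:
  fixes s :: "nat \<Rightarrow> real"
  assumes s: "\<And>k. 0 \<le> s k"
  shows "(\<Sum>(k, j)\<in>interfaces \<omega> N. s k + s j) \<le> real (Emax \<omega> N) * (\<Sum>k=1..N. s k)"
proof -
  let ?E = "interfaces \<omega> N"
  \<comment> \<open>Written as a sum over all cells, the summand allows the two sums to be
    exchanged; the two sides agree because \<open>k\<close> and \<open>j\<close> differ.\<close>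
  have "s k + s j = (\<Sum>i=1..N. if i = k \<or> i = j then s i else 0)" if "(k, j) \<in> ?E" for k j
  proof -
    have kj: "k \<in> {1..N}" "j \<in> {1..N}" "k \<noteq> j"
      using that by (auto simp: interfaces_def neighbours_def)
    have "(\<Sum>i=1..N. if i = k \<or> i = j then s i else 0) = (\<Sum>i\<in>{k, j}. s i)"
      using kj by (intro sum.mono_neutral_cong_right) auto
    then show ?thesis
      using kj by simp
  qed
  then have "(\<Sum>(k, j)\<in>?E. s k + s j) = (\<Sum>p\<in>?E. \<Sum>i=1..N. if i = fst p \<or> i = snd p then s i else 0)"
    by (intro sum.cong) auto
  also have "\<dots> = (\<Sum>i=1..N. \<Sum>p\<in>?E. if i = fst p \<or> i = snd p then s i else 0)"
    by (rule sum.swap)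
  also have "\<dots> = (\<Sum>i=1..N. real (card {(k, j) \<in> ?E. k = i \<or> j = i}) * s i)"
  proof (intro sum.cong refl)
    fix i
    have "(\<Sum>p\<in>?E. if i = fst p \<or> i = snd p then s i else 0) = (\<Sum>p\<in>{p \<in> ?E. i = fst p \<or> i = snd p}. s i)"
      by (rule sum.inter_filter[OF finite_interfaces, symmetric])
    also have "{p \<in> ?E. i = fst p \<or> i = snd p} = {(k, j) \<in> ?E. k = i \<or> j = i}"
      by auto
    finally show "(\<Sum>p\<in>?E. if i = fst p \<or> i = snd p then s i else 0) = real (card {(k, j) \<in> ?E. k = i \<or> j = i}) * s i"
      by simp
  qed
  also have "\<dots> \<le> (\<Sum>i=1..N. real (Emax \<omega> N) * s i)"
  proof (intro sum_mono mult_right_mono s)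
    fix i assume "i \<in> {1..N}"
    then show "real (card {(k, j) \<in> ?E. k = i \<or> j = i}) \<le> real (Emax \<omega> N)"
      unfolding Emax_def by (intro of_nat_mono Max_ge) auto
  qed
  finally show ?thesis
    by (simp add: sum_distrib_left)
qed

section \<open>Poincare inequalities and mean values\<close>

lemma L2_const_surface_on:
  assumes "S \<in> sets borel" "bounded S" "emeasure surface S < \<infinity>"
  shows "L2 (surface_on S) (\<lambda>_. c::real)"
  using assms by (intro continuous_L2_surface_on) auto

lemma C1_const: "C1_with_gradient (\<lambda>_. c) (\<lambda>_. 0)"
  by (simp add: C1_with_gradient_def)

text \<open>\<open>poincare_const\<close> contains no sign condition, but a coordinate function,
  whose gradient has positive norm, forces one. The sign is needed to multiply inequalities by the
  maximal constant.\<close>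

lemma poincare_const_nonneg:
  fixes S :: "'a::euclidean_space set"
  assumes C: "poincare_const S C" and S: "open S" "bounded S" "S \<noteq> {}"
  shows "0 \<le> C"
proof -
  obtain i :: 'a where i: "i \<in> Basis"
    using nonempty_Basis by blast
  have "C1_with_gradient (\<lambda>x. x \<bullet> i) (\<lambda>_. i)"
    by (auto simp: C1_with_gradient_def inner_commute intro!: derivative_eq_intros)
  then have H: "H1 S (\<lambda>x. x \<bullet> i) (\<lambda>_. i)"
    using S by (intro C1_H1)
  have "S \<in> lmeasurable"
    using S by (simp add: lmeasurable_open)
  moreover have "\<not> negligible S"
    using S open_not_negligible by blast
  ultimately have "measure lebesgue S > 0"
    by (simp add: negligible_iff_measure zero_less_measure_iff)
  then have "L2norm (lebesgue_on S) (\<lambda>_. i) > 0"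
    using i S by (simp add: L2norm_def measure_restrict_space)
  moreover have "0 \<le> C * L2norm (lebesgue_on S) (\<lambda>_. i)"
    using C[unfolded poincare_const_def, rule_format, OF H] by (rule order_trans[OF L2norm_nonneg])
  ultimately show ?thesis
    by (simp add: zero_le_mult_iff)
qed

lemma mean_value_zero_bound:
  fixes r w :: "'a::euclidean_space \<Rightarrow> real"
  assumes C: "poincare_const S C" and S: "open S" "bounded S" and w: "H1 S w Dw"
    and r: "L2 (lebesgue_on S) r" "(\<integral>x. r x \<partial>lebesgue_on S) = 0"
  shows "(\<integral>x. r x * w x \<partial>lebesgue_on S) \<le> L2norm (lebesgue_on S) r * (C * L2norm (lebesgue_on S) Dw)"
proof -
  define c where "c = (1 / measure lebesgue S) * (\<integral>z. w z \<partial>lebesgue_on S)"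
  have Lw: "L2 (lebesgue_on S) w"
    using w by (simp add: H1_def)
  have Lc: "L2 (lebesgue_on S) (\<lambda>_. c)" "L2 (lebesgue_on S) (\<lambda>_. 1::real)"
    using S by (auto intro: continuous_L2_lebesgue_on)
  have ir: "integrable (lebesgue_on S) r"
    using L2_integrable_mult[OF r(1) Lc(2)] by simp
  have "(\<integral>x. r x * (w x - c) \<partial>lebesgue_on S) = (\<integral>x. r x * w x \<partial>lebesgue_on S) - (\<integral>x. r x * c \<partial>lebesgue_on S)"
    unfolding right_diff_distrib
    by (intro Bochner_Integration.integral_diff L2_integrable_mult r Lw Lc)
  also have "(\<integral>x. r x * c \<partial>lebesgue_on S) = 0"
    using r(2) by simp
  finally have "(\<integral>x. r x * w x \<partial>lebesgue_on S) = (\<integral>x. r x * (w x - c) \<partial>lebesgue_on S)"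
    by simp
  also have "\<dots> \<le> L2norm (lebesgue_on S) r * L2norm (lebesgue_on S) (\<lambda>x. w x - c)"
    using L2_mult_bound[OF r(1) L2_diff[OF Lw Lc(1)]] by simp
  also have "\<dots> \<le> L2norm (lebesgue_on S) r * (C * L2norm (lebesgue_on S) Dw)"
    using C w unfolding poincare_const_def c_def by (intro mult_left_mono) auto
  finally show ?thesis .
qed

text \<open>Subtracting a constant leaves the gradient alone, so the inequality for traces with mean
  value zero extends to the deviation of any trace from its mean.\<close>

lemma trace_poincare_mean:
  fixes w :: "'a::euclidean_space \<Rightarrow> real"
  assumes C: "trace_poincare_const R S C" and S: "open S" "bounded S" "emeasure surface (frontier S) < \<infinity>"
    and R: "R \<in> sets surface" "R \<subseteq> frontier S" "emeasure surface R > 0"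
    and t: "has_trace S w Dw t"
  shows "L2norm (surface_on R) (\<lambda>x. t x - (1 / measure surface R) * (\<integral>x. t x \<partial>surface_on R))
    \<le> C * L2norm (lebesgue_on S) Dw"
proof -
  define c where "c = (1 / measure surface R) * (\<integral>x. t x \<partial>surface_on R)"
  have "emeasure surface R \<le> emeasure surface (frontier S)"
    using R by (intro emeasure_mono) (auto intro: borel_closed)
  then have finR: "emeasure surface R < \<infinity>"
    using S(3) by (rule le_less_trans)
  have bR: "bounded R"
    using bounded_subset[OF bounded_diff[OF bounded_closure[OF S(2)]]] R(2) by (simp add: frontier_def)
  have mR: "measure surface R > 0"
    using R(3) finR by (simp add: measure_def enn2real_positive_iff)
  interpret finite_measure "surface_on R"
    using R finR by (intro finite_measure_surface_on) auto
  have Lt: "L2 (surface_on R) t"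
    using t R(2) unfolding has_trace_def surface_on_def
    by (intro L2_restrict_subset(1)[OF R(1) _ R(2)]) (auto intro: borel_closed)
  have it: "integrable (surface_on R) t"
    using L2_integrable_mult[OF Lt L2_const_surface_on[of R 1]] R bR finR by simp
  have "measure (surface_on R) (space (surface_on R)) = measure surface R"
    using R(1) unfolding surface_on_def by (simp add: space_restrict_space measure_restrict_space)
  then have "(\<integral>x. t x - c \<partial>surface_on R) = (\<integral>x. t x \<partial>surface_on R) - c * measure surface R"
    using it by simp
  also have "\<dots> = 0"
    using mR by (simp add: c_def)
  finally have "(1 / measure surface R) * (\<integral>x. t x - c \<partial>surface_on R) = 0"
    by simp
  moreover have "has_trace S (\<lambda>x. w x - c) Dw (\<lambda>x. t x - c)"
    using has_trace_diff[OF t C1_has_trace[OF C1_const S] S] by simp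
  ultimately show ?thesis
    using C unfolding trace_poincare_const_def c_def[symmetric] by blast
qed

text \<open>The constant \<open>c\<close> is free here; in the application it is the mean of
  \<open>t\<close>.\<close>

lemma zero_mean_inner_bound:
  fixes r t :: "'a::euclidean_space \<Rightarrow> real"
  assumes R: "R \<in> sets borel" "bounded R" "emeasure surface R < \<infinity>"
    and r: "L2 (surface_on R) r" "(\<integral>x. r x \<partial>surface_on R) = 0" and t: "L2 (surface_on R) t"
  shows "\<bar>\<integral>x. r x * t x \<partial>surface_on R\<bar> \<le> L2norm (surface_on R) r * L2norm (surface_on R) (\<lambda>x. t x - c)"
proof -
  note Lc = L2_const_surface_on[OF R]
  have "(\<integral>x. r x * (t x - c) \<partial>surface_on R) = (\<integral>x. r x * t x \<partial>surface_on R) - (\<integral>x. r x * c \<partial>surface_on R)"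
    unfolding right_diff_distrib
    by (intro Bochner_Integration.integral_diff L2_integrable_mult r t Lc)
  also have "(\<integral>x. r x * c \<partial>surface_on R) = 0"
    using r(2) by simp
  finally show ?thesis
    using L2_mult_bound[OF r(1) L2_diff[OF t Lc], of c] by simp
qed

section \<open>The error estimate\<close>

text \<open>The deviation of \<open>t\<close> from its mean over the interface can be estimated from
  either cell, as both cells share \<open>t\<close>. Using both estimates yields a bound that is
  symmetric in the two cells.\<close>

lemma interface_flux_bound:
  fixes \<omega> :: "nat \<Rightarrow> 'a::euclidean_space set" and w t gk gj :: "'a \<Rightarrow> real" and n :: 'a
  assumes P: "convex_partition S N \<omega>" and dom: "polyhedral_lipschitz_domain S" and kj: "(k, j) \<in> interfaces \<omega> N"
  defines "R \<equiv> interface \<omega> k j"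
  defines "r \<equiv> \<lambda>x. normal_component (\<omega> k) R n gk x - normal_component (\<omega> j) R n gj x"
  assumes t: "has_trace (\<omega> k) w Dw t" "has_trace (\<omega> j) w Dw t"
    and g: "L2 (surface_on R) gk" "L2 (surface_on R) gj"
    and n: "is_unit_normal R n"
    and C: "trace_poincare_const R (\<omega> k) Ck" "trace_poincare_const R (\<omega> j) Cj"
    and mean: "(1 / measure surface R) * (\<integral>x. r x \<partial>surface_on R) = 0"
  shows "\<bar>(\<integral>x. gk x * t x \<partial>surface_on R) + (\<integral>x. gj x * t x \<partial>surface_on R)\<bar>
    \<le> (sqrt ((Cj\<^sup>2 + Ck\<^sup>2) / 2) * L2norm (surface_on R) r)
      * sqrt ((L2norm (lebesgue_on (\<omega> k)) Dw)\<^sup>2 + (L2norm (lebesgue_on (\<omega> j)) Dw)\<^sup>2)"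
proof -
  have S: "open S" "bounded S"
    using dom by (auto simp: polyhedral_lipschitz_domain_def)
  have k: "k \<in> {1..N}" and nb: "j \<in> neighbours \<omega> N k"
    using kj by (auto simp: interfaces_def)
  note j = neighboursD(1,2)[OF nb] and posR = neighboursD(3)[OF nb, folded R_def]
  note Ck = convex_partitionD[OF P k] and Cj = convex_partitionD[OF P j(1)]
  have R_eq: "R = closure (\<omega> k) \<inter> closure (\<omega> j)"
    by (simp add: R_def interface_def)
  have R: "R \<in> sets surface" "R \<in> sets borel"
    using interface_borel[of \<omega> k j] by (auto simp: R_def)
  have Rk: "R \<subseteq> frontier (\<omega> k)"
    unfolding R_def by (rule interface_subset_frontier[OF P k j])
  have Rj: "R \<subseteq> frontier (\<omega> j)"
    unfolding R_def interface_commute[of \<omega> k j] by (rule interface_subset_frontier[OF P j(1) k j(2)[symmetric]])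
  have bR: "bounded R"
    unfolding R_def by (rule bounded_interface[OF P S(2) k])
  have finR: "emeasure surface R < \<infinity>"
    unfolding R_def by (rule emeasure_surface_interface[OF P S(2) k j])
  \<comment> \<open>If the area were zero or infinite, \<open>measure\<close> would be 0, and so
    would the factor \<open>1 / measure\<close> in \<open>mean\<close>, leaving \<open>mean\<close>
    without content.\<close>
  have mR: "measure surface R > 0"
    using posR finR by (simp add: measure_def enn2real_positive_iff)
  have Lt: "L2 (surface_on R) t"
    using t(1) unfolding has_trace_def surface_on_def
    by (intro L2_restrict_subset(1)[OF R(1) _ Rk]) (auto intro: borel_closed)
  have one_side: "(\<forall>a\<in>\<omega> k. \<forall>z\<in>R. n \<bullet> a \<le> n \<bullet> z) \<longleftrightarrow> \<not> (\<forall>a\<in>\<omega> j. \<forall>z\<in>R. n \<bullet> a \<le> n \<bullet> z)"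
    unfolding R_eq
    by (rule outward_for_exactly_one_side[OF Ck(1-3) Cj(1-3) Ck(5)[OF j]]) (use posR n in \<open>simp_all add: R_eq\<close>)
  \<comment> \<open>Sign of \<open>n\<close> relative to the outward normal of
    \<open>\<omega> k\<close>. The sign on \<open>\<omega> j\<close> is opposite, which turns the
    difference that defines the jump into the sum of the two outer traces.\<close>
  define \<sigma> :: real where "\<sigma> = (if \<forall>a\<in>\<omega> k. \<forall>z\<in>R. n \<bullet> a \<le> n \<bullet> z then 1 else -1)"
  have r: "r x = \<sigma> * (gk x + gj x)" for x
    using one_side by (simp add: r_def normal_component_def \<sigma>_def)
  have Lr: "L2 (surface_on R) r"
    using L2_scaleR[OF L2_add[OF g], of \<sigma>] by (simp add: r[abs_def])
  have r0: "(\<integral>x. r x \<partial>surface_on R) = 0"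
    using mean mR by simp
  define c where "c = (1 / measure surface R) * (\<integral>x. t x \<partial>surface_on R)"
  define b where "b = L2norm (surface_on R) (\<lambda>x. t x - c)"
  define bk bj where "bk = L2norm (lebesgue_on (\<omega> k)) Dw" "bj = L2norm (lebesgue_on (\<omega> j)) Dw"
  have b0: "b \<ge> 0"
    by (simp add: b_def)
  have "b \<le> Ck * bk"
    unfolding b_def c_def bk_bj_def
    by (rule trace_poincare_mean[OF C(1) Ck(1) bounded_frontier_cell(1)[OF P S(2) k] emeasure_surface_frontier_cell[OF P dom k] R(1) Rk posR t(1)])
  then have "b\<^sup>2 \<le> (Ck * bk)\<^sup>2"
    using b0 by (rule power_mono)
  moreover have "b \<le> Cj * bj"
    unfolding b_def c_def bk_bj_def
    by (rule trace_poincare_mean[OF C(2) Cj(1) bounded_frontier_cell(1)[OF P S(2) j(1)] emeasure_surface_frontier_cell[OF P dom j(1)] R(1) Rj posR t(2)])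
  then have "b\<^sup>2 \<le> (Cj * bj)\<^sup>2"
    using b0 by (rule power_mono)
  \<comment> \<open>Averaging the two bounds on the same \<open>b\<close> produces the factor 1/2 in
    \<open>interface_const\<close>; the step after it only adds the nonnegative mixed
    products.\<close>
  ultimately have "b\<^sup>2 \<le> (Ck\<^sup>2 * bk\<^sup>2 + Cj\<^sup>2 * bj\<^sup>2) / 2"
    by (simp add: power_mult_distrib)
  also have "\<dots> \<le> (Cj\<^sup>2 + Ck\<^sup>2) / 2 * (bk\<^sup>2 + bj\<^sup>2)"
    using mult_nonneg_nonneg[of "Ck\<^sup>2" "bj\<^sup>2"] mult_nonneg_nonneg[of "Cj\<^sup>2" "bk\<^sup>2"] by (simp add: algebra_simps)
  finally have "b \<le> sqrt ((Cj\<^sup>2 + Ck\<^sup>2) / 2 * (bk\<^sup>2 + bj\<^sup>2))"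
    by (rule real_le_rsqrt)
  then have b: "b \<le> sqrt ((Cj\<^sup>2 + Ck\<^sup>2) / 2) * sqrt (bk\<^sup>2 + bj\<^sup>2)"
    by (simp only: real_sqrt_mult)
  have "(\<integral>x. r x * t x \<partial>surface_on R) = \<sigma> * ((\<integral>x. gk x * t x \<partial>surface_on R) + (\<integral>x. gj x * t x \<partial>surface_on R))"
    by (simp add: r distrib_right mult.assoc Bochner_Integration.integral_add L2_integrable_mult g Lt)
  then have "\<bar>(\<integral>x. gk x * t x \<partial>surface_on R) + (\<integral>x. gj x * t x \<partial>surface_on R)\<bar> = \<bar>\<integral>x. r x * t x \<partial>surface_on R\<bar>"
    by (simp add: abs_mult \<sigma>_def)
  also have "\<dots> \<le> L2norm (surface_on R) r * b"
    unfolding b_def by (rule zero_mean_inner_bound[OF R(2) bR finR Lr r0 Lt])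
  also have "\<dots> \<le> L2norm (surface_on R) r * (sqrt ((Cj\<^sup>2 + Ck\<^sup>2) / 2) * sqrt (bk\<^sup>2 + bj\<^sup>2))"
    by (intro mult_left_mono b) simp
  finally show ?thesis
    by (simp add: bk_bj_def mult_ac)
qed

text \<open>Adding and subtracting \<open>y x \<bullet> p x\<close> and \<open>dy x * w x\<close>.
  The last integral is the one that the normal trace of \<open>y\<close> converts into a boundary
  integral when \<open>p\<close> is the gradient of \<open>w\<close>.\<close>

lemma broken_flux_identity:
  fixes y p q :: "'a::euclidean_space \<Rightarrow> 'a" and w f dy :: "'a \<Rightarrow> real"
  assumes L2: "L2 M y" "L2 M p" "L2 M q" "L2 M w" "L2 M f" "L2 M dy"
  shows "(\<integral>x. f x * w x - q x \<bullet> p x \<partial>M)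
    = (\<integral>x. (y x - q x) \<bullet> p x \<partial>M) + (\<integral>x. (dy x + f x) * w x \<partial>M) - (\<integral>x. y x \<bullet> p x + dy x * w x \<partial>M)"
proof -
  have i: "integrable M (\<lambda>x. (y x - q x) \<bullet> p x)" "integrable M (\<lambda>x. (dy x + f x) * w x)"
    "integrable M (\<lambda>x. y x \<bullet> p x + dy x * w x)"
    by (intro L2_integrable_inner L2_integrable_mult Bochner_Integration.integrable_add L2_diff L2_add L2)+
  have "(\<integral>x. f x * w x - q x \<bullet> p x \<partial>M)
    = (\<integral>x. (y x - q x) \<bullet> p x + (dy x + f x) * w x - (y x \<bullet> p x + dy x * w x) \<partial>M)"
    by (simp add: inner_diff_left algebra_simps)
  then show ?thesis
    using i by simp
qed

theorem theorem3p1: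
  fixes \<Omega> :: "(real^'n) set" and \<omega> :: "nat \<Rightarrow> (real^'n) set" and N :: nat
    and A :: "real^'n^'n" and Cmin Cmax :: real
    and f u ug v :: "real^'n \<Rightarrow> real" and Du Dug Dv :: "real^'n \<Rightarrow> real^'n"
    and y :: "real^'n \<Rightarrow> real^'n" and dy g :: "nat \<Rightarrow> real^'n \<Rightarrow> real"
    and n :: "nat \<Rightarrow> nat \<Rightarrow> real^'n"
    and CP :: "nat \<Rightarrow> real" and CPt :: "(real^'n) set \<Rightarrow> (real^'n) set \<Rightarrow> real"
  defines "yn \<equiv> \<lambda>i k j. normal_component (\<omega> i) (interface \<omega> k j) (n k j) (g i)"
  assumes domain: "polyhedral_lipschitz_domain \<Omega>"
    and partition: "convex_partition \<Omega> N \<omega>"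
    and A_sym: "transpose A = A"
    and C_bounds: "0 < Cmin" "Cmin \<le> Cmax"
    and A_bounds: "\<And>\<xi>. Cmin * (norm \<xi>)\<^sup>2 \<le> (A *v \<xi>) \<bullet> \<xi> \<and> (A *v \<xi>) \<bullet> \<xi> \<le> Cmax * (norm \<xi>)\<^sup>2"
    and f: "L2 (lebesgue_on \<Omega>) f"
    and ug: "H1 \<Omega> ug Dug"
    and u: "H1 \<Omega> u Du" "equal_traces \<Omega> u Du ug Dug"
    and weak_solution: "\<And>w Dw. H10 \<Omega> w Dw \<Longrightarrow>
          (\<integral>x. (A *v Du x) \<bullet> Dw x \<partial>lebesgue_on \<Omega>) = (\<integral>x. f x * w x \<partial>lebesgue_on \<Omega>)"
    and v: "H1 \<Omega> v Dv" "equal_traces \<Omega> v Dv ug Dug"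
    and y: "L2 (lebesgue_on \<Omega>) y" "\<And>k. k \<in> {1..N} \<Longrightarrow> Hdiv (\<omega> k) y (dy k)"
    and normal_traces: "\<And>k. k \<in> {1..N} \<Longrightarrow>
          has_outer_normal_trace (\<omega> k) (interior_boundary \<omega> N k) y (dy k) (g k)"
    and normals: "\<And>k j. (k, j) \<in> interfaces \<omega> N \<Longrightarrow> is_unit_normal (interface \<omega> k j) (n k j)"
    and CP: "\<And>k. k \<in> {1..N} \<Longrightarrow> poincare_const (\<omega> k) (CP k)"
    and CPt: "\<And>k j. (k, j) \<in> interfaces \<omega> N \<Longrightarrow>
          trace_poincare_const (interface \<omega> k j) (\<omega> k) (CPt (interface \<omega> k j) (\<omega> k)) \<and>
          trace_poincare_const (interface \<omega> k j) (\<omega> j) (CPt (interface \<omega> k j) (\<omega> j))"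
    and A1: "\<And>k j. (k, j) \<in> interfaces \<omega> N \<Longrightarrow>
          (1 / measure surface (interface \<omega> k j)) *
            (\<integral>x. yn k k j x - yn j k j x \<partial>surface_on (interface \<omega> k j)) = 0"
    and A2: "\<And>j. j \<in> {1..N} \<Longrightarrow>
          (1 / measure lebesgue (\<omega> j)) * (\<integral>x. dy j x + f x \<partial>lebesgue_on (\<omega> j)) = 0"
  shows "matrix_norm_on A \<Omega> (\<lambda>x. Du x - Dv x)
    \<le> sqrt (\<Sum>k=1..N. (matrix_norm_on (matrix_inv A) (\<omega> k) (\<lambda>x. y x - A *v Dv x))\<^sup>2)
      + 1 / sqrt Cmin *
        (Max (CP ` {1..N}) * sqrt (\<Sum>k=1..N. (L2norm (lebesgue_on (\<omega> k)) (\<lambda>x. dy k x + f x))\<^sup>2)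
         + sqrt (real (Emax \<omega> N)) *
           sqrt (\<Sum>(k, j)\<in>interfaces \<omega> N. (interface_const CPt \<omega> k j)\<^sup>2 *
                  (L2norm (surface_on (interface \<omega> k j)) (\<lambda>x. yn k k j x - yn j k j x))\<^sup>2))"
proof -
  interpret spd_matrix A Cmin
    using A_sym C_bounds A_bounds by unfold_locales auto
  have \<Omega>: "open \<Omega>" "bounded \<Omega>" "\<Omega> \<noteq> {}"
    using domain by (auto simp: polyhedral_lipschitz_domain_def)
  have finite_frontier: "emeasure surface (frontier \<Omega>) < \<infinity>"
    by (rule emeasure_surface_frontier_domain[OF domain])
  \<comment> \<open>\<open>Max\<close> is meaningful only for a nonempty set, so there has to be a
    cell.\<close>
  have N: "{1..N} \<noteq> {}"
  proof
    assume "{1..N} = {}"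
    then have "closure \<Omega> = {}"
      using partition by (simp add: convex_partition_def)
    then show False
      using \<Omega>(3) by simp
  qed
  note cell = convex_partitionD[OF partition]
  have sets: "\<Omega> \<in> sets lebesgue" "\<And>k. k \<in> {1..N} \<Longrightarrow> \<omega> k \<in> sets lebesgue"
    using \<Omega>(1) cell(1) by auto
  define w where "w x = u x - v x" for x
  define Dw where "Dw x = Du x - Dv x" for x
  have H10: "H10 \<Omega> w Dw"
    unfolding w_def[abs_def] Dw_def[abs_def] by (rule H10_diff[OF u(2) v(2) \<Omega>(1,2) finite_frontier])
  then have Lw: "L2 (lebesgue_on \<Omega>) w" "L2 (lebesgue_on \<Omega>) Dw"
    by (auto simp: H10_def has_trace_def H1_def)
  have LD: "L2 (lebesgue_on \<Omega>) Du" "L2 (lebesgue_on \<Omega>) Dv"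
    using u(1) v(1) by (auto simp: H1_def)
  have Lq: "L2 (lebesgue_on \<Omega>) (\<lambda>x. A *v Dv x)"
    by (rule L2_matrix_vector[OF LD(2)])
  have on_cell: "L2 (lebesgue_on (\<omega> k)) h" if "k \<in> {1..N}" "L2 (lebesgue_on \<Omega>) h"
    for k and h :: "real^'n \<Rightarrow> 'b::euclidean_space"
    using L2_restrict_subset(1)[OF sets(2)[OF that(1)] sets(1) cell(4)[OF that(1)] that(2)] .
  have Ldy: "L2 (lebesgue_on (\<omega> k)) (dy k)" if "k \<in> {1..N}" for k
    using y(2)[OF that] by (simp add: Hdiv_def)
  obtain t where t: "\<And>k. k \<in> {1..N} \<Longrightarrow> has_trace (\<omega> k) w Dw t"
    and t0: "AE x in surface_on (frontier \<Omega> \<inter> (\<Union>k\<in>{1..N}. frontier (\<omega> k))). t x = 0"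
    by (rule skeleton_trace[OF partition domain H10]; rule that; assumption)

  define M where "M = matrix_norm_on A \<Omega> Dw"
  define m where "m k = matrix_norm_on A (\<omega> k) Dw" for k
  define B where "B = L2norm (lebesgue_on \<Omega>) Dw"
  define b where "b k = L2norm (lebesgue_on (\<omega> k)) Dw" for k
  define Q where "Q k = matrix_norm_on (matrix_inv A) (\<omega> k) (\<lambda>x. y x - A *v Dv x)" for k
  define R where "R k = L2norm (lebesgue_on (\<omega> k)) (\<lambda>x. dy k x + f x)" for k
  define J where "J k j = interface_const CPt \<omega> k j * L2norm (surface_on (interface \<omega> k j)) (\<lambda>x. yn k k j x - yn j k j x)" for k j
  \<comment> \<open>Pairing of the outer normal trace from cell \<open>k\<close> with the common
    trace. The outward normals of the two cells are opposite, so \<open>a k j + a j k\<close>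
    measures the jump.\<close>
  define a where "a k j = (\<integral>x. g k x * t x \<partial>surface_on (interface \<omega> k j))" for k j
  define E where "E = interfaces \<omega> N"

  have sum_m: "(\<Sum>k=1..N. (m k)\<^sup>2) = M\<^sup>2"
  proof -
    have "M\<^sup>2 = (\<integral>x. (A *v Dw x) \<bullet> Dw x \<partial>lebesgue_on \<Omega>)"
      unfolding M_def by (rule matrix_norm_on_L2norm(3)[OF Lw(2) quadratic_nonneg])
    also have "\<dots> = (\<Sum>k=1..N. \<integral>x. (A *v Dw x) \<bullet> Dw x \<partial>lebesgue_on (\<omega> k))"
      by (intro integral_partition[OF partition \<Omega>(1)] L2_integrable_inner L2_matrix_vector Lw)
    also have "\<dots> = (\<Sum>k=1..N. (m k)\<^sup>2)"
      unfolding m_def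
      by (intro sum.cong refl matrix_norm_on_L2norm(3)[symmetric] on_cell Lw quadratic_nonneg)
    finally show ?thesis ..
  qed
  have sum_b: "(\<Sum>k=1..N. (b k)\<^sup>2) = B\<^sup>2"
    unfolding b_def B_def L2norm_square
    using Lw(2) by (intro integral_partition[OF partition \<Omega>(1), symmetric]) (simp add: L2_def)
  have nonneg: "0 \<le> M" "0 \<le> B" "\<And>k. 0 \<le> m k" "\<And>k. 0 \<le> b k" "\<And>k. 0 \<le> Q k" "\<And>k. 0 \<le> R k" "\<And>k j. 0 \<le> J k j"
    by (simp_all add: M_def B_def m_def b_def Q_def R_def J_def interface_const_def matrix_norm_on_nonneg
        quadratic_nonneg inverse_quadratic_nonneg)
  have CP_nonneg: "0 \<le> CP k" if "k \<in> {1..N}" for k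
    by (rule poincare_const_nonneg[OF CP[OF that] cell(1)[OF that] bounded_frontier_cell(1)[OF partition \<Omega>(2) that] cell(3)[OF that]])
  have CP_le: "CP k \<le> Max (CP ` {1..N})" if "k \<in> {1..N}" for k
    using that by (intro Max_ge) auto
  have CP_max: "0 \<le> Max (CP ` {1..N})"
    using CP_nonneg CP_le N by (meson ex_in_conv order_trans)

  have energy: "M\<^sup>2 = (\<Sum>k=1..N. \<integral>x. f x * w x - (A *v Dv x) \<bullet> Dw x \<partial>lebesgue_on (\<omega> k))"
  proof -
    have "M\<^sup>2 = (\<integral>x. (A *v Dw x) \<bullet> Dw x \<partial>lebesgue_on \<Omega>)"
      unfolding M_def by (rule matrix_norm_on_L2norm(3)[OF Lw(2) quadratic_nonneg])
    also have "\<dots> = (\<integral>x. (A *v Du x) \<bullet> Dw x - (A *v Dv x) \<bullet> Dw x \<partial>lebesgue_on \<Omega>)"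
      by (simp add: Dw_def matrix_vector_mult_diff_distrib inner_diff_left)
    also have "\<dots> = (\<integral>x. (A *v Du x) \<bullet> Dw x \<partial>lebesgue_on \<Omega>) - (\<integral>x. (A *v Dv x) \<bullet> Dw x \<partial>lebesgue_on \<Omega>)"
      by (intro Bochner_Integration.integral_diff L2_integrable_inner L2_matrix_vector LD Lw)
    also have "\<dots> = (\<integral>x. f x * w x \<partial>lebesgue_on \<Omega>) - (\<integral>x. (A *v Dv x) \<bullet> Dw x \<partial>lebesgue_on \<Omega>)"
      by (simp add: weak_solution[OF H10])
    also have "\<dots> = (\<integral>x. f x * w x - (A *v Dv x) \<bullet> Dw x \<partial>lebesgue_on \<Omega>)"
      by (intro Bochner_Integration.integral_diff[symmetric] L2_integrable_inner L2_integrable_mult Lq f Lw)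
    also have "\<dots> = (\<Sum>k=1..N. \<integral>x. f x * w x - (A *v Dv x) \<bullet> Dw x \<partial>lebesgue_on (\<omega> k))"
      by (intro integral_partition[OF partition \<Omega>(1)] Bochner_Integration.integrable_diff
          L2_integrable_inner L2_integrable_mult Lq f Lw)
    finally show ?thesis .
  qed
  \<comment> \<open>Here \<open>w\<close> is a legitimate test function in the definition of the
    normal trace: its trace \<open>t\<close> vanishes almost everywhere off the interior boundary of
    the cell.\<close>
  have flux: "(\<integral>x. y x \<bullet> Dw x + dy k x * w x \<partial>lebesgue_on (\<omega> k)) = (\<Sum>j\<in>neighbours \<omega> N k. a k j)"
    if k: "k \<in> {1..N}" for k
  proof -
    have g: "L2 (surface_on (interior_boundary \<omega> N k)) (g k)"
      using normal_traces[OF k] by (simp add: has_outer_normal_trace_def)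
    have sub: "interior_boundary \<omega> N k \<subseteq> frontier (\<omega> k)"
      unfolding interior_boundary_def
      by (intro UN_least interface_subset_frontier[OF partition k] neighboursD(1,2)) assumption+
    have "frontier (\<omega> k) \<in> sets surface" "L2 (surface_on (frontier (\<omega> k))) t"
      using t[OF k] by (simp_all add: has_trace_def borel_closed)
    then have "L2 (surface_on (interior_boundary \<omega> N k)) t"
      unfolding surface_on_def by (intro L2_restrict_subset(1)[OF interior_boundary_borel _ sub])
    then have "integrable (surface_on (interior_boundary \<omega> N k)) (\<lambda>x. g k x * t x)"
      by (rule L2_integrable_mult[OF g])
    moreover have "AE x in surface_on (frontier (\<omega> k) - interior_boundary \<omega> N k). t x = 0"
      by (rule skeleton_trace_vanishes[OF partition \<Omega>(1) k t0])
    then have "(\<integral>x. y x \<bullet> Dw x + dy k x * w x \<partial>lebesgue_on (\<omega> k))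
        = (\<integral>x. g k x * t x \<partial>surface_on (interior_boundary \<omega> N k))"
      using normal_traces[OF k] t[OF k] unfolding has_outer_normal_trace_def by blast
    ultimately show ?thesis
      by (simp add: a_def integral_interior_boundary[OF partition k])
  qed
  have cell_bound: "(\<integral>x. f x * w x - (A *v Dv x) \<bullet> Dw x \<partial>lebesgue_on (\<omega> k))
      \<le> Q k * m k + Max (CP ` {1..N}) * (R k * b k) - (\<Sum>j\<in>neighbours \<omega> N k. a k j)"
    if k: "k \<in> {1..N}" for k
  proof -
    note L = on_cell[OF k y(1)] on_cell[OF k Lw(2)] on_cell[OF k Lq] on_cell[OF k Lw(1)] on_cell[OF k f] Ldy[OF k]
    \<comment> \<open>Division by zero gives 0, so the mean value condition says something about the
      integral only because a cell has positive volume.\<close>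
    have "measure lebesgue (\<omega> k) > 0"
    proof -
      have "\<omega> k \<in> lmeasurable"
        using cell(1)[OF k] bounded_frontier_cell(1)[OF partition \<Omega>(2) k] by (simp add: lmeasurable_open)
      moreover have "\<not> negligible (\<omega> k)"
        using cell(1,3)[OF k] open_not_negligible by blast
      ultimately show ?thesis
        by (simp add: negligible_iff_measure zero_less_measure_iff)
    qed
    then have mean: "(\<integral>x. dy k x + f x \<partial>lebesgue_on (\<omega> k)) = 0"
      using A2[OF k] by simp
    have "(\<integral>x. (y x - A *v Dv x) \<bullet> Dw x \<partial>lebesgue_on (\<omega> k)) \<le> Q k * m k"
      unfolding Q_def m_def by (rule energy_inner_bound[OF L2_diff[OF L(1,3)] L(2)])
    moreover have "(\<integral>x. (dy k x + f x) * w x \<partial>lebesgue_on (\<omega> k)) \<le> Max (CP ` {1..N}) * (R k * b k)"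
    proof -
      have "H1 (\<omega> k) w Dw"
        using t[OF k] by (simp add: has_trace_def)
      then have "(\<integral>x. (dy k x + f x) * w x \<partial>lebesgue_on (\<omega> k)) \<le> R k * (CP k * b k)"
        unfolding R_def b_def
        by (intro mean_value_zero_bound[OF CP[OF k] cell(1)[OF k] bounded_frontier_cell(1)[OF partition \<Omega>(2) k]]
            L2_add[OF L(6,5)] mean)
      also have "\<dots> = CP k * (R k * b k)"
        by simp
      also have "\<dots> \<le> Max (CP ` {1..N}) * (R k * b k)"
        by (intro mult_right_mono CP_le[OF k]) (simp add: nonneg)
      finally show ?thesis .
    qed
    ultimately show ?thesis
      using broken_flux_identity[OF L] flux[OF k] by simp
  qed
  have jump: "\<bar>a k j + a j k\<bar> \<le> J k j * sqrt ((b k)\<^sup>2 + (b j)\<^sup>2)" if kj: "(k, j) \<in> E" for k j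
  proof -
    have k: "k \<in> {1..N}" and nb: "j \<in> neighbours \<omega> N k"
      using kj by (auto simp: E_def interfaces_def)
    note j = neighboursD[OF nb] and nb' = neighbours_sym[OF k nb]
    have sub: "interface \<omega> k j \<subseteq> interior_boundary \<omega> N k" "interface \<omega> k j \<subseteq> interior_boundary \<omega> N j"
      using nb nb' interface_commute[of \<omega> k j] by (auto simp: interior_boundary_def)
    have g: "L2 (surface_on (interface \<omega> k j)) (g k)" "L2 (surface_on (interface \<omega> k j)) (g j)"
      using normal_traces[OF k] normal_traces[OF j(1)]
        L2_restrict_subset(1)[OF interface_borel interior_boundary_borel sub(1)]
        L2_restrict_subset(1)[OF interface_borel interior_boundary_borel sub(2)]
      by (auto simp: has_outer_normal_trace_def surface_on_def)
    note kj' = kj[unfolded E_def]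
    \<comment> \<open>\<open>a j k\<close> is an integral over
      \<open>interface \<omega> j k\<close>, which has to be identified with
      \<open>interface \<omega> k j\<close> first.\<close>
    show ?thesis
      using interface_flux_bound[OF partition domain kj' t[OF k] t[OF j(1)] g normals[OF kj']
          conjunct1[OF CPt[OF kj']] conjunct2[OF CPt[OF kj']]] A1[OF kj']
      unfolding a_def J_def b_def yn_def interface_const_def interface_commute[of \<omega> j k] by simp
  qed

  have "M\<^sup>2 \<le> (\<Sum>k=1..N. Q k * m k + Max (CP ` {1..N}) * (R k * b k) - (\<Sum>j\<in>neighbours \<omega> N k. a k j))"
    unfolding energy by (intro sum_mono cell_bound)
  also have "\<dots> = (\<Sum>k=1..N. Q k * m k) + Max (CP ` {1..N}) * (\<Sum>k=1..N. R k * b k) - (\<Sum>(k, j)\<in>E. a k j + a j k)"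
    unfolding E_def sum_neighbours[where a=a, symmetric] by (simp add: sum.distrib sum_subtractf sum_distrib_left)
  also have "\<dots> \<le> sqrt (\<Sum>k=1..N. (Q k)\<^sup>2) * M + Max (CP ` {1..N}) * (sqrt (\<Sum>k=1..N. (R k)\<^sup>2) * B)
      + sqrt (\<Sum>(k, j)\<in>E. (J k j)\<^sup>2) * (sqrt (real (Emax \<omega> N)) * B)"
  proof -
    have "(\<Sum>k=1..N. Q k * m k) \<le> sqrt (\<Sum>k=1..N. (Q k)\<^sup>2) * M"
      using sum_mult_le_sqrt[of Q m "{1..N}"] nonneg(1) unfolding sum_m by simp
    moreover have "(\<Sum>k=1..N. R k * b k) \<le> sqrt (\<Sum>k=1..N. (R k)\<^sup>2) * B"
      using sum_mult_le_sqrt[of R b "{1..N}"] nonneg(2) unfolding sum_b by simp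
    then have "Max (CP ` {1..N}) * (\<Sum>k=1..N. R k * b k) \<le> Max (CP ` {1..N}) * (sqrt (\<Sum>k=1..N. (R k)\<^sup>2) * B)"
      using CP_max by (rule mult_left_mono)
    \<comment> \<open>The interface terms enter with a minus sign, which the absolute value in
      \<open>jump\<close> absorbs.\<close>
    moreover have "- (\<Sum>(k, j)\<in>E. a k j + a j k) \<le> sqrt (\<Sum>(k, j)\<in>E. (J k j)\<^sup>2) * (sqrt (real (Emax \<omega> N)) * B)"
    proof -
      have "- (\<Sum>(k, j)\<in>E. a k j + a j k) \<le> (\<Sum>p\<in>E. J (fst p) (snd p) * sqrt ((b (fst p))\<^sup>2 + (b (snd p))\<^sup>2))"
        unfolding sum_negf[symmetric]
      proof (rule sum_mono)
        fix p assume "p \<in> E"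
        then show "- (case p of (k, j) \<Rightarrow> a k j + a j k) \<le> J (fst p) (snd p) * sqrt ((b (fst p))\<^sup>2 + (b (snd p))\<^sup>2)"
          using jump[of "fst p" "snd p"] by (simp add: case_prod_unfold abs_le_iff)
      qed
      also have "\<dots> \<le> sqrt (\<Sum>p\<in>E. (J (fst p) (snd p))\<^sup>2) * sqrt (\<Sum>p\<in>E. (sqrt ((b (fst p))\<^sup>2 + (b (snd p))\<^sup>2))\<^sup>2)"
        by (rule sum_mult_le_sqrt)
      also have "(\<Sum>p\<in>E. (sqrt ((b (fst p))\<^sup>2 + (b (snd p))\<^sup>2))\<^sup>2) = (\<Sum>(k, j)\<in>E. (b k)\<^sup>2 + (b j)\<^sup>2)"
        by (simp add: case_prod_unfold)
      also have "sqrt (\<Sum>p\<in>E. (J (fst p) (snd p))\<^sup>2) * sqrt (\<Sum>(k, j)\<in>E. (b k)\<^sup>2 + (b j)\<^sup>2)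
          \<le> sqrt (\<Sum>p\<in>E. (J (fst p) (snd p))\<^sup>2) * (sqrt (real (Emax \<omega> N)) * B)"
      proof (rule mult_left_mono)
        \<comment> \<open>Here \<open>Emax\<close> arises: a cell gradient occurs in as many
          summands as its cell has interfaces.\<close>
        have "sqrt (\<Sum>(k, j)\<in>E. (b k)\<^sup>2 + (b j)\<^sup>2) \<le> sqrt (real (Emax \<omega> N) * B\<^sup>2)"
          unfolding E_def sum_b[symmetric] by (intro real_sqrt_le_mono sum_interfaces_le_Emax) simp
        then show "sqrt (\<Sum>(k, j)\<in>E. (b k)\<^sup>2 + (b j)\<^sup>2) \<le> sqrt (real (Emax \<omega> N)) * B"
          using nonneg(2) by (simp add: real_sqrt_mult)
      qed (simp add: sum_nonneg)
      finally show ?thesis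
        by (simp add: case_prod_unfold)
    qed
    ultimately show ?thesis
      by linarith
  qed
  finally have main: "M\<^sup>2 \<le> sqrt (\<Sum>k=1..N. (Q k)\<^sup>2) * M
      + (Max (CP ` {1..N}) * sqrt (\<Sum>k=1..N. (R k)\<^sup>2) + sqrt (real (Emax \<omega> N)) * sqrt (\<Sum>(k, j)\<in>E. (J k j)\<^sup>2)) * B"
    by (simp add: algebra_simps)
  define X where "X = sqrt (\<Sum>k=1..N. (Q k)\<^sup>2)"
  define Y where "Y = Max (CP ` {1..N}) * sqrt (\<Sum>k=1..N. (R k)\<^sup>2) + sqrt (real (Emax \<omega> N)) * sqrt (\<Sum>(k, j)\<in>E. (J k j)\<^sup>2)"
  have X: "X \<ge> 0"
    by (simp add: X_def sum_nonneg)
  have Y: "Y \<ge> 0"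
    unfolding Y_def using CP_max by (intro add_nonneg_nonneg mult_nonneg_nonneg) (auto intro!: sum_nonneg)
  \<comment> \<open>Only the residual and jump terms carry the plain gradient norm \<open>B\<close>,
    so the coercivity factor falls on \<open>Y\<close> and not on \<open>X\<close>.\<close>
  have "B \<le> M / sqrt Cmin"
    using L2norm_le_energy[OF Lw(2)] C_bounds(1) by (simp add: B_def M_def field_simps)
  then have "Y * B \<le> Y * (M / sqrt Cmin)"
    using Y by (rule mult_left_mono)
  moreover have "M * M \<le> X * M + Y * B"
    using main unfolding X_def Y_def power2_eq_square[of M] .
  ultimately have "M * M \<le> (X + 1 / sqrt Cmin * Y) * M"
    by (simp add: algebra_simps)
  \<comment> \<open>Cancelling one factor \<open>M\<close> requires \<open>M \<noteq> 0\<close>; for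
    \<open>M = 0\<close> the claim is that the right side is nonnegative.\<close>
  then have "M \<le> X + 1 / sqrt Cmin * Y"
    using nonneg(1) X Y C_bounds(1) by (cases "M = 0") auto
  then show ?thesis
    by (simp add: M_def Dw_def[abs_def] X_def Y_def Q_def R_def J_def E_def power_mult_distrib)
qed

end
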